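(* Let $\mathbf{P}$ be an operad with $\mathbf{P}(0)=(0)$ and all $\mathbf{P}(n)$ finite-dimensional. The abelianized algebra $S(\mathbf{P}^* )$ of $\mathbf{D}^*_{\mathbf{P}}=(T(\mathbf{P}^* ),m_{conc},\Delta_* )$ inherits a coproduct $\Delta_*$ making it a bialgebra. Moreover, $D^*_{\mathbf{P}}=S(\mathrm{inv}\,\mathbf{P}^* )$ is a subbialgebra of $S(\mathbf{P}^* )$.
   Context: The base field has characteristic zero. $\mathbf{P}=\bigoplus_{n\ge1}\mathbf{P}(n)$, $\mathbf{P}^*=\bigoplus_{n\ge1}\mathbf{P}^*(n)$ with $\mathbf{P}^*(n)=\mathbf{P}(n)^*$, carrying the dual action of $\mathfrak{S}_n$, $f^\sigma(p)=f(p^{\sigma^{-1}})$. $\mathrm{inv}\,\mathbf{P}^*=\bigoplus_n\{f\in\mathbf{P}^*(n)\mid f^\sigma=f\ \forall\sigma\in\mathfrak{S}_n\}$. On $T(\mathbf{P}^* )$ with the concatenation product, $\Delta_*$ is the algebra morphism with $\Delta_*(f)=\delta(f)$ for $f\in\mathbf{P}^*$, where $\delta:\mathbf{P}^*\to\mathbf{P}^*\otimes T(\mathbf{P}^* )$ is the transpose of the operadic composition: for $f\in\mathbf{P}^*(n)$, $\delta(f)\in\bigoplus_{p=1}^n\bigoplus_{k_1+\cdots+k_p=n}\mathbf{P}^*(p)\otimes\mathbf{P}^*(k_1)\cdots\mathbf{P}^*(k_p)$ and $\delta(f)(q\otimes q_1\cdots q_p)=f(q\circ(q_1,\ldots,q_p))$.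 This makes $\mathbf{D}^*_{\mathbf{P}}$ a bialgebra. *)

theory Defs
  imports
    "HOL-Algebra.QuotRing"
    "HOL-Algebra.Module"
    "HOL-Algebra.Subrings"
    "HOL-Library.Poly_Mapping"
    "HOL-Combinatorics.Permutations"
begin

section \<open>Algebras over a field\<close>

text \<open>The ground field is a type of class \<open>field\<close>. Vector spaces and (not necessarily commutative)
  algebras over it are HOL-Algebra records of type \<open>module\<close>; for a mere vector space the
  fields \<open>mult\<close> and \<open>one\<close> carry no information.\<close>

definition scalar_alg :: "('k::field, 'k) module" where
  "scalar_alg = \<lparr>carrier = UNIV, monoid.mult = (*), one = 1, zero = 0, add = (+), smult = (*)\<rparr>"

definition k_algebra :: "('k::field, 'a) module \<Rightarrow> bool" where
  "k_algebra A \<longleftrightarrow> ring A \<and> Module.module scalar_alg A \<and>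
     (\<forall>c. \<forall>x\<in>carrier A. \<forall>y\<in>carrier A.
        (c \<odot>\<^bsub>A\<^esub> x) \<otimes>\<^bsub>A\<^esub> y = c \<odot>\<^bsub>A\<^esub> (x \<otimes>\<^bsub>A\<^esub> y) \<and>
        x \<otimes>\<^bsub>A\<^esub> (c \<odot>\<^bsub>A\<^esub> y) = c \<odot>\<^bsub>A\<^esub> (x \<otimes>\<^bsub>A\<^esub> y))"

definition alg_hom :: "('k::field, 'a) module \<Rightarrow> ('k, 'b) module \<Rightarrow> ('a \<Rightarrow> 'b) set" where
  "alg_hom A B = {h \<in> ring_hom A B. \<forall>c. \<forall>x\<in>carrier A. h (c \<odot>\<^bsub>A\<^esub> x) = c \<odot>\<^bsub>B\<^esub> h x}"

text \<open>Quotient by a two-sided ideal; \<open>I\<close> may also be just a subspace, if only the vector space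
  structure of the quotient is used.\<close>

definition quot_alg :: "('k::field, 'a) module \<Rightarrow> 'a set \<Rightarrow> ('k, 'a set) module" where
  "quot_alg A I = ring.extend (A Quot I) (module.fields (\<lambda>c X. \<Union>x\<in>X. I +>\<^bsub>A\<^esub> (c \<odot>\<^bsub>A\<^esub> x)))"

definition pm_scale :: "'k::field \<Rightarrow> ('x \<Rightarrow>\<^sub>0 'k) \<Rightarrow> ('x \<Rightarrow>\<^sub>0 'k)" where
  "pm_scale c F = Poly_Mapping.map (\<lambda>d. c * d) F"

text \<open>The monoid algebra: the free vector space on the carrier of \<open>M\<close>, with the bilinear extension
  of the multiplication of \<open>M\<close>.\<close>

definition monoid_alg :: "('x, 'm) monoid_scheme \<Rightarrow> ('k::field, 'x \<Rightarrow>\<^sub>0 'k) module" where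
  "monoid_alg M =
    \<lparr>carrier = {F. Poly_Mapping.keys F \<subseteq> carrier M},
     monoid.mult = (\<lambda>F G. \<Sum>u\<in>Poly_Mapping.keys F. \<Sum>v\<in>Poly_Mapping.keys G.
               Poly_Mapping.single (u \<otimes>\<^bsub>M\<^esub> v) (Poly_Mapping.lookup F u * Poly_Mapping.lookup G v)),
     one = Poly_Mapping.single \<one>\<^bsub>M\<^esub> 1,
     zero = 0,
     add = (+),
     smult = pm_scale\<rparr>"

text \<open>The linear map, into \<open>C\<close>, induced by \<open>b\<close> on a quotient of a free vector space; it is only
  applied when the linear extension of \<open>b\<close> is constant on the cosets.\<close>

definition lin_lift :: "('k::field, 'c) module \<Rightarrow> ('x \<Rightarrow> 'c) \<Rightarrow> ('x \<Rightarrow>\<^sub>0 'k) set \<Rightarrow> 'c" where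
  "lin_lift C b X = (let F = (SOME F. F \<in> X) in
     \<Oplus>\<^bsub>C\<^esub>x\<in>Poly_Mapping.keys F. Poly_Mapping.lookup F x \<odot>\<^bsub>C\<^esub> b x)"


section \<open>Tensor products\<close>

definition tensor_rels ::
  "('k::field, 'a) module \<Rightarrow> ('k, 'b) module \<Rightarrow> ('a \<times> 'b \<Rightarrow>\<^sub>0 'k) set" where
  "tensor_rels A B =
    {Poly_Mapping.single (a \<oplus>\<^bsub>A\<^esub> a', b) 1 - Poly_Mapping.single (a, b) 1
       - Poly_Mapping.single (a', b) 1 | a a' b. a \<in> carrier A \<and> a' \<in> carrier A \<and> b \<in> carrier B} \<union>
    {Poly_Mapping.single (a, b \<oplus>\<^bsub>B\<^esub> b') 1 - Poly_Mapping.single (a, b) 1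
       - Poly_Mapping.single (a, b') 1 | a b b'. a \<in> carrier A \<and> b \<in> carrier B \<and> b' \<in> carrier B} \<union>
    {Poly_Mapping.single (c \<odot>\<^bsub>A\<^esub> a, b) 1 - Poly_Mapping.single (a, b) c
       | c a b. a \<in> carrier A \<and> b \<in> carrier B} \<union>
    {Poly_Mapping.single (a, c \<odot>\<^bsub>B\<^esub> b) 1 - Poly_Mapping.single (a, b) c
       | c a b. a \<in> carrier A \<and> b \<in> carrier B}"

definition tensor_null ::
  "('k::field, 'a) module \<Rightarrow> ('k, 'b) module \<Rightarrow> ('a \<times> 'b \<Rightarrow>\<^sub>0 'k) set" where
  "tensor_null A B = module.span pm_scale (tensor_rels A B)"

text \<open>The vector space \<open>A \<otimes> B\<close>. If \<open>A\<close> and \<open>B\<close> are algebras, then \<open>tensor_null A B\<close> is an ideal and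
  the product is the usual one, \<open>(a \<otimes> b)(a' \<otimes> b') = aa' \<otimes> bb'\<close>.\<close>

definition tensor ::
  "('k::field, 'a) module \<Rightarrow> ('k, 'b) module \<Rightarrow> ('k, ('a \<times> 'b \<Rightarrow>\<^sub>0 'k) set) module" where
  "tensor A B = quot_alg (monoid_alg (A \<times>\<times> B)) (tensor_null A B)"

definition pure ::
  "('k::field, 'a) module \<Rightarrow> ('k, 'b) module \<Rightarrow> 'a \<Rightarrow> 'b \<Rightarrow> ('a \<times> 'b \<Rightarrow>\<^sub>0 'k) set" where
  "pure A B a b =
     tensor_null A B +>\<^bsub>(monoid_alg (A \<times>\<times> B) :: ('k, 'a \<times> 'b \<Rightarrow>\<^sub>0 'k) module)\<^esub> Poly_Mapping.single (a, b) 1"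

text \<open>\<open>tensor_map C D f g\<close> is \<open>f \<otimes> g\<close>, with values in \<open>C \<otimes> D\<close>.\<close>

definition tensor_map ::
  "('k::field, 'c) module \<Rightarrow> ('k, 'd) module \<Rightarrow> ('a \<Rightarrow> 'c) \<Rightarrow> ('b \<Rightarrow> 'd) \<Rightarrow>
   ('a \<times> 'b \<Rightarrow>\<^sub>0 'k) set \<Rightarrow> ('c \<times> 'd \<Rightarrow>\<^sub>0 'k) set" where
  "tensor_map C D f g = lin_lift (tensor C D) (\<lambda>(a, b). pure C D (f a) (g b))"

definition tensor_assoc ::
  "('k::field, 'a) module \<Rightarrow> ('k, 'b) module \<Rightarrow> ('k, 'c) module \<Rightarrow>
   (('a \<times> 'b \<Rightarrow>\<^sub>0 'k) set \<times> 'c \<Rightarrow>\<^sub>0 'k) set \<Rightarrow> ('a \<times> ('b \<times> 'c \<Rightarrow>\<^sub>0 'k) set \<Rightarrow>\<^sub>0 'k) set" where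
  "tensor_assoc A B C =
     lin_lift (tensor A (tensor B C))
       (\<lambda>(X, c). lin_lift (tensor A (tensor B C))
          (\<lambda>(a, b). pure A (tensor B C) a (pure B C b c)) X)"


section \<open>Bialgebras\<close>

definition bialgebra ::
  "('k::field, 'a) module \<Rightarrow> ('a \<Rightarrow> ('a \<times> 'a \<Rightarrow>\<^sub>0 'k) set) \<Rightarrow> ('a \<Rightarrow> 'k) \<Rightarrow> bool" where
  "bialgebra A \<Delta> \<epsilon> \<longleftrightarrow>
     k_algebra A \<and>
     \<Delta> \<in> alg_hom A (tensor A A) \<and>
     \<epsilon> \<in> alg_hom A scalar_alg \<and>
     (\<forall>x\<in>carrier A.
        tensor_assoc A A A (tensor_map (tensor A A) A \<Delta> (\<lambda>y. y) (\<Delta> x)) =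
        tensor_map A (tensor A A) (\<lambda>y. y) \<Delta> (\<Delta> x)) \<and>
     (\<forall>x\<in>carrier A. lin_lift A (\<lambda>(a, b). \<epsilon> a \<odot>\<^bsub>A\<^esub> b) (\<Delta> x) = x) \<and>
     (\<forall>x\<in>carrier A. lin_lift A (\<lambda>(a, b). \<epsilon> b \<odot>\<^bsub>A\<^esub> a) (\<Delta> x) = x)"

text \<open>A subalgebra \<open>B\<close> of \<open>A\<close> such that \<open>\<Delta>\<close> maps \<open>B\<close> to the image of \<open>B \<otimes> B\<close> in \<open>A \<otimes> A\<close>.\<close>

definition subbialgebra ::
  "('k::field, 'a) module \<Rightarrow> ('a \<Rightarrow> ('a \<times> 'a \<Rightarrow>\<^sub>0 'k) set) \<Rightarrow> 'a set \<Rightarrow> bool" where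
  "subbialgebra A \<Delta> B \<longleftrightarrow>
     subring B A \<and> submodule B scalar_alg A \<and>
     \<Delta> ` B \<subseteq> tensor_map A A (\<lambda>y. y) (\<lambda>y. y) ` carrier (tensor (A\<lparr>carrier := B\<rparr>) (A\<lparr>carrier := B\<rparr>))"


section \<open>Tensor and symmetric algebras\<close>

definition free_monoid :: "'v set \<Rightarrow> 'v list monoid" where
  "free_monoid X = \<lparr>carrier = lists X, monoid.mult = (@), one = []\<rparr>"

definition free_alg :: "('k::field, 'v) module \<Rightarrow> ('k, 'v list \<Rightarrow>\<^sub>0 'k) module" where
  "free_alg V = monoid_alg (free_monoid (carrier V))"

text \<open>\<open>T(V)\<close> is the free algebra on the set \<open>V\<close> modulo the relations making \<open>V \<rightarrow> T(V)\<close> linear.\<close>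

definition tensor_alg_ideal :: "('k::field, 'v) module \<Rightarrow> ('v list \<Rightarrow>\<^sub>0 'k) set" where
  "tensor_alg_ideal V = genideal (free_alg V)
     ({Poly_Mapping.single [v \<oplus>\<^bsub>V\<^esub> w] 1 - Poly_Mapping.single [v] 1 - Poly_Mapping.single [w] 1
         | v w. v \<in> carrier V \<and> w \<in> carrier V} \<union>
      {Poly_Mapping.single [c \<odot>\<^bsub>V\<^esub> v] 1 - Poly_Mapping.single [v] c | c v. v \<in> carrier V})"

definition tensor_alg :: "('k::field, 'v) module \<Rightarrow> ('k, ('v list \<Rightarrow>\<^sub>0 'k) set) module" where
  "tensor_alg V = quot_alg (free_alg V) (tensor_alg_ideal V)"

definition tensor_alg_inc :: "('k::field, 'v) module \<Rightarrow> 'v \<Rightarrow> ('v list \<Rightarrow>\<^sub>0 'k) set" where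
  "tensor_alg_inc V v = tensor_alg_ideal V +>\<^bsub>free_alg V\<^esub> Poly_Mapping.single [v] 1"

text \<open>The algebra morphism from \<open>T(V)\<close> to \<open>A\<close> extending a linear map \<open>g\<close> from \<open>V\<close> to \<open>A\<close>.\<close>

definition tensor_alg_lift ::
  "('k::field, 'a) module \<Rightarrow> ('v \<Rightarrow> 'a) \<Rightarrow> ('v list \<Rightarrow>\<^sub>0 'k) set \<Rightarrow> 'a" where
  "tensor_alg_lift A g = lin_lift A (\<lambda>vs. foldr (\<lambda>v x. g v \<otimes>\<^bsub>A\<^esub> x) vs \<one>\<^bsub>A\<^esub>)"

definition commutator_ideal :: "('k::field, 'a) module \<Rightarrow> 'a set" where
  "commutator_ideal A =
     genideal A {(x \<otimes>\<^bsub>A\<^esub> y) \<ominus>\<^bsub>A\<^esub> (y \<otimes>\<^bsub>A\<^esub> x) | x y. x \<in> carrier A \<and> y \<in> carrier A}"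

definition abelianization :: "('k::field, 'a) module \<Rightarrow> ('k, 'a set) module" where
  "abelianization A = quot_alg A (commutator_ideal A)"

definition abel_proj :: "('k::field, 'a) module \<Rightarrow> 'a \<Rightarrow> 'a set" where
  "abel_proj A x = commutator_ideal A +>\<^bsub>A\<^esub> x"

definition sym_alg :: "('k::field, 'v) module \<Rightarrow> ('k, ('v list \<Rightarrow>\<^sub>0 'k) set set) module" where
  "sym_alg V = abelianization (tensor_alg V)"

definition sym_alg_inc :: "('k::field, 'v) module \<Rightarrow> 'v \<Rightarrow> ('v list \<Rightarrow>\<^sub>0 'k) set set" where
  "sym_alg_inc V v = abel_proj (tensor_alg V) (tensor_alg_inc V v)"


section \<open>Operads\<close>

text \<open>\<open>block_perm ks \<sigma> \<tau>\<close> cuts the interval of length \<open>sum_list ks\<close> into consecutive blocks of lengths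
  \<open>ks ! 0, ks ! 1, \<dots>\<close>, applies \<open>\<tau> i\<close> inside block \<open>i\<close>, and moves block \<open>i\<close> to place \<open>\<sigma> i\<close>, so that
  block number \<open>l\<close> of the result has length \<open>ks ! (\<sigma>\<inverse> l)\<close>.\<close>

definition block_perm :: "nat list \<Rightarrow> (nat \<Rightarrow> nat) \<Rightarrow> (nat \<Rightarrow> nat \<Rightarrow> nat) \<Rightarrow> nat \<Rightarrow> nat" where
  "block_perm ks \<sigma> \<tau> x =
    (if x < sum_list ks
     then let i = (LEAST i. x < sum_list (take (Suc i) ks));
              j = x - sum_list (take i ks)
          in (\<Sum>l<\<sigma> i. ks ! inv_into UNIV \<sigma> l) + \<tau> i j
     else x)"

text \<open>Symmetric operads of vector spaces. The component of arity \<open>n\<close> is the subspace \<open>P n\<close> of an ambient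
  space; \<open>act n \<sigma> p\<close> is \<open>p\<^sup>\<sigma>\<close> for \<open>\<sigma>\<close> a permutation of \<open>{..<n}\<close>, and
  \<open>\<gamma> q [(k\<^sub>0, q\<^sub>0), \<dots>, (k\<^sub>n\<^sub>-\<^sub>1, q\<^sub>n\<^sub>-\<^sub>1)]\<close> is \<open>q \<circ> (q\<^sub>0, \<dots>, q\<^sub>n\<^sub>-\<^sub>1)\<close> for \<open>q \<in> P n\<close> and \<open>q\<^sub>i \<in> P k\<^sub>i\<close>. Arities are recorded
  explicitly because the components need not be disjoint.

  The actions are right actions; the equivariance axioms are those satisfied by multilinear maps
  with \<open>p\<^sup>\<sigma>(x\<^sub>0, \<dots>, x\<^sub>n\<^sub>-\<^sub>1) = p(x\<^bsub>\<sigma>\<inverse>(0)\<^esub>, \<dots>, x\<^bsub>\<sigma>\<inverse>(n-1)\<^esub>)\<close>.\<close>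

locale operad = vector_space scale
  for scale :: "'k::field \<Rightarrow> 'a::ab_group_add \<Rightarrow> 'a" +
  fixes P :: "nat \<Rightarrow> 'a set"
    and act :: "nat \<Rightarrow> (nat \<Rightarrow> nat) \<Rightarrow> 'a \<Rightarrow> 'a"
    and \<gamma> :: "'a \<Rightarrow> (nat \<times> 'a) list \<Rightarrow> 'a"
    and e :: 'a
  assumes subspace_P: "subspace (P n)"
    and act_closed: "\<sigma> permutes {..<n} \<Longrightarrow> p \<in> P n \<Longrightarrow> act n \<sigma> p \<in> P n"
    and act_add: "\<sigma> permutes {..<n} \<Longrightarrow> p \<in> P n \<Longrightarrow> q \<in> P n \<Longrightarrow>
      act n \<sigma> (p + q) = act n \<sigma> p + act n \<sigma> q"
    and act_scale: "\<sigma> permutes {..<n} \<Longrightarrow> p \<in> P n \<Longrightarrow> act n \<sigma> (scale c p) = scale c (act n \<sigma> p)"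
    and act_id: "p \<in> P n \<Longrightarrow> act n id p = p"
    and act_comp: "\<sigma> permutes {..<n} \<Longrightarrow> \<tau> permutes {..<n} \<Longrightarrow> p \<in> P n \<Longrightarrow>
      act n (\<sigma> \<circ> \<tau>) p = act n \<tau> (act n \<sigma> p)"
    and comp_closed: "ws \<in> lists (Sigma UNIV P) \<Longrightarrow> q \<in> P (length ws) \<Longrightarrow>
      \<gamma> q ws \<in> P (sum_list (map fst ws))"
    and comp_add_left: "ws \<in> lists (Sigma UNIV P) \<Longrightarrow> q \<in> P (length ws) \<Longrightarrow> q' \<in> P (length ws) \<Longrightarrow>
      \<gamma> (q + q') ws = \<gamma> q ws + \<gamma> q' ws"
    and comp_scale_left: "ws \<in> lists (Sigma UNIV P) \<Longrightarrow> q \<in> P (length ws) \<Longrightarrow>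
      \<gamma> (scale c q) ws = scale c (\<gamma> q ws)"
    and comp_add_right: "us \<in> lists (Sigma UNIV P) \<Longrightarrow> vs \<in> lists (Sigma UNIV P) \<Longrightarrow>
      r \<in> P k \<Longrightarrow> r' \<in> P k \<Longrightarrow> q \<in> P (length us + 1 + length vs) \<Longrightarrow>
      \<gamma> q (us @ [(k, r + r')] @ vs) = \<gamma> q (us @ [(k, r)] @ vs) + \<gamma> q (us @ [(k, r')] @ vs)"
    and comp_scale_right: "us \<in> lists (Sigma UNIV P) \<Longrightarrow> vs \<in> lists (Sigma UNIV P) \<Longrightarrow>
      r \<in> P k \<Longrightarrow> q \<in> P (length us + 1 + length vs) \<Longrightarrow>
      \<gamma> q (us @ [(k, scale c r)] @ vs) = scale c (\<gamma> q (us @ [(k, r)] @ vs))"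
    and unit_closed: "e \<in> P 1"
    and unit_left: "q \<in> P k \<Longrightarrow> \<gamma> e [(k, q)] = q"
    and unit_right: "q \<in> P n \<Longrightarrow> \<gamma> q (replicate n (1, e)) = q"
    and comp_assoc: "ws \<in> lists (Sigma UNIV P) \<Longrightarrow> q \<in> P (length ws) \<Longrightarrow>
      uss \<in> lists (lists (Sigma UNIV P)) \<Longrightarrow> map length uss = map fst ws \<Longrightarrow>
      \<gamma> (\<gamma> q ws) (concat uss) =
      \<gamma> q (map2 (\<lambda>(k, r) us. (sum_list (map fst us), \<gamma> r us)) ws uss)"
    and equivariance_outer: "ws \<in> lists (Sigma UNIV P) \<Longrightarrow> q \<in> P (length ws) \<Longrightarrow>
      \<sigma> permutes {..<length ws} \<Longrightarrow>
      \<gamma> (act (length ws) \<sigma> q) ws =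
      act (sum_list (map fst ws)) (block_perm (map fst ws) \<sigma> (\<lambda>i. id))
        (\<gamma> q (map (\<lambda>l. ws ! inv_into UNIV \<sigma> l) [0..<length ws]))"
    and equivariance_inner: "ws \<in> lists (Sigma UNIV P) \<Longrightarrow> q \<in> P (length ws) \<Longrightarrow>
      (\<And>i. i < length ws \<Longrightarrow> \<tau>s i permutes {..<fst (ws ! i)}) \<Longrightarrow>
      \<gamma> q (map (\<lambda>i. (fst (ws ! i), act (fst (ws ! i)) (\<tau>s i) (snd (ws ! i)))) [0..<length ws]) =
      act (sum_list (map fst ws)) (block_perm (map fst ws) id \<tau>s) (\<gamma> q ws)"


section \<open>The dual of an operad and its coproduct\<close>

text \<open>Linear forms on a subspace \<open>W\<close> are represented by functions that vanish outside \<open>W\<close>.\<close>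

definition dual_of :: "('k::field \<Rightarrow> 'a::ab_group_add \<Rightarrow> 'a) \<Rightarrow> 'a set \<Rightarrow> ('a \<Rightarrow> 'k) set" where
  "dual_of scale W = {\<phi>. (\<forall>x\<in>W. \<forall>y\<in>W. \<phi> (x + y) = \<phi> x + \<phi> y) \<and>
     (\<forall>c. \<forall>x\<in>W. \<phi> (scale c x) = c * \<phi> x) \<and> (\<forall>x. x \<notin> W \<longrightarrow> \<phi> x = 0)}"

text \<open>The direct sum of the duals of \<open>P n\<close> for \<open>n \<ge> 1\<close>.\<close>

definition dual_operad ::
  "('k::field \<Rightarrow> 'a::ab_group_add \<Rightarrow> 'a) \<Rightarrow> (nat \<Rightarrow> 'a set) \<Rightarrow> ('k, nat \<Rightarrow> 'a \<Rightarrow> 'k) module" where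
  "dual_operad scale P =
    \<lparr>carrier = {f. (\<forall>n. f n \<in> dual_of scale (P n)) \<and> f 0 = (\<lambda>p. 0) \<and> finite {n. f n \<noteq> (\<lambda>p. 0)}},
     monoid.mult = undefined, one = undefined,
     zero = (\<lambda>n p. 0), add = (\<lambda>f g n p. f n p + g n p), smult = (\<lambda>c f n p. c * f n p)\<rparr>"

definition dual_act ::
  "(nat \<Rightarrow> 'a set) \<Rightarrow> (nat \<Rightarrow> (nat \<Rightarrow> nat) \<Rightarrow> 'a \<Rightarrow> 'a) \<Rightarrow> nat \<Rightarrow> (nat \<Rightarrow> nat) \<Rightarrow>
   ('a \<Rightarrow> 'k::field) \<Rightarrow> 'a \<Rightarrow> 'k" where
  "dual_act P act n \<sigma> \<phi> = (\<lambda>p. if p \<in> P n then \<phi> (act n (inv_into UNIV \<sigma>) p) else 0)"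

definition inv_dual ::
  "('k::field \<Rightarrow> 'a::ab_group_add \<Rightarrow> 'a) \<Rightarrow> (nat \<Rightarrow> 'a set) \<Rightarrow>
   (nat \<Rightarrow> (nat \<Rightarrow> nat) \<Rightarrow> 'a \<Rightarrow> 'a) \<Rightarrow> ('k, nat \<Rightarrow> 'a \<Rightarrow> 'k) module" where
  "inv_dual scale P act = (dual_operad scale P)
     \<lparr>carrier := {f \<in> carrier (dual_operad scale P).
                    \<forall>n \<sigma>. \<sigma> permutes {..<n} \<longrightarrow> dual_act P act n \<sigma> (f n) = f n}\<rparr>"

text \<open>The value of an element of \<open>T(P\<^sup>*)\<close> on the word \<open>q\<^sub>1\<dots>q\<^sub>p\<close> with \<open>q\<^sub>i \<in> P k\<^sub>i\<close>:
  \<open>(f\<^sub>1\<dots>f\<^sub>m)(q\<^sub>1\<dots>q\<^sub>p)\<close> is \<open>f\<^sub>1(q\<^sub>1)\<dots>f\<^sub>p(q\<^sub>p)\<close> if \<open>m = p\<close>, and 0 otherwise.\<close>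

definition word_eval ::
  "(nat \<times> 'a) list \<Rightarrow> ((nat \<Rightarrow> 'a \<Rightarrow> 'k::field) list \<Rightarrow>\<^sub>0 'k) set \<Rightarrow> 'k" where
  "word_eval ws = lin_lift scalar_alg
     (\<lambda>fs. if length fs = length ws then prod_list (map2 (\<lambda>f (k, q). f k q) fs ws) else 0)"

text \<open>The value of an element of \<open>P\<^sup>* \<otimes> T(P\<^sup>*)\<close> on \<open>q \<otimes> q\<^sub>1\<dots>q\<^sub>p\<close> with \<open>q \<in> P n\<close>.\<close>

definition pairing ::
  "nat \<Rightarrow> 'a \<Rightarrow> (nat \<times> 'a) list \<Rightarrow>
   ((nat \<Rightarrow> 'a \<Rightarrow> 'k::field) \<times> ((nat \<Rightarrow> 'a \<Rightarrow> 'k) list \<Rightarrow>\<^sub>0 'k) set \<Rightarrow>\<^sub>0 'k) set \<Rightarrow> 'k" where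
  "pairing n q ws = lin_lift scalar_alg (\<lambda>(f, t). f n q * word_eval ws t)"

text \<open>The transpose of the operadic composition. The composition \<open>q \<circ> (q\<^sub>1, \<dots>, q\<^sub>p)\<close> of \<open>q \<in> P n\<close> only
  exists for \<open>n = p\<close>; all other pairings with \<open>\<delta>(f)\<close> are 0.\<close>

definition delta ::
  "('k::field \<Rightarrow> 'a::ab_group_add \<Rightarrow> 'a) \<Rightarrow> (nat \<Rightarrow> 'a set) \<Rightarrow> ('a \<Rightarrow> (nat \<times> 'a) list \<Rightarrow> 'a) \<Rightarrow>
   (nat \<Rightarrow> 'a \<Rightarrow> 'k) \<Rightarrow> ((nat \<Rightarrow> 'a \<Rightarrow> 'k) \<times> ((nat \<Rightarrow> 'a \<Rightarrow> 'k) list \<Rightarrow>\<^sub>0 'k) set \<Rightarrow>\<^sub>0 'k) set" where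
  "delta scale P \<gamma> f = (THE X.
     X \<in> carrier (tensor (dual_operad scale P) (tensor_alg (dual_operad scale P))) \<and>
     (\<forall>n. \<forall>q\<in>P n. \<forall>ws\<in>lists (Sigma UNIV P).
        pairing n q ws X =
        (if length ws = n then f (sum_list (map fst ws)) (\<gamma> q ws) else 0)))"

text \<open>The coproduct of \<open>T(P\<^sup>*)\<close>: the algebra morphism extending \<open>\<delta>\<close>, where \<open>P\<^sup>* \<otimes> T(P\<^sup>*)\<close> is mapped
  canonically to \<open>T(P\<^sup>*) \<otimes> T(P\<^sup>*)\<close>.\<close>

definition Delta_star ::
  "('k::field \<Rightarrow> 'a::ab_group_add \<Rightarrow> 'a) \<Rightarrow> (nat \<Rightarrow> 'a set) \<Rightarrow> ('a \<Rightarrow> (nat \<times> 'a) list \<Rightarrow> 'a) \<Rightarrow>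
   ((nat \<Rightarrow> 'a \<Rightarrow> 'k) list \<Rightarrow>\<^sub>0 'k) set \<Rightarrow>
   (((nat \<Rightarrow> 'a \<Rightarrow> 'k) list \<Rightarrow>\<^sub>0 'k) set \<times> ((nat \<Rightarrow> 'a \<Rightarrow> 'k) list \<Rightarrow>\<^sub>0 'k) set \<Rightarrow>\<^sub>0 'k) set" where
  "Delta_star scale P \<gamma> =
     (let V = dual_operad scale P; T = tensor_alg V in
      tensor_alg_lift (tensor T T)
        (\<lambda>f. tensor_map T T (tensor_alg_inc V) (\<lambda>t. t) (delta scale P \<gamma> f)))"

end

theory Submission
  imports Defs
begin

text \<open>Evaluation of an element of \<open>T(P\<^sup>*)\<close> on a word of operations \<open>q\<^sub>1\<dots>q\<^sub>m\<close> separates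
  \<open>T(P\<^sup>*)\<close> and its tensor powers, and \<open>\<Delta>\<^sub>*\<close> is dual to the blockwise composition of words:
  \<open>(ev\<^sub>y \<otimes> ev\<^sub>z)(\<Delta>\<^sub>* t)\<close> is \<open>ev\<^bsub>y \<circ> z\<^esub>(t)\<close> if the length of \<open>z\<close> is the total arity of \<open>y\<close>, and 0 otherwise.
  Hence coassociativity is associativity of the composition. Since \<open>S(P\<^sup>*)\<close> is a quotient of
  \<open>T(P\<^sup>*)\<close> and \<open>S(P\<^sup>*) \<otimes> S(P\<^sup>*)\<close> is commutative, the structure descends.

  For the invariants, let \<open>\<pi>\<close> be the averaging projection of \<open>P\<^sup>*\<close> onto \<open>inv P\<^sup>*\<close>. It induces a left
  inverse of \<open>S(inv P\<^sup>*) \<rightarrow> S(P\<^sup>*)\<close>. For invariant \<open>f\<close>, the equivariance axioms show that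
  \<open>(\<pi> \<otimes> T(\<pi>)) (\<delta> f)\<close> is \<open>\<delta> f\<close> with its right factor symmetrized; in \<open>P\<^sup>* \<otimes> S(P\<^sup>*)\<close> both have the
  same image, which therefore lies in \<open>inv P\<^sup>* \<otimes> S(inv P\<^sup>*)\<close>.\<close>

section \<open>Vector spaces and linear maps\<close>

text \<open>The coproduct is prescribed only by its values, so the existence of
  \<open>\<delta> f\<close> is the first obstacle. A multilinear form on \<open>P k1\<close>, ...,
  \<open>P km\<close> comes from a tensor of linear forms because the components are
  finite-dimensional, and finitely many arity lists suffice because \<open>P 0\<close> is zero: all
  arities are then positive, and their sum is bounded by the top arity occurring in
  \<open>f\<close>. Uniqueness comes from pairing with operations. This pairing is shown to be
  faithful for any point-separating family of forms and without bases, since the spaces here consist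
  of cosets of formal sums and have no normal forms. Evaluating a product cuts the word of
  operations, and the arity of each letter of \<open>y\<close> dictates the only cut of
  \<open>z\<close> that survives; this is how a multiplicative map becomes dual to composition. For
  invariant \<open>f\<close>, averaging the letters in the right factor of \<open>\<delta> f\<close>
  changes nothing, whereas averaging the left factor permutes these letters. Only a commutative
  quotient ignores their order, hence the passage to symmetric algebras.\<close>

lemma (in abelian_group) minus_add_cancel:
  "x \<in> carrier G \<Longrightarrow> y \<in> carrier G \<Longrightarrow> x \<ominus> y \<oplus> y = x"
  by (simp add: a_minus_def a_assoc l_neg)

lemma (in abelian_group) add_minus_cancel:
  "x \<in> carrier G \<Longrightarrow> y \<in> carrier G \<Longrightarrow> x \<oplus> y \<ominus> y = x"
  by (simp add: a_minus_def a_assoc r_neg)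

lemma scalar_alg_simps [simp]:
  "carrier scalar_alg = UNIV" "x \<otimes>\<^bsub>scalar_alg\<^esub> y = x * y" "\<one>\<^bsub>scalar_alg\<^esub> = 1"
  "\<zero>\<^bsub>scalar_alg\<^esub> = 0" "x \<oplus>\<^bsub>scalar_alg\<^esub> y = x + y" "x \<odot>\<^bsub>scalar_alg\<^esub> y = x * y"
  by (simp_all add: scalar_alg_def)

lemma cring_scalar_alg: "cring (scalar_alg :: ('k::field, 'k) module)"
proof (rule cringI)
  show "abelian_group (scalar_alg :: ('k::field, 'k) module)"
    by (rule abelian_groupI) (auto simp: algebra_simps intro: exI[of _ "- x" for x])
  show "comm_monoid (scalar_alg :: ('k::field, 'k) module)"
    by (rule comm_monoidI) (auto simp: algebra_simps)
qed (auto simp: algebra_simps)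

abbreviation vsp :: "('k::field, 'a) module \<Rightarrow> bool" where
  "vsp A \<equiv> Module.module scalar_alg A"

text \<open>The negative of \<open>x\<close> is \<open>(-1) \<odot> x\<close>, so the law
  \<open>0 \<odot> x = \<zero>\<close> stands in for additive inverses.\<close>

lemma vspI:
  fixes A :: "('k::field, 'a) module" (structure)
  assumes "\<And>x y. x \<in> carrier A \<Longrightarrow> y \<in> carrier A \<Longrightarrow> x \<oplus> y \<in> carrier A"
    and "\<zero> \<in> carrier A"
    and "\<And>c x. x \<in> carrier A \<Longrightarrow> c \<odot> x \<in> carrier A"
    and "\<And>x y z. x \<in> carrier A \<Longrightarrow> y \<in> carrier A \<Longrightarrow> z \<in> carrier A \<Longrightarrow> (x \<oplus> y) \<oplus> z = x \<oplus> (y \<oplus> z)"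
    and "\<And>x y. x \<in> carrier A \<Longrightarrow> y \<in> carrier A \<Longrightarrow> x \<oplus> y = y \<oplus> x"
    and "\<And>x. x \<in> carrier A \<Longrightarrow> \<zero> \<oplus> x = x"
    and "\<And>c x y. x \<in> carrier A \<Longrightarrow> y \<in> carrier A \<Longrightarrow> c \<odot> (x \<oplus> y) = c \<odot> x \<oplus> c \<odot> y"
    and "\<And>c d x. x \<in> carrier A \<Longrightarrow> (c + d) \<odot> x = c \<odot> x \<oplus> d \<odot> x"
    and "\<And>c d x. x \<in> carrier A \<Longrightarrow> (c * d) \<odot> x = c \<odot> (d \<odot> x)"
    and "\<And>x. x \<in> carrier A \<Longrightarrow> 1 \<odot> x = x"
    and "\<And>x. x \<in> carrier A \<Longrightarrow> 0 \<odot> x = \<zero>"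
  shows "vsp A"
proof (rule moduleI)
  show "abelian_group A"
  proof (rule abelian_groupI)
    fix x assume x: "x \<in> carrier A"
    have "(-1) \<odot> x \<oplus> x = (-1 + 1) \<odot> x"
      unfolding assms(8)[OF x] using assms(10)[OF x] by simp
    then show "\<exists>y\<in>carrier A. y \<oplus> x = \<zero>"
      using assms(3,11) x by (intro bexI[of _ "(-1) \<odot> x"]) auto
  qed (use assms in auto)
qed (use assms cring_scalar_alg in auto)

text \<open>Each axiom is lifted along a choice of preimages and checked in \<open>A\<close>;
  quotients become vector spaces in this way without any verification of axioms on cosets.\<close>

lemma vsp_image:
  fixes A :: "('k::field, 'a) module" and Q :: "('k, 'b) module"
  assumes "vsp A" and surj: "\<pi> ` carrier A = carrier Q"
    and add: "\<And>x y. x \<in> carrier A \<Longrightarrow> y \<in> carrier A \<Longrightarrow> \<pi> (x \<oplus>\<^bsub>A\<^esub> y) = \<pi> x \<oplus>\<^bsub>Q\<^esub> \<pi> y"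
    and zero: "\<pi> \<zero>\<^bsub>A\<^esub> = \<zero>\<^bsub>Q\<^esub>"
    and smult: "\<And>c x. x \<in> carrier A \<Longrightarrow> \<pi> (c \<odot>\<^bsub>A\<^esub> x) = c \<odot>\<^bsub>Q\<^esub> \<pi> x"
  shows "vsp Q"
proof -
  interpret A: Module.module scalar_alg A by fact
  have "\<exists>x\<in>carrier A. y = \<pi> x" if "y \<in> carrier Q" for y
    using that surj by blast
  then obtain s where s: "\<And>y. y \<in> carrier Q \<Longrightarrow> s y \<in> carrier A \<and> y = \<pi> (s y)" by metis
  show ?thesis
  proof (rule vspI)
    show "x \<oplus>\<^bsub>Q\<^esub> y \<in> carrier Q" if "x \<in> carrier Q" "y \<in> carrier Q" for x y
      using s[OF that(1)] s[OF that(2)] by (metis add A.add.m_closed surj imageI)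
    show "\<zero>\<^bsub>Q\<^esub> \<in> carrier Q" using zero surj A.zero_closed by (metis imageI)
    show "c \<odot>\<^bsub>Q\<^esub> x \<in> carrier Q" if "x \<in> carrier Q" for c x
      using s[OF that] smult[of "s x" c] A.smult_closed[of c "s x"] surj by (metis UNIV_I imageI scalar_alg_simps(1))
    show "x \<oplus>\<^bsub>Q\<^esub> y \<oplus>\<^bsub>Q\<^esub> z = x \<oplus>\<^bsub>Q\<^esub> (y \<oplus>\<^bsub>Q\<^esub> z)"
      if "x \<in> carrier Q" "y \<in> carrier Q" "z \<in> carrier Q" for x y z
      using s[OF that(1)] s[OF that(2)] s[OF that(3)] by (metis add A.add.m_closed A.a_assoc)
    show "x \<oplus>\<^bsub>Q\<^esub> y = y \<oplus>\<^bsub>Q\<^esub> x" if "x \<in> carrier Q" "y \<in> carrier Q" for x y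
      using s[OF that(1)] s[OF that(2)] by (metis add A.a_comm)
    show "\<zero>\<^bsub>Q\<^esub> \<oplus>\<^bsub>Q\<^esub> x = x" if "x \<in> carrier Q" for x
      using s[OF that] by (metis add zero A.zero_closed A.l_zero)
    show "c \<odot>\<^bsub>Q\<^esub> (x \<oplus>\<^bsub>Q\<^esub> y) = c \<odot>\<^bsub>Q\<^esub> x \<oplus>\<^bsub>Q\<^esub> c \<odot>\<^bsub>Q\<^esub> y" if "x \<in> carrier Q" "y \<in> carrier Q" for c x y
    proof -
      have "c \<odot>\<^bsub>Q\<^esub> (\<pi> (s x) \<oplus>\<^bsub>Q\<^esub> \<pi> (s y)) = \<pi> (c \<odot>\<^bsub>A\<^esub> (s x \<oplus>\<^bsub>A\<^esub> s y))"
        using s that by (simp add: add smult)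
      also have "\<dots> = \<pi> (c \<odot>\<^bsub>A\<^esub> s x \<oplus>\<^bsub>A\<^esub> c \<odot>\<^bsub>A\<^esub> s y)" using s that by (simp add: A.smult_r_distr)
      also have "\<dots> = c \<odot>\<^bsub>Q\<^esub> \<pi> (s x) \<oplus>\<^bsub>Q\<^esub> c \<odot>\<^bsub>Q\<^esub> \<pi> (s y)" using s that by (simp add: add smult)
      finally show ?thesis using s that by metis
    qed
    fix x assume x: "x \<in> carrier Q"
    define u where "u = s x"
    have u: "u \<in> carrier A" "x = \<pi> u" using s[OF x] unfolding u_def by auto
    show "(c + d) \<odot>\<^bsub>Q\<^esub> x = c \<odot>\<^bsub>Q\<^esub> x \<oplus>\<^bsub>Q\<^esub> d \<odot>\<^bsub>Q\<^esub> x" for c d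
      using A.smult_l_distr[of c d u] u smult[of u] add by (metis A.smult_closed UNIV_I scalar_alg_simps(1,5))
    show "(c * d) \<odot>\<^bsub>Q\<^esub> x = c \<odot>\<^bsub>Q\<^esub> (d \<odot>\<^bsub>Q\<^esub> x)" for c d
      using A.smult_assoc1[of c d u] u smult by (metis A.smult_closed UNIV_I scalar_alg_simps(1,2))
    show "1 \<odot>\<^bsub>Q\<^esub> x = x" using A.smult_one[of u] u smult[of u] by (metis scalar_alg_simps(3))
    show "0 \<odot>\<^bsub>Q\<^esub> x = \<zero>\<^bsub>Q\<^esub>" using A.smult_l_null[of u] u smult[of u] zero by (metis scalar_alg_simps(4))
  qed
qed

text \<open>Nothing is required outside \<open>carrier A\<close>, so such maps are compared
  pointwise on the carrier. Preservation of zero follows from the scalar 0.\<close>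

definition lin_map :: "('k::field, 'a) module \<Rightarrow> ('k, 'b) module \<Rightarrow> ('a \<Rightarrow> 'b) set" where
  "lin_map A B = {h \<in> carrier A \<rightarrow> carrier B.
     (\<forall>x\<in>carrier A. \<forall>y\<in>carrier A. h (x \<oplus>\<^bsub>A\<^esub> y) = h x \<oplus>\<^bsub>B\<^esub> h y) \<and>
     (\<forall>c. \<forall>x\<in>carrier A. h (c \<odot>\<^bsub>A\<^esub> x) = c \<odot>\<^bsub>B\<^esub> h x)}"

lemma lin_mapI:
  assumes "\<And>x. x \<in> carrier A \<Longrightarrow> h x \<in> carrier B"
    and "\<And>x y. x \<in> carrier A \<Longrightarrow> y \<in> carrier A \<Longrightarrow> h (x \<oplus>\<^bsub>A\<^esub> y) = h x \<oplus>\<^bsub>B\<^esub> h y"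
    and "\<And>c x. x \<in> carrier A \<Longrightarrow> h (c \<odot>\<^bsub>A\<^esub> x) = c \<odot>\<^bsub>B\<^esub> h x"
  shows "h \<in> lin_map A B"
  using assms by (auto simp: lin_map_def)

lemma lin_mapD:
  assumes "h \<in> lin_map A B"
  shows "x \<in> carrier A \<Longrightarrow> h x \<in> carrier B"
    and "x \<in> carrier A \<Longrightarrow> y \<in> carrier A \<Longrightarrow> h (x \<oplus>\<^bsub>A\<^esub> y) = h x \<oplus>\<^bsub>B\<^esub> h y"
    and "x \<in> carrier A \<Longrightarrow> h (c \<odot>\<^bsub>A\<^esub> x) = c \<odot>\<^bsub>B\<^esub> h x"
  using assms by (auto simp: lin_map_def)

lemma lin_map_zero:
  assumes "vsp A" "vsp B" "h \<in> lin_map A B"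
  shows "h \<zero>\<^bsub>A\<^esub> = \<zero>\<^bsub>B\<^esub>"
proof -
  interpret A: Module.module scalar_alg A by fact
  interpret B: Module.module scalar_alg B by fact
  show ?thesis
    using lin_mapD(3)[OF assms(3) A.zero_closed, of 0] lin_mapD(1)[OF assms(3) A.zero_closed]
      A.smult_l_null[OF A.zero_closed] B.smult_l_null by auto
qed

lemma lin_map_minus:
  assumes "vsp A" "vsp B" "h \<in> lin_map A B" "x \<in> carrier A" "y \<in> carrier A"
  shows "h (x \<ominus>\<^bsub>A\<^esub> y) = h x \<ominus>\<^bsub>B\<^esub> h y"
proof -
  interpret A: Module.module scalar_alg A by fact
  interpret B: Module.module scalar_alg B by fact
  have "h (x \<ominus>\<^bsub>A\<^esub> y) \<oplus>\<^bsub>B\<^esub> h y = h (x \<ominus>\<^bsub>A\<^esub> y \<oplus>\<^bsub>A\<^esub> y)"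
    using lin_mapD(2)[OF assms(3)] assms(4,5) by simp
  then have "h (x \<ominus>\<^bsub>A\<^esub> y) \<oplus>\<^bsub>B\<^esub> h y = h x"
    using A.M.minus_add_cancel assms(4,5) by simp
  then show ?thesis
    using lin_mapD(1)[OF assms(3)] assms(4,5) B.M.add_minus_cancel[of "h (x \<ominus>\<^bsub>A\<^esub> y)" "h y"]
    by simp
qed

lemma lin_map_comp:
  "f \<in> lin_map A B \<Longrightarrow> g \<in> lin_map B C \<Longrightarrow> (\<lambda>x. g (f x)) \<in> lin_map A C"
  by (auto simp: lin_map_def Pi_iff)

lemma lin_map_id: "(\<lambda>x. x) \<in> lin_map A A"
  by (auto simp: lin_map_def)

lemma lin_map_finsum:
  assumes "vsp A" "vsp B" "h \<in> lin_map A B" "finite K" "f \<in> K \<rightarrow> carrier A"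
  shows "h (\<Oplus>\<^bsub>A\<^esub>i\<in>K. f i) = (\<Oplus>\<^bsub>B\<^esub>i\<in>K. h (f i))"
proof -
  interpret A: Module.module scalar_alg A by fact
  interpret B: Module.module scalar_alg B by fact
  show ?thesis
    using assms(4,5)
  proof (induction K)
    case empty
    then show ?case using lin_map_zero[OF assms(1-3)] by simp
  next
    case (insert i K)
    then have f: "f i \<in> carrier A" "f \<in> K \<rightarrow> carrier A" by auto
    have hf: "(\<lambda>i. h (f i)) \<in> K \<rightarrow> carrier B" "h (f i) \<in> carrier B"
      using lin_mapD(1)[OF assms(3)] f by auto
    show ?case using insert f hf lin_mapD[OF assms(3)] by simp
  qed
qed

lemma vsp_scalar: "vsp (scalar_alg :: ('k::field, 'k) module)"
  by (rule vspI) (auto simp: algebra_simps)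

lemma submodule_scalarI:
  fixes A :: "('k::field, 'a) module" (structure)
  assumes "vsp A" "I \<subseteq> carrier A" "\<zero> \<in> I"
    and "\<And>x y. x \<in> I \<Longrightarrow> y \<in> I \<Longrightarrow> x \<oplus> y \<in> I" "\<And>c x. x \<in> I \<Longrightarrow> c \<odot> x \<in> I"
  shows "submodule I scalar_alg A"
proof -
  interpret A: Module.module scalar_alg A by fact
  have "\<ominus> x \<in> I" if "x \<in> I" for x
  proof -
    have "(\<ominus>\<^bsub>scalar_alg\<^esub> 1) \<odot> x = \<ominus> x"
      using A.smult_l_minus[of 1 x] A.smult_one[of x] that assms(2) by auto
    then show ?thesis using assms(5)[OF that] by metis
  qed
  then show ?thesis using assms by (intro A.submoduleI) auto
qed


section \<open>Quotients\<close>

lemma quot_alg_simps: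
  "carrier (quot_alg A I) = (\<lambda>x. I +>\<^bsub>A\<^esub> x) ` carrier A"
  "\<zero>\<^bsub>quot_alg A I\<^esub> = I"
  "\<one>\<^bsub>quot_alg A I\<^esub> = I +>\<^bsub>A\<^esub> \<one>\<^bsub>A\<^esub>"
  "X \<oplus>\<^bsub>quot_alg A I\<^esub> Y = X <+>\<^bsub>A\<^esub> Y"
  "X \<otimes>\<^bsub>quot_alg A I\<^esub> Y = rcoset_mult A I X Y"
  "c \<odot>\<^bsub>quot_alg A I\<^esub> X = (\<Union>x\<in>X. I +>\<^bsub>A\<^esub> (c \<odot>\<^bsub>A\<^esub> x))"
  by (auto simp: quot_alg_def ring.defs module.defs FactRing_simps)

locale subspace_vsp = Module.module scalar_alg A
  for A :: "('k::field, 'a) module" (structure) +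
  fixes I
  assumes sub: "submodule I scalar_alg A"
begin

lemma abelian_sub: "abelian_subgroup I A"
  using sub submodule.axioms(1) abelian_group_axioms
  by (auto intro!: abelian_subgroupI3 additive_subgroup.intro)

lemma sub_closed:
  "x \<in> I \<Longrightarrow> x \<in> carrier A" "\<zero> \<in> I" "x \<in> I \<Longrightarrow> y \<in> I \<Longrightarrow> x \<oplus> y \<in> I" "x \<in> I \<Longrightarrow> \<ominus> x \<in> I"
  "x \<in> I \<Longrightarrow> c \<odot> x \<in> I"
proof -
  show *: "x \<in> I \<Longrightarrow> x \<in> carrier A" "x \<in> I \<Longrightarrow> y \<in> I \<Longrightarrow> x \<oplus> y \<in> I" "x \<in> I \<Longrightarrow> \<ominus> x \<in> I"
    "x \<in> I \<Longrightarrow> c \<odot> x \<in> I" for x y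
    using submoduleE[OF sub] by auto
  show "\<zero> \<in> I" using sub submodule.axioms(1) subgroup.one_closed by fastforce
qed

lemma coset_mem_iff: "x \<in> carrier A \<Longrightarrow> y \<in> I +> x \<longleftrightarrow> (\<exists>i\<in>I. y = i \<oplus> x)"
  by (auto simp: a_r_coset_def')

lemma coset_eq_iff:
  assumes "x \<in> carrier A" "y \<in> carrier A"
  shows "I +> x = I +> y \<longleftrightarrow> x \<ominus> y \<in> I"
proof
  interpret abelian_subgroup I A by (rule abelian_sub)
  assume "I +> x = I +> y"
  then have "x \<in> I +> y" using a_rcos_self[OF assms(1)] by simp
  then obtain i where i: "i \<in> I" "x = i \<oplus> y" using coset_mem_iff[OF assms(2)] by auto
  then have "x \<ominus> y = i" using assms sub_closed(1) M.add_minus_cancel by simp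
  then show "x \<ominus> y \<in> I" using i by simp
next
  assume d: "x \<ominus> y \<in> I"
  have "x = (x \<ominus> y) \<oplus> y" using assms M.minus_add_cancel by simp
  then have "x \<in> I +> y" using coset_mem_iff[OF assms(2)] d by blast
  then show "I +> x = I +> y"
    using a_repr_independence[OF _ assms(2)] submodule.axioms(1)[OF sub] by blast
qed

lemma coset_zero: "I +> \<zero> = I"
  using a_coset_join2[OF zero_closed] submodule.axioms(1)[OF sub] sub_closed(2) by blast

lemma coset_add: "x \<in> carrier A \<Longrightarrow> y \<in> carrier A \<Longrightarrow> I +> (x \<oplus> y) = (I +> x) \<oplus>\<^bsub>quot_alg A I\<^esub> (I +> y)"
  using abelian_subgroup.a_rcos_sum[OF abelian_sub] by (simp add: quot_alg_simps)

text \<open>In \<open>quot_alg\<close> a scalar multiple is a union over all representatives of the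
  coset; it collapses to one coset because \<open>c \<odot> i\<close> stays in
  \<open>I\<close>.\<close>

lemma coset_smult:
  assumes "x \<in> carrier A"
  shows "I +> (c \<odot> x) = c \<odot>\<^bsub>quot_alg A I\<^esub> (I +> x)"
proof -
  interpret abelian_subgroup I A by (rule abelian_sub)
  have "I +> (c \<odot> y) = I +> (c \<odot> x)" if y: "y \<in> I +> x" for y
  proof -
    obtain i where i: "i \<in> I" "y = i \<oplus> x" using y coset_mem_iff[OF assms] by auto
    then have "c \<odot> y = c \<odot> i \<oplus> c \<odot> x" using sub_closed(1) assms smult_r_distr by simp
    then have "c \<odot> y \<in> I +> (c \<odot> x)"
      using coset_mem_iff[of "c \<odot> x" "c \<odot> y"] sub_closed(5)[OF i(1), of c] assms by auto
    then show ?thesis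
      using a_repr_independence[of "c \<odot> y" I "c \<odot> x"] submodule.axioms(1)[OF sub] assms by auto
  qed
  then have "(\<Union>y\<in>I +> x. I +> (c \<odot> y)) = (\<Union>y\<in>I +> x. I +> (c \<odot> x))" by (intro SUP_cong) auto
  also have "\<dots> = I +> (c \<odot> x)" using a_rcos_self[OF assms] by (intro SUP_eq_const) auto
  finally show ?thesis unfolding quot_alg_simps by simp
qed

lemma coset_lin: "(\<lambda>x. I +> x) \<in> lin_map A (quot_alg A I)"
  by (rule lin_mapI) (auto simp: coset_add coset_smult quot_alg_simps(1))

lemma vsp_quot: "vsp (quot_alg A I)"
proof (rule vsp_image)
  show "vsp A" ..
  show "(\<lambda>x. I +> x) ` carrier A = carrier (quot_alg A I)" by (simp add: quot_alg_simps)
  show "I +> \<zero> = \<zero>\<^bsub>quot_alg A I\<^esub>" by (simp add: quot_alg_simps(2) coset_zero)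
qed (auto simp: coset_add coset_smult)

end


section \<open>Free vector spaces\<close>

lemma lookup_pm_scale [simp]: "Poly_Mapping.lookup (pm_scale c F) x = c * Poly_Mapping.lookup F x"
  unfolding pm_scale_def by (simp add: Poly_Mapping.map.rep_eq when_def)

lemma pm_scale_single [simp]: "pm_scale c (Poly_Mapping.single x d) = Poly_Mapping.single x (c * d)"
  by (rule poly_mapping_eqI) (simp add: lookup_single when_def)

lemma keys_pm_scale: "Poly_Mapping.keys (pm_scale c F) \<subseteq> Poly_Mapping.keys F"
  by (auto simp: in_keys_iff)

lemma vector_space_pm_scale: "vector_space pm_scale"
  by unfold_locales (auto intro!: poly_mapping_eqI simp: lookup_add algebra_simps)

text \<open>The bound on the keys is carried through the induction so that every intermediate
  mapping lies in the carrier of the monoid algebra at hand.\<close>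

lemma pm_induct [consumes 1, case_names zero single add]:
  assumes "Poly_Mapping.keys F \<subseteq> X"
    and "P 0"
    and "\<And>x c. x \<in> X \<Longrightarrow> P (Poly_Mapping.single x c)"
    and "\<And>F G. Poly_Mapping.keys F \<subseteq> X \<Longrightarrow> Poly_Mapping.keys G \<subseteq> X \<Longrightarrow> P F \<Longrightarrow> P G \<Longrightarrow> P (F + G)"
  shows "P F"
  using assms(1)
proof (induction F rule: update_induct)
  case const
  show ?case by (rule assms(2))
next
  case (update F a b)
  have eq: "Poly_Mapping.update a b F = Poly_Mapping.single a b + F"
    using update(1) by (intro poly_mapping_eqI)
      (auto simp: lookup_update lookup_add lookup_single when_def in_keys_iff)
  have "a \<in> X" "Poly_Mapping.keys F \<subseteq> X" using update(2,4) by (auto simp: keys_update)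
  then show ?case unfolding eq using update(3) by (intro assms(4) assms(3)) auto
qed

lemma monoid_alg_simps:
  "carrier (monoid_alg M) = {F. Poly_Mapping.keys F \<subseteq> carrier M}"
  "\<one>\<^bsub>monoid_alg M\<^esub> = Poly_Mapping.single \<one>\<^bsub>M\<^esub> 1"
  "\<zero>\<^bsub>monoid_alg M\<^esub> = 0"
  "F \<oplus>\<^bsub>monoid_alg M\<^esub> G = F + G"
  "c \<odot>\<^bsub>monoid_alg M\<^esub> F = pm_scale c F"
  by (simp_all add: monoid_alg_def)

lemma vsp_monoid_alg: "vsp (monoid_alg M)"
  by (rule vspI)
    (auto simp: monoid_alg_simps lookup_add algebra_simps intro!: poly_mapping_eqI
      dest: subsetD[OF Poly_Mapping.keys_add] subsetD[OF keys_pm_scale])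

lemma monoid_alg_minus:
  assumes "F \<in> carrier (monoid_alg M)" "G \<in> carrier (monoid_alg M)"
  shows "F \<ominus>\<^bsub>monoid_alg M\<^esub> G = F - G"
proof -
  interpret Module.module scalar_alg "monoid_alg M" by (rule vsp_monoid_alg)
  have "F \<ominus>\<^bsub>monoid_alg M\<^esub> G + G = F"
    using minus_add_cancel[OF assms] by (simp add: monoid_alg_simps)
  then show ?thesis by (simp add: eq_diff_eq)
qed

definition linext :: "('k::field, 'c) module \<Rightarrow> ('x \<Rightarrow> 'c) \<Rightarrow> ('x \<Rightarrow>\<^sub>0 'k) \<Rightarrow> 'c" where
  "linext C b F = (\<Oplus>\<^bsub>C\<^esub>x\<in>Poly_Mapping.keys F. Poly_Mapping.lookup F x \<odot>\<^bsub>C\<^esub> b x)"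

lemma lin_lift_linext: "lin_lift C b X = linext C b (SOME F. F \<in> X)"
  by (simp add: lin_lift_def linext_def Let_def)

context
  fixes C :: "('k::field, 'c) module" (structure) and X :: "'x set" and b
  assumes C: "vsp C" and b: "b \<in> X \<rightarrow> carrier C"
begin

interpretation Module.module scalar_alg C by (rule C)

lemma smult_b_closed [simp, intro]: "x \<in> X \<Longrightarrow> c \<odot> b x \<in> carrier C"
  using b by (auto intro!: smult_closed)

text \<open>Two mappings have different keys; summing over a common finite superset turns linearity
  into a termwise statement.\<close>

lemma linext_superset:
  assumes "finite K" "Poly_Mapping.keys F \<subseteq> K" "K \<subseteq> X"
  shows "linext C b F = (\<Oplus>x\<in>K. Poly_Mapping.lookup F x \<odot> b x)"
  unfolding linext_def
proof (rule add.finprod_mono_neutral_cong_left)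
  show "\<And>x. x \<in> K - Poly_Mapping.keys F \<Longrightarrow> Poly_Mapping.lookup F x \<odot> b x = \<zero>"
    using assms b smult_l_null by (auto simp: in_keys_iff)
  show "(\<lambda>x. Poly_Mapping.lookup F x \<odot> b x) \<in> K \<rightarrow> carrier C"
    using assms by (auto simp: subset_iff)
qed (use assms in auto)

lemma linext_closed:
  assumes "Poly_Mapping.keys F \<subseteq> X"
  shows "linext C b F \<in> carrier C"
  unfolding linext_def using assms by (auto intro!: finsum_closed simp: subset_iff)

lemma linext_single:
  assumes "x \<in> X"
  shows "linext C b (Poly_Mapping.single x c) = c \<odot> b x"
proof -
  have "linext C b (Poly_Mapping.single x c) = (\<Oplus>y\<in>{x}. Poly_Mapping.lookup (Poly_Mapping.single x c) y \<odot> b y)"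
    using assms by (intro linext_superset) auto
  also have "\<dots> = c \<odot> b x" using assms by (subst finsum_insert) auto
  finally show ?thesis .
qed

lemma linext_add:
  assumes F: "Poly_Mapping.keys F \<subseteq> X" and G: "Poly_Mapping.keys G \<subseteq> X"
  shows "linext C b (F + G) = linext C b F \<oplus> linext C b G"
proof -
  let ?K = "Poly_Mapping.keys F \<union> Poly_Mapping.keys G"
  have K: "finite ?K" "?K \<subseteq> X" using assms by auto
  have "linext C b (F + G) = (\<Oplus>x\<in>?K. Poly_Mapping.lookup (F + G) x \<odot> b x)"
    using K Poly_Mapping.keys_add[of F G] by (intro linext_superset) auto
  also have "\<dots> = (\<Oplus>x\<in>?K. Poly_Mapping.lookup F x \<odot> b x \<oplus> Poly_Mapping.lookup G x \<odot> b x)"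
  proof (rule finsum_cong')
    show "Poly_Mapping.lookup (F + G) x \<odot> b x = Poly_Mapping.lookup F x \<odot> b x \<oplus> Poly_Mapping.lookup G x \<odot> b x"
      if "x \<in> ?K" for x
      using smult_l_distr[of "Poly_Mapping.lookup F x" "Poly_Mapping.lookup G x" "b x"] that K b
      by (auto simp: lookup_add)
  qed (use K in \<open>auto simp: subset_iff\<close>)
  also have "\<dots> = (\<Oplus>x\<in>?K. Poly_Mapping.lookup F x \<odot> b x) \<oplus> (\<Oplus>x\<in>?K. Poly_Mapping.lookup G x \<odot> b x)"
    using K by (intro finsum_addf) (auto simp: subset_iff)
  also have "\<dots> = linext C b F \<oplus> linext C b G"
    using K linext_superset[of ?K F] linext_superset[of ?K G] by simp
  finally show ?thesis .
qed

lemma linext_smult: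
  assumes F: "Poly_Mapping.keys F \<subseteq> X"
  shows "linext C b (pm_scale c F) = c \<odot> linext C b F"
proof -
  have "linext C b (pm_scale c F) = (\<Oplus>x\<in>Poly_Mapping.keys F. Poly_Mapping.lookup (pm_scale c F) x \<odot> b x)"
    using assms keys_pm_scale[of c F] by (intro linext_superset) auto
  also have "\<dots> = (\<Oplus>x\<in>Poly_Mapping.keys F. c \<odot> (Poly_Mapping.lookup F x \<odot> b x))"
    using smult_assoc1 F b by (intro finsum_cong') (auto simp: subset_iff Pi_iff)
  also have "\<dots> = c \<odot> linext C b F" unfolding linext_def
    using F by (intro finsum_smult_ldistr[symmetric]) (auto simp: subset_iff)
  finally show ?thesis .
qed

lemma linext_lin:
  "carrier M = X \<Longrightarrow> linext C b \<in> lin_map (monoid_alg M) C"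
  by (rule lin_mapI) (auto simp: monoid_alg_simps linext_closed linext_add linext_smult)

end

lemma lin_map_monoid_alg_eq:
  assumes "vsp C" "h \<in> lin_map (monoid_alg M) C" "h' \<in> lin_map (monoid_alg M) C"
    and "\<And>x. x \<in> carrier M \<Longrightarrow> h (Poly_Mapping.single x 1) = h' (Poly_Mapping.single x 1)"
    and "F \<in> carrier (monoid_alg M)"
  shows "h F = h' F"
proof -
  have "Poly_Mapping.keys F \<subseteq> carrier M" using assms(5) by (simp add: monoid_alg_simps)
  then show ?thesis
  proof (induction F rule: pm_induct)
    case zero
    show ?case using lin_map_zero[OF vsp_monoid_alg assms(1)] assms(2,3) by (metis monoid_alg_simps(3))
  next
    case (single x c)
    have *: "Poly_Mapping.single x c = c \<odot>\<^bsub>monoid_alg M\<^esub> Poly_Mapping.single x 1"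
      by (simp add: monoid_alg_simps)
    have "Poly_Mapping.single x 1 \<in> carrier (monoid_alg M)"
      using single by (simp add: monoid_alg_simps)
    then show ?case unfolding * using assms(4)[OF single] lin_mapD(3)[OF assms(2)] lin_mapD(3)[OF assms(3)]
      by metis
  next
    case (add F G)
    then show ?case using lin_mapD(2)[OF assms(2), of F G] lin_mapD(2)[OF assms(3), of F G]
      by (simp add: monoid_alg_simps)
  qed
qed

text \<open>Tensor products and tensor algebras are both quotients of a free vector space on the
  carrier of a monoid. Their linear universal property is proved once here, for an arbitrary
  subspace \<open>I\<close>.\<close>

locale free_quot =
  fixes M :: "('x, 'm) monoid_scheme" and I :: "('x \<Rightarrow>\<^sub>0 'k::field) set"
  assumes sub: "submodule I scalar_alg (monoid_alg M)"
begin

sublocale subspace_vsp "monoid_alg M" I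
  by (intro subspace_vsp.intro subspace_vsp_axioms.intro vsp_monoid_alg sub)

abbreviation "Q \<equiv> quot_alg (monoid_alg M :: ('k, 'x \<Rightarrow>\<^sub>0 'k) module) I"
abbreviation "cls x \<equiv> I +>\<^bsub>(monoid_alg M :: ('k, 'x \<Rightarrow>\<^sub>0 'k) module)\<^esub> Poly_Mapping.single x 1"

lemma cls_closed: "x \<in> carrier M \<Longrightarrow> cls x \<in> carrier Q"
  by (auto simp: quot_alg_simps monoid_alg_simps)

lemma coset_single:
  assumes "x \<in> carrier M"
  shows "I +>\<^bsub>monoid_alg M\<^esub> Poly_Mapping.single x c = c \<odot>\<^bsub>Q\<^esub> cls x"
  using coset_smult[of "Poly_Mapping.single x 1" c] assms by (simp add: monoid_alg_simps)

lemma Q_induct [consumes 1, case_names zero scaled add]: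
  assumes "Y \<in> carrier Q"
    and "P \<zero>\<^bsub>Q\<^esub>"
    and "\<And>x c. x \<in> carrier M \<Longrightarrow> P (c \<odot>\<^bsub>Q\<^esub> cls x)"
    and "\<And>Y Z. Y \<in> carrier Q \<Longrightarrow> Z \<in> carrier Q \<Longrightarrow> P Y \<Longrightarrow> P Z \<Longrightarrow> P (Y \<oplus>\<^bsub>Q\<^esub> Z)"
  shows "P Y"
proof -
  obtain F where F: "F \<in> carrier (monoid_alg M)" "Y = I +>\<^bsub>monoid_alg M\<^esub> F"
    using assms(1) by (auto simp: quot_alg_simps(1))
  have "Poly_Mapping.keys F \<subseteq> carrier M" using F by (simp add: monoid_alg_simps)
  then have "P (I +>\<^bsub>monoid_alg M\<^esub> F)"
  proof (induction F rule: pm_induct)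
    case zero
    show ?case using assms(2) coset_zero by (simp add: quot_alg_simps monoid_alg_simps)
  next
    case (single x c)
    show ?case by (subst coset_single[OF single, of c]) (rule assms(3)[OF single])
  next
    case (add F G)
    then show ?case
      using coset_add[of F G] assms(4)[of "I +>\<^bsub>monoid_alg M\<^esub> F" "I +>\<^bsub>monoid_alg M\<^esub> G"]
      by (simp add: monoid_alg_simps quot_alg_simps(1))
  qed
  then show ?thesis using F by simp
qed

lemma lin_map_Q_eq:
  assumes C: "vsp C" and h: "h \<in> lin_map Q C" and h': "h' \<in> lin_map Q C"
    and eq: "\<And>x. x \<in> carrier M \<Longrightarrow> h (cls x) = h' (cls x)"
    and Y: "Y \<in> carrier Q"
  shows "h Y = h' Y"
  using Y
proof (induction Y rule: Q_induct)
  case zero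
  show ?case using lin_map_zero[OF vsp_quot C] h h' by metis
next
  case (scaled x c)
  then show ?case using lin_mapD(3)[OF h] lin_mapD(3)[OF h'] cls_closed eq by metis
next
  case (add Y Z)
  then show ?case using lin_mapD(2)[OF h] lin_mapD(2)[OF h'] by metis
qed

text \<open>\<open>SOME\<close> may return any representative, but it differs from \<open>F\<close>
  by an element of \<open>I\<close>, on which the linear extension is zero.\<close>

lemma lin_lift_coset:
  assumes C: "vsp C" and b: "b \<in> carrier M \<rightarrow> carrier C"
    and null: "\<And>F. F \<in> I \<Longrightarrow> linext C b F = \<zero>\<^bsub>C\<^esub>" and F: "F \<in> carrier (monoid_alg M)"
  shows "lin_lift C b (I +>\<^bsub>monoid_alg M\<^esub> F) = linext C b F"
proof -
  interpret C: Module.module scalar_alg C by fact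
  interpret abelian_subgroup I "monoid_alg M" by (rule abelian_sub)
  let ?G = "SOME G. G \<in> I +>\<^bsub>monoid_alg M\<^esub> F"
  have "?G \<in> I +>\<^bsub>monoid_alg M\<^esub> F" using a_rcos_self[OF F] by (rule someI)
  then obtain i where i: "i \<in> I" "?G = i + F"
    using coset_mem_iff[OF F, of ?G] by (auto simp: monoid_alg_simps)
  have "i \<in> carrier (monoid_alg M)" using i sub_closed by auto
  then have "linext C b ?G = linext C b i \<oplus>\<^bsub>C\<^esub> linext C b F"
    unfolding i(2) using F by (intro linext_add[OF C b]) (auto simp: monoid_alg_simps)
  then show ?thesis
    using null[OF i(1)] linext_closed[OF C b, of F] F by (simp add: lin_lift_linext monoid_alg_simps)
qed

lemma lin_lift_lin:
  assumes C: "vsp C" and b: "b \<in> carrier M \<rightarrow> carrier C"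
    and null: "\<And>F. F \<in> I \<Longrightarrow> linext C b F = \<zero>\<^bsub>C\<^esub>"
  shows "lin_lift C b \<in> lin_map Q C"
proof (rule lin_mapI)
  note L = lin_lift_coset[OF assms]
  note lin = linext_lin[OF C b refl]
  fix Y assume "Y \<in> carrier Q"
  then obtain F where F: "F \<in> carrier (monoid_alg M)" "Y = I +>\<^bsub>monoid_alg M\<^esub> F"
    by (auto simp: quot_alg_simps(1))
  show "lin_lift C b Y \<in> carrier C" using F L lin_mapD(1)[OF lin] by simp
  show "lin_lift C b (c \<odot>\<^bsub>Q\<^esub> Y) = c \<odot>\<^bsub>C\<^esub> lin_lift C b Y" for c
    using F L lin_mapD(3)[OF lin] smult_closed[of c F] by (simp add: coset_smult[symmetric])
  fix Z assume "Z \<in> carrier Q"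
  then obtain G where G: "G \<in> carrier (monoid_alg M)" "Z = I +>\<^bsub>monoid_alg M\<^esub> G"
    by (auto simp: quot_alg_simps(1))
  show "lin_lift C b (Y \<oplus>\<^bsub>Q\<^esub> Z) = lin_lift C b Y \<oplus>\<^bsub>C\<^esub> lin_lift C b Z"
    using F G L lin_mapD(2)[OF lin] by (simp add: coset_add[symmetric])
qed

lemma lin_lift_cls:
  assumes C: "vsp C" and b: "b \<in> carrier M \<rightarrow> carrier C"
    and null: "\<And>F. F \<in> I \<Longrightarrow> linext C b F = \<zero>\<^bsub>C\<^esub>" and x: "x \<in> carrier M"
  shows "lin_lift C b (cls x) = b x"
proof -
  interpret C: Module.module scalar_alg C by fact
  have "lin_lift C b (cls x) = 1 \<odot>\<^bsub>C\<^esub> b x"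
    using lin_lift_coset[OF C b null, of "Poly_Mapping.single x 1"] linext_single[OF C b x, of 1] x
    by (simp add: monoid_alg_simps)
  then show ?thesis using C.smult_one b x by auto
qed

end


section \<open>Algebras and their quotients\<close>

locale kalg = Module.module scalar_alg A + ring A for A :: "('k::field, 'a) module" (structure) +
  assumes smult_mult: "x \<in> carrier A \<Longrightarrow> y \<in> carrier A \<Longrightarrow> (c \<odot> x) \<otimes> y = c \<odot> (x \<otimes> y)"
    and mult_smult: "x \<in> carrier A \<Longrightarrow> y \<in> carrier A \<Longrightarrow> x \<otimes> (c \<odot> y) = c \<odot> (x \<otimes> y)"

lemma k_algebra_iff: "k_algebra A \<longleftrightarrow> kalg A"
  by (auto simp: k_algebra_def kalg_def kalg_axioms_def)

lemma kalg_vsp: "kalg A \<Longrightarrow> vsp A"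
  by (simp add: kalg_def)

lemma kalg_ring: "kalg A \<Longrightarrow> ring A"
  by (simp add: kalg_def)

lemma kalgI:
  fixes A :: "('k::field, 'a) module" (structure)
  assumes "vsp A"
    and "\<And>x y. x \<in> carrier A \<Longrightarrow> y \<in> carrier A \<Longrightarrow> x \<otimes> y \<in> carrier A"
    and "\<one> \<in> carrier A"
    and "\<And>x y z. x \<in> carrier A \<Longrightarrow> y \<in> carrier A \<Longrightarrow> z \<in> carrier A \<Longrightarrow> (x \<otimes> y) \<otimes> z = x \<otimes> (y \<otimes> z)"
    and "\<And>x. x \<in> carrier A \<Longrightarrow> \<one> \<otimes> x = x" "\<And>x. x \<in> carrier A \<Longrightarrow> x \<otimes> \<one> = x"
    and "\<And>x y z. x \<in> carrier A \<Longrightarrow> y \<in> carrier A \<Longrightarrow> z \<in> carrier A \<Longrightarrow> (x \<oplus> y) \<otimes> z = x \<otimes> z \<oplus> y \<otimes> z"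
    and "\<And>x y z. x \<in> carrier A \<Longrightarrow> y \<in> carrier A \<Longrightarrow> z \<in> carrier A \<Longrightarrow> z \<otimes> (x \<oplus> y) = z \<otimes> x \<oplus> z \<otimes> y"
    and "\<And>c x y. x \<in> carrier A \<Longrightarrow> y \<in> carrier A \<Longrightarrow> (c \<odot> x) \<otimes> y = c \<odot> (x \<otimes> y)"
    and "\<And>c x y. x \<in> carrier A \<Longrightarrow> y \<in> carrier A \<Longrightarrow> x \<otimes> (c \<odot> y) = c \<odot> (x \<otimes> y)"
  shows "kalg A"
proof -
  interpret Module.module scalar_alg A by fact
  have "ring A" by (intro ringI abelian_group_axioms monoidI) (use assms in auto)
  then show ?thesis using assms by (auto simp: kalg_def kalg_axioms_def)
qed

lemma kalg_scalar: "kalg (scalar_alg :: ('k::field, 'k) module)"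
  by (rule kalgI[OF vsp_scalar]) (auto simp: algebra_simps)

lemma alg_homI:
  assumes "h \<in> lin_map A B"
    and "\<And>x y. x \<in> carrier A \<Longrightarrow> y \<in> carrier A \<Longrightarrow> h (x \<otimes>\<^bsub>A\<^esub> y) = h x \<otimes>\<^bsub>B\<^esub> h y"
    and "h \<one>\<^bsub>A\<^esub> = \<one>\<^bsub>B\<^esub>"
  shows "h \<in> alg_hom A B"
  using assms by (auto simp: alg_hom_def lin_map_def ring_hom_def)

lemma alg_hom_lin: "h \<in> alg_hom A B \<Longrightarrow> h \<in> lin_map A B"
  by (auto simp: alg_hom_def lin_map_def ring_hom_def)

lemma alg_homD:
  assumes "h \<in> alg_hom A B"
  shows "x \<in> carrier A \<Longrightarrow> h x \<in> carrier B"
    and "x \<in> carrier A \<Longrightarrow> y \<in> carrier A \<Longrightarrow> h (x \<oplus>\<^bsub>A\<^esub> y) = h x \<oplus>\<^bsub>B\<^esub> h y"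
    and "x \<in> carrier A \<Longrightarrow> y \<in> carrier A \<Longrightarrow> h (x \<otimes>\<^bsub>A\<^esub> y) = h x \<otimes>\<^bsub>B\<^esub> h y"
    and "h \<one>\<^bsub>A\<^esub> = \<one>\<^bsub>B\<^esub>"
    and "x \<in> carrier A \<Longrightarrow> h (c \<odot>\<^bsub>A\<^esub> x) = c \<odot>\<^bsub>B\<^esub> h x"
  using assms by (auto simp: alg_hom_def ring_hom_def)

lemma alg_hom_comp: "f \<in> alg_hom A B \<Longrightarrow> g \<in> alg_hom B C \<Longrightarrow> (\<lambda>x. g (f x)) \<in> alg_hom A C"
  by (auto simp: alg_hom_def ring_hom_def Pi_iff)

lemma alg_hom_id: "(\<lambda>x. x) \<in> alg_hom A A"
  by (auto simp: alg_hom_def ring_hom_def)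

lemma kalg_image:
  fixes A :: "('k::field, 'a) module" and Q :: "('k, 'b) module"
  assumes "kalg A" and surj: "\<pi> ` carrier A = carrier Q" and lin: "\<pi> \<in> lin_map A Q"
    and zero: "\<pi> \<zero>\<^bsub>A\<^esub> = \<zero>\<^bsub>Q\<^esub>" and one: "\<pi> \<one>\<^bsub>A\<^esub> = \<one>\<^bsub>Q\<^esub>"
    and mult: "\<And>x y. x \<in> carrier A \<Longrightarrow> y \<in> carrier A \<Longrightarrow> \<pi> (x \<otimes>\<^bsub>A\<^esub> y) = \<pi> x \<otimes>\<^bsub>Q\<^esub> \<pi> y"
  shows "kalg Q"
proof -
  interpret A: kalg A by fact
  note add = lin_mapD(2)[OF lin, symmetric] and smult = lin_mapD(3)[OF lin, symmetric]
    and mul = mult[symmetric]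
  have c: "\<pi> x \<in> carrier Q" if "x \<in> carrier A" for x using that surj by blast
  have s: "\<exists>x\<in>carrier A. y = \<pi> x" if "y \<in> carrier Q" for y
    using that surj by blast
  show ?thesis
  proof (rule kalgI)
    show "vsp Q"
      by (rule vsp_image[OF kalg_vsp[OF assms(1)] surj])
        (simp_all add: lin_mapD[OF lin] zero)
    show "\<one>\<^bsub>Q\<^esub> \<in> carrier Q" using one c[OF A.one_closed] by simp
    fix x assume "x \<in> carrier Q"
    then obtain u where u: "u \<in> carrier A" "x = \<pi> u" using s by blast
    show "\<one>\<^bsub>Q\<^esub> \<otimes>\<^bsub>Q\<^esub> x = x" "x \<otimes>\<^bsub>Q\<^esub> \<one>\<^bsub>Q\<^esub> = x"
      using u by (simp_all add: one[symmetric] mul)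
    fix y assume "y \<in> carrier Q"
    then obtain v where v: "v \<in> carrier A" "y = \<pi> v" using s by blast
    show "x \<otimes>\<^bsub>Q\<^esub> y \<in> carrier Q" using u v c by (simp add: mul)
    show "(k \<odot>\<^bsub>Q\<^esub> x) \<otimes>\<^bsub>Q\<^esub> y = k \<odot>\<^bsub>Q\<^esub> (x \<otimes>\<^bsub>Q\<^esub> y)" for k
      using u v by (simp add: mul smult A.smult_mult)
    show "x \<otimes>\<^bsub>Q\<^esub> (k \<odot>\<^bsub>Q\<^esub> y) = k \<odot>\<^bsub>Q\<^esub> (x \<otimes>\<^bsub>Q\<^esub> y)" for k
      using u v by (simp add: mul smult A.mult_smult)
    fix z assume "z \<in> carrier Q"
    then obtain w where w: "w \<in> carrier A" "z = \<pi> w" using s by blast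
    show "(x \<otimes>\<^bsub>Q\<^esub> y) \<otimes>\<^bsub>Q\<^esub> z = x \<otimes>\<^bsub>Q\<^esub> (y \<otimes>\<^bsub>Q\<^esub> z)"
      using u v w by (simp add: mul A.m_assoc)
    show "(x \<oplus>\<^bsub>Q\<^esub> y) \<otimes>\<^bsub>Q\<^esub> z = x \<otimes>\<^bsub>Q\<^esub> z \<oplus>\<^bsub>Q\<^esub> y \<otimes>\<^bsub>Q\<^esub> z"
      using u v w by (simp add: mul add A.l_distr)
    show "z \<otimes>\<^bsub>Q\<^esub> (x \<oplus>\<^bsub>Q\<^esub> y) = z \<otimes>\<^bsub>Q\<^esub> x \<oplus>\<^bsub>Q\<^esub> z \<otimes>\<^bsub>Q\<^esub> y"
      using u v w by (simp add: mul add A.r_distr)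
  qed
qed

text \<open>Scalars act as multiplication by \<open>c \<odot> \<one>\<close>, so a ring ideal
  absorbs them.\<close>

lemma (in kalg) ideal_submodule:
  assumes "ideal I A"
  shows "submodule I scalar_alg A"
proof -
  interpret ideal I A by fact
  show ?thesis
  proof (rule submodule_scalarI)
    show "vsp A" ..
    show "c \<odot> x \<in> I" if "x \<in> I" for c x
      using I_l_closed[OF that, of "c \<odot> \<one>"] that by (simp add: smult_mult a_Hcarr)
  qed (use a_subset additive_subgroup.zero_closed[OF additive_subgroup_axioms] a_closed in auto)
qed

locale kalg_ideal = kalg A + ideal I A for A :: "('k::field, 'a) module" (structure) and I
begin

sublocale subspace_vsp A I
  by (intro subspace_vsp.intro subspace_vsp_axioms.intro kalg_vsp kalg_axioms ideal_submodule
      ideal_axioms)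

lemma coset_mult:
  "x \<in> carrier A \<Longrightarrow> y \<in> carrier A \<Longrightarrow> I +> (x \<otimes> y) = (I +> x) \<otimes>\<^bsub>quot_alg A I\<^esub> (I +> y)"
  by (simp add: quot_alg_simps(5) rcoset_mult_add)

lemma kalg_quot: "kalg (quot_alg A I)"
proof (rule kalg_image)
  show "kalg A" ..
  show "(\<lambda>x. I +> x) ` carrier A = carrier (quot_alg A I)" by (simp add: quot_alg_simps)
qed (auto simp: coset_lin coset_zero coset_mult quot_alg_simps(2,3))

lemma coset_alg_hom: "(\<lambda>x. I +> x) \<in> alg_hom A (quot_alg A I)"
  by (rule alg_homI[OF coset_lin]) (auto simp: coset_mult quot_alg_simps(3))

text \<open>The factor is defined through a chosen representative; two choices differ by an element
  of \<open>I\<close>, which \<open>h\<close> kills.\<close>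

lemma quot_alg_factor:
  assumes h: "h \<in> alg_hom A B" and B: "kalg B" and null: "\<And>x. x \<in> I \<Longrightarrow> h x = \<zero>\<^bsub>B\<^esub>"
  obtains h' where "h' \<in> alg_hom (quot_alg A I) B" "\<And>x. x \<in> carrier A \<Longrightarrow> h' (I +> x) = h x"
proof -
  interpret B: kalg B by fact
  define h' where "h' X = h (SOME x. x \<in> carrier A \<and> I +> x = X)" for X
  have h': "h' (I +> x) = h x" if x: "x \<in> carrier A" for x
  proof -
    let ?y = "SOME y. y \<in> carrier A \<and> I +> y = I +> x"
    have y: "?y \<in> carrier A \<and> I +> ?y = I +> x"
      by (rule someI[where P="\<lambda>y. y \<in> carrier A \<and> I +> y = I +> x"]) (use x in simp)
    then have "?y \<ominus> x \<in> I" using coset_eq_iff[of ?y x] x by simp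
    then have "h ?y \<ominus>\<^bsub>B\<^esub> h x = \<zero>\<^bsub>B\<^esub>"
      using null lin_map_minus[OF kalg_vsp[OF kalg_axioms] kalg_vsp[OF B] alg_hom_lin[OF h], of ?y x] x y by simp
    then show ?thesis unfolding h'_def
      using B.minus_add_cancel[of "h ?y" "h x"] alg_homD(1)[OF h] x y by simp
  qed
  have "h' \<in> alg_hom (quot_alg A I) B"
  proof (rule alg_homI)
    show "h' \<in> lin_map (quot_alg A I) B"
      using h' alg_homD[OF h] by (intro lin_mapI)
        (auto simp: quot_alg_simps(1) coset_add[symmetric] coset_smult[symmetric])
    show "h' \<one>\<^bsub>quot_alg A I\<^esub> = \<one>\<^bsub>B\<^esub>" using h' alg_homD(4)[OF h] by (simp add: quot_alg_simps(3))
  qed (use h' alg_homD[OF h] in \<open>auto simp: quot_alg_simps(1) coset_mult[symmetric]\<close>)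
  then show ?thesis using h' that by blast
qed

end

text \<open>The generated ideal is never described explicitly. The elements \<open>s\<close> with
  \<open>L (x s y) = 0\<close> for all \<open>x\<close> and \<open>y\<close> form an ideal
  containing \<open>S\<close>; the quantification over both outer factors is what closes this set
  under multiplication when \<open>L\<close> is merely linear.\<close>

lemma genideal_vanish:
  assumes A: "kalg A" and C: "vsp C" and L: "L \<in> lin_map A C" and S: "S \<subseteq> carrier A"
    and LS: "\<And>s x y. s \<in> S \<Longrightarrow> x \<in> carrier A \<Longrightarrow> y \<in> carrier A \<Longrightarrow> L (x \<otimes>\<^bsub>A\<^esub> s \<otimes>\<^bsub>A\<^esub> y) = \<zero>\<^bsub>C\<^esub>"
    and x: "x \<in> genideal A S"
  shows "L x = \<zero>\<^bsub>C\<^esub>"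
proof -
  interpret A: kalg A by fact
  interpret C: Module.module scalar_alg C by fact
  define K where "K = {s \<in> carrier A. \<forall>x\<in>carrier A. \<forall>y\<in>carrier A. L (x \<otimes>\<^bsub>A\<^esub> s \<otimes>\<^bsub>A\<^esub> y) = \<zero>\<^bsub>C\<^esub>}"
  have L0: "L \<zero>\<^bsub>A\<^esub> = \<zero>\<^bsub>C\<^esub>" by (rule lin_map_zero[OF kalg_vsp[OF A] C L])
  have "submodule K scalar_alg A"
  proof (rule submodule_scalarI[OF kalg_vsp[OF A]])
    show "x \<oplus>\<^bsub>A\<^esub> y \<in> K" if "x \<in> K" "y \<in> K" for x y
      using that unfolding K_def by (auto simp: A.l_distr A.r_distr lin_mapD(2)[OF L])
    show "c \<odot>\<^bsub>A\<^esub> x \<in> K" if "x \<in> K" for c x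
      using that unfolding K_def by (auto simp: A.smult_mult A.mult_smult lin_mapD(3)[OF L])
  qed (auto simp: K_def L0)
  then have sub: "subgroup K (add_monoid A)" by (rule submodule.axioms(1))
  have "ideal K A"
  proof (rule idealI[OF A.ring_axioms sub])
    fix a x assume a: "a \<in> K" and x: "x \<in> carrier A"
    show "x \<otimes>\<^bsub>A\<^esub> a \<in> K"
      using a x unfolding K_def by (auto simp: A.m_assoc[symmetric])
    show "a \<otimes>\<^bsub>A\<^esub> x \<in> K"
      using a x unfolding K_def by (auto simp: A.m_assoc)
  qed
  moreover have "S \<subseteq> K" using S LS unfolding K_def by auto
  ultimately have "x \<in> K" using x A.genideal_minimal by blast
  then have "L (\<one>\<^bsub>A\<^esub> \<otimes>\<^bsub>A\<^esub> x \<otimes>\<^bsub>A\<^esub> \<one>\<^bsub>A\<^esub>) = \<zero>\<^bsub>C\<^esub>" unfolding K_def by blast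
  then show ?thesis using \<open>x \<in> K\<close> unfolding K_def by simp
qed


section \<open>Monoid algebras\<close>

lemma monoid_alg_mult_superset:
  assumes "finite K" "Poly_Mapping.keys F \<subseteq> K" "finite L" "Poly_Mapping.keys G \<subseteq> L"
  shows "F \<otimes>\<^bsub>monoid_alg M\<^esub> G =
    (\<Sum>u\<in>K. \<Sum>v\<in>L. Poly_Mapping.single (u \<otimes>\<^bsub>M\<^esub> v) (Poly_Mapping.lookup F u * Poly_Mapping.lookup G v))"
proof -
  have "F \<otimes>\<^bsub>monoid_alg M\<^esub> G = (\<Sum>u\<in>Poly_Mapping.keys F. \<Sum>v\<in>L.
      Poly_Mapping.single (u \<otimes>\<^bsub>M\<^esub> v) (Poly_Mapping.lookup F u * Poly_Mapping.lookup G v))"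
    unfolding monoid_alg_def monoid.simps
    by (intro sum.cong refl sum.mono_neutral_left assms) (auto simp: in_keys_iff)
  also have "\<dots> = (\<Sum>u\<in>K. \<Sum>v\<in>L. Poly_Mapping.single (u \<otimes>\<^bsub>M\<^esub> v) (Poly_Mapping.lookup F u * Poly_Mapping.lookup G v))"
    using assms by (intro sum.mono_neutral_left) (auto simp: in_keys_iff)
  finally show ?thesis .
qed

lemma monoid_alg_mult_single:
  "Poly_Mapping.single u c \<otimes>\<^bsub>monoid_alg M\<^esub> Poly_Mapping.single v d = Poly_Mapping.single (u \<otimes>\<^bsub>M\<^esub> v) (c * d)"
  by (subst monoid_alg_mult_superset[of "{u}" _ "{v}"]) auto

lemma monoid_alg_mult_add_left:
  "(F + F') \<otimes>\<^bsub>monoid_alg M\<^esub> G = F \<otimes>\<^bsub>monoid_alg M\<^esub> G + F' \<otimes>\<^bsub>monoid_alg M\<^esub> G"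
proof -
  let ?K = "Poly_Mapping.keys F \<union> Poly_Mapping.keys F'" and ?L = "Poly_Mapping.keys G"
  show ?thesis using Poly_Mapping.keys_add[of F F']
    by (subst (1 2 3) monoid_alg_mult_superset[of ?K _ ?L])
      (auto simp: lookup_add algebra_simps single_add sum.distrib)
qed

lemma monoid_alg_mult_add_right:
  "G \<otimes>\<^bsub>monoid_alg M\<^esub> (F + F') = G \<otimes>\<^bsub>monoid_alg M\<^esub> F + G \<otimes>\<^bsub>monoid_alg M\<^esub> F'"
proof -
  let ?K = "Poly_Mapping.keys F \<union> Poly_Mapping.keys F'" and ?L = "Poly_Mapping.keys G"
  show ?thesis using Poly_Mapping.keys_add[of F F']
    by (subst (1 2 3) monoid_alg_mult_superset[of ?L _ ?K])
      (auto simp: lookup_add algebra_simps single_add sum.distrib)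
qed

lemma pm_scale_sum: "pm_scale c (\<Sum>x\<in>X. f x) = (\<Sum>x\<in>X. pm_scale c (f x))"
  by (rule poly_mapping_eqI) (simp add: lookup_sum sum_distrib_left)

lemma monoid_alg_mult_scale:
  "pm_scale c F \<otimes>\<^bsub>monoid_alg M\<^esub> G = pm_scale c (F \<otimes>\<^bsub>monoid_alg M\<^esub> G)"
  "F \<otimes>\<^bsub>monoid_alg M\<^esub> pm_scale c G = pm_scale c (F \<otimes>\<^bsub>monoid_alg M\<^esub> G)"
  using keys_pm_scale[of c F] keys_pm_scale[of c G]
  by (auto simp: monoid_alg_mult_superset[of "Poly_Mapping.keys F" _ "Poly_Mapping.keys G"]
      pm_scale_sum algebra_simps)

lemma monoid_alg_mult_zero [simp]:
  "0 \<otimes>\<^bsub>monoid_alg M\<^esub> G = 0" "F \<otimes>\<^bsub>monoid_alg M\<^esub> 0 = 0"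
  by (simp_all add: monoid_alg_def)

text \<open>Associativity is trilinear, so nested inductions over the three factors reduce it to
  associativity in \<open>M\<close>.\<close>

lemma kalg_monoid_alg:
  assumes "Group.monoid M"
  shows "kalg (monoid_alg M :: ('k::field, 'x \<Rightarrow>\<^sub>0 'k) module)"
proof -
  interpret M: Group.monoid M by fact
  let ?A = "monoid_alg M :: ('k, 'x \<Rightarrow>\<^sub>0 'k) module"
  note simps = monoid_alg_simps monoid_alg_mult_add_left monoid_alg_mult_add_right monoid_alg_mult_scale
  show ?thesis
  proof (rule kalgI[OF vsp_monoid_alg])
    fix F assume "F \<in> carrier ?A"
    then have F: "Poly_Mapping.keys F \<subseteq> carrier M" by (simp add: simps)
    show "\<one>\<^bsub>?A\<^esub> \<otimes>\<^bsub>?A\<^esub> F = F"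
      using F by (induction F rule: pm_induct) (auto simp: simps monoid_alg_mult_single)
    show "F \<otimes>\<^bsub>?A\<^esub> \<one>\<^bsub>?A\<^esub> = F"
      using F by (induction F rule: pm_induct) (auto simp: simps monoid_alg_mult_single)
    fix G assume "G \<in> carrier ?A"
    then have G: "Poly_Mapping.keys G \<subseteq> carrier M" by (simp add: simps)
    have "Poly_Mapping.keys (F \<otimes>\<^bsub>?A\<^esub> G) \<subseteq> carrier M"
      using F
    proof (induction F rule: pm_induct)
      case (single u c)
      show ?case using G
      proof (induction G rule: pm_induct)
        case (add F G)
        then show ?case by (auto simp: simps dest: subsetD[OF Poly_Mapping.keys_add])
      qed (use single in \<open>auto simp: monoid_alg_mult_single\<close>)
    next
      case (add F' F)
      then show ?case by (auto simp: simps dest: subsetD[OF Poly_Mapping.keys_add])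
    qed auto
    then show "F \<otimes>\<^bsub>?A\<^esub> G \<in> carrier ?A" by (simp add: simps)
    fix H assume "H \<in> carrier ?A"
    then have H: "Poly_Mapping.keys H \<subseteq> carrier M" by (simp add: simps)
    show "(F \<otimes>\<^bsub>?A\<^esub> G) \<otimes>\<^bsub>?A\<^esub> H = F \<otimes>\<^bsub>?A\<^esub> (G \<otimes>\<^bsub>?A\<^esub> H)"
      using F
    proof (induction F rule: pm_induct)
      case u: (single u c)
      show ?case using G
      proof (induction G rule: pm_induct)
        case v: (single v d)
        show ?case using H
          by (induction H rule: pm_induct)
            (use u v in \<open>auto simp: simps monoid_alg_mult_single M.m_assoc mult.assoc\<close>)
      qed (auto simp: simps)
    qed (auto simp: simps)
  qed (auto simp: simps)
qed


section \<open>Tensor products\<close>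

interpretation pm: vector_space "pm_scale :: 'k::field \<Rightarrow> ('x \<Rightarrow>\<^sub>0 'k) \<Rightarrow> ('x \<Rightarrow>\<^sub>0 'k)"
  by (rule vector_space_pm_scale)

definition bilin ::
  "('k::field, 'a) module \<Rightarrow> ('k, 'b) module \<Rightarrow> ('k, 'c) module \<Rightarrow> ('a \<Rightarrow> 'b \<Rightarrow> 'c) \<Rightarrow> bool" where
  "bilin A B C \<beta> \<longleftrightarrow>
     (\<forall>a\<in>carrier A. \<beta> a \<in> lin_map B C) \<and> (\<forall>b\<in>carrier B. (\<lambda>a. \<beta> a b) \<in> lin_map A C)"

lemma bilinI:
  "(\<And>a. a \<in> carrier A \<Longrightarrow> \<beta> a \<in> lin_map B C) \<Longrightarrow>
   (\<And>b. b \<in> carrier B \<Longrightarrow> (\<lambda>a. \<beta> a b) \<in> lin_map A C) \<Longrightarrow> bilin A B C \<beta>"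
  by (simp add: bilin_def)

lemma bilinD:
  assumes "bilin A B C \<beta>"
  shows "a \<in> carrier A \<Longrightarrow> \<beta> a \<in> lin_map B C"
    and "b \<in> carrier B \<Longrightarrow> (\<lambda>a. \<beta> a b) \<in> lin_map A C"
    and "a \<in> carrier A \<Longrightarrow> b \<in> carrier B \<Longrightarrow> \<beta> a b \<in> carrier C"
    and "a \<in> carrier A \<Longrightarrow> b \<in> carrier B \<Longrightarrow> b' \<in> carrier B \<Longrightarrow> \<beta> a (b \<oplus>\<^bsub>B\<^esub> b') = \<beta> a b \<oplus>\<^bsub>C\<^esub> \<beta> a b'"
    and "a \<in> carrier A \<Longrightarrow> a' \<in> carrier A \<Longrightarrow> b \<in> carrier B \<Longrightarrow> \<beta> (a \<oplus>\<^bsub>A\<^esub> a') b = \<beta> a b \<oplus>\<^bsub>C\<^esub> \<beta> a' b"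
    and "a \<in> carrier A \<Longrightarrow> b \<in> carrier B \<Longrightarrow> \<beta> a (c \<odot>\<^bsub>B\<^esub> b) = c \<odot>\<^bsub>C\<^esub> \<beta> a b"
    and "a \<in> carrier A \<Longrightarrow> b \<in> carrier B \<Longrightarrow> \<beta> (c \<odot>\<^bsub>A\<^esub> a) b = c \<odot>\<^bsub>C\<^esub> \<beta> a b"
proof -
  show *: "a \<in> carrier A \<Longrightarrow> \<beta> a \<in> lin_map B C" "b \<in> carrier B \<Longrightarrow> (\<lambda>a. \<beta> a b) \<in> lin_map A C" for a b
    using assms by (auto simp: bilin_def)
  show "a \<in> carrier A \<Longrightarrow> b \<in> carrier B \<Longrightarrow> \<beta> a b \<in> carrier C"
    and "a \<in> carrier A \<Longrightarrow> b \<in> carrier B \<Longrightarrow> b' \<in> carrier B \<Longrightarrow> \<beta> a (b \<oplus>\<^bsub>B\<^esub> b') = \<beta> a b \<oplus>\<^bsub>C\<^esub> \<beta> a b'"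
    and "a \<in> carrier A \<Longrightarrow> a' \<in> carrier A \<Longrightarrow> b \<in> carrier B \<Longrightarrow> \<beta> (a \<oplus>\<^bsub>A\<^esub> a') b = \<beta> a b \<oplus>\<^bsub>C\<^esub> \<beta> a' b"
    and "a \<in> carrier A \<Longrightarrow> b \<in> carrier B \<Longrightarrow> \<beta> a (c \<odot>\<^bsub>B\<^esub> b) = c \<odot>\<^bsub>C\<^esub> \<beta> a b"
    and "a \<in> carrier A \<Longrightarrow> b \<in> carrier B \<Longrightarrow> \<beta> (c \<odot>\<^bsub>A\<^esub> a) b = c \<odot>\<^bsub>C\<^esub> \<beta> a b"
    using lin_mapD[OF *(1)] lin_mapD[OF *(2)] by auto
qed

lemma lin_map_add:
  assumes "vsp B" "f \<in> lin_map A B" "g \<in> lin_map A B"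
  shows "(\<lambda>x. f x \<oplus>\<^bsub>B\<^esub> g x) \<in> lin_map A B"
proof -
  interpret B: Module.module scalar_alg B by fact
  show ?thesis
    by (rule lin_mapI)
      (auto simp: lin_mapD[OF assms(2)] lin_mapD[OF assms(3)] B.smult_r_distr B.M.a_ac)
qed

lemma lin_map_smult:
  assumes "vsp B" "f \<in> lin_map A B"
  shows "(\<lambda>x. c \<odot>\<^bsub>B\<^esub> f x) \<in> lin_map A B"
proof -
  interpret B: Module.module scalar_alg B by fact
  have "c \<odot>\<^bsub>B\<^esub> (d \<odot>\<^bsub>B\<^esub> y) = d \<odot>\<^bsub>B\<^esub> (c \<odot>\<^bsub>B\<^esub> y)" if "y \<in> carrier B" for d y
    using B.smult_assoc1[of c d y] B.smult_assoc1[of d c y] that by (simp add: mult.commute)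
  then show ?thesis
    by (intro lin_mapI) (auto simp: lin_mapD[OF assms(2)] B.smult_r_distr)
qed

lemma lin_map_const_zero: "vsp B \<Longrightarrow> (\<lambda>x. \<zero>\<^bsub>B\<^esub>) \<in> lin_map A B"
proof -
  assume "vsp B"
  then interpret B: Module.module scalar_alg B .
  show ?thesis by (rule lin_mapI) auto
qed

lemma bilin_comp:
  assumes "bilin A B C \<beta>" "f \<in> lin_map A' A" "g \<in> lin_map B' B" "h \<in> lin_map C C'"
  shows "bilin A' B' C' (\<lambda>a b. h (\<beta> (f a) (g b)))"
  by (rule bilinI; rule lin_mapI)
    (auto simp: lin_mapD[OF assms(2)] lin_mapD[OF assms(3)] lin_mapD[OF assms(4)] bilinD[OF assms(1)])

lemma bilin_mult: "kalg A \<Longrightarrow> bilin A A A (\<lambda>x y. x \<otimes>\<^bsub>A\<^esub> y)"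
proof -
  assume "kalg A"
  then interpret kalg A .
  show ?thesis by (rule bilinI; rule lin_mapI) (auto simp: l_distr r_distr smult_mult mult_smult)
qed

lemma bilin_smult:
  assumes "vsp A" "vsp B" "\<phi> \<in> lin_map A scalar_alg"
  shows "bilin A B B (\<lambda>a b. \<phi> a \<odot>\<^bsub>B\<^esub> b)"
proof -
  interpret A: Module.module scalar_alg A by fact
  interpret B: Module.module scalar_alg B by fact
  have *: "c \<odot>\<^bsub>B\<^esub> (d \<odot>\<^bsub>B\<^esub> y) = d \<odot>\<^bsub>B\<^esub> (c \<odot>\<^bsub>B\<^esub> y)" if "y \<in> carrier B" for c d y
    using B.smult_assoc1[of c d y] B.smult_assoc1[of d c y] that by (simp add: mult.commute)
  show ?thesis
    by (rule bilinI; rule lin_mapI)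
      (use lin_mapD[OF assms(3)] B.smult_l_distr B.smult_assoc1 in \<open>auto simp: B.smult_r_distr *\<close>)
qed

lemma bilin_swap: "bilin A B C \<beta> \<Longrightarrow> bilin B A C (\<lambda>b a. \<beta> a b)"
  by (auto simp: bilin_def)

locale tens =
  fixes A :: "('k::field, 'a) module" and B :: "('k, 'b) module"
  assumes vA: "vsp A" and vB: "vsp B"
begin

sublocale A: Module.module scalar_alg A by (rule vA)
sublocale B: Module.module scalar_alg B by (rule vB)

abbreviation "F\<^sub>0 \<equiv> (monoid_alg (A \<times>\<times> B) :: ('k, 'a \<times> 'b \<Rightarrow>\<^sub>0 'k) module)"

lemma tensor_rels_closed: "tensor_rels A B \<subseteq> carrier F\<^sub>0"
proof -
  have m: "F - G \<in> carrier F\<^sub>0" if "F \<in> carrier F\<^sub>0" "G \<in> carrier F\<^sub>0" for F G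
  proof -
    interpret Module.module scalar_alg F\<^sub>0 by (rule vsp_monoid_alg)
    show ?thesis using monoid_alg_minus[OF that] that by (metis minus_closed)
  qed
  have sc: "Poly_Mapping.single (a, b) c \<in> carrier F\<^sub>0" if "a \<in> carrier A" "b \<in> carrier B" for a b c
    using that by (auto simp: monoid_alg_simps)
  show ?thesis
    unfolding tensor_rels_def by (auto intro!: m sc)
qed

lemma tensor_null_submodule: "submodule (tensor_null A B) scalar_alg F\<^sub>0"
proof (rule submodule_scalarI[OF vsp_monoid_alg])
  have "pm.subspace (carrier F\<^sub>0)"
    by (rule pm.subspaceI)
      (auto simp: monoid_alg_simps dest: subsetD[OF Poly_Mapping.keys_add] subsetD[OF keys_pm_scale])
  then show "tensor_null A B \<subseteq> carrier F\<^sub>0"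
    unfolding tensor_null_def by (intro pm.span_minimal tensor_rels_closed)
qed (auto simp: tensor_null_def monoid_alg_simps pm.span_zero pm.span_add pm.span_scale)

sublocale free_quot "A \<times>\<times> B" "tensor_null A B"
  by unfold_locales (use submodule.axioms[OF tensor_null_submodule] in \<open>auto simp: submodule_axioms_def
      subgroup_def\<close>)

lemma tensor_eq: "tensor A B = quot_alg F\<^sub>0 (tensor_null A B)"
  by (simp add: tensor_def)

lemma vsp_tensor: "vsp (tensor A B)"
  unfolding tensor_eq by (rule vsp_quot)

lemma pure_closed [simp, intro]: "a \<in> carrier A \<Longrightarrow> b \<in> carrier B \<Longrightarrow> pure A B a b \<in> carrier (tensor A B)"
  unfolding tensor_eq pure_def by (rule cls_closed) simp

text \<open>The four families in \<open>tensor_rels\<close> are the axioms of bilinearity, so the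
  extension kills each relation; its kernel is a subspace and therefore contains their span.\<close>

lemma bilin_null:
  assumes C: "vsp C" and \<beta>: "bilin A B C \<beta>" and F: "F \<in> tensor_null A B"
  shows "linext C (\<lambda>(a, b). \<beta> a b) F = \<zero>\<^bsub>C\<^esub>"
proof -
  interpret C: Module.module scalar_alg C by fact
  let ?L = "linext C (\<lambda>(a, b). \<beta> a b)"
  note \<beta>D = bilinD[OF \<beta>]
  have bc: "(\<lambda>(a, b). \<beta> a b) \<in> carrier (A \<times>\<times> B) \<rightarrow> carrier C" using \<beta>D(3) by auto
  note lin = linext_lin[OF C bc refl]
  have s: "?L (Poly_Mapping.single (a, b) c) = c \<odot>\<^bsub>C\<^esub> \<beta> a b"
    if "a \<in> carrier A" "b \<in> carrier B" for a b c
    using linext_single[OF C bc, of "(a, b)" c] that by simp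
  have m: "?L (F - G) = ?L F \<ominus>\<^bsub>C\<^esub> ?L G \<and> F - G \<in> carrier F\<^sub>0" if "F \<in> carrier F\<^sub>0" "G \<in> carrier F\<^sub>0" for F G
    using lin_map_minus[OF vsp_monoid_alg C lin that] that
    by (metis monoid_alg_minus M.minus_closed)
  have sc: "Poly_Mapping.single (a, b) c \<in> carrier F\<^sub>0" if "a \<in> carrier A" "b \<in> carrier B" for a b c
    using that by (auto simp: monoid_alg_simps)
  have one: "1 \<odot>\<^bsub>C\<^esub> y = y" if "y \<in> carrier C" for y
    using C.smult_one[OF that] by simp
  have rel: "?L r = \<zero>\<^bsub>C\<^esub>" if "r \<in> tensor_rels A B" for r
    using that unfolding tensor_rels_def
  proof (elim UnE CollectE exE conjE)
    fix a a' b
    assume r: "r = Poly_Mapping.single (a \<oplus>\<^bsub>A\<^esub> a', b) 1 - Poly_Mapping.single (a, b) 1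
       - Poly_Mapping.single (a', b) 1" and c: "a \<in> carrier A" "a' \<in> carrier A" "b \<in> carrier B"
    show ?thesis unfolding r using c \<beta>D(3)
      by (simp add: m sc s one \<beta>D(5) C.M.minus_eq C.M.minus_add C.M.a_ac C.M.r_neg C.M.r_neg2 C.M.r_neg1)
  next
    fix a b b'
    assume r: "r = Poly_Mapping.single (a, b \<oplus>\<^bsub>B\<^esub> b') 1 - Poly_Mapping.single (a, b) 1
       - Poly_Mapping.single (a, b') 1" and c: "a \<in> carrier A" "b \<in> carrier B" "b' \<in> carrier B"
    show ?thesis unfolding r using c \<beta>D(3)
      by (simp add: m sc s one \<beta>D(4) C.M.minus_eq C.M.minus_add C.M.a_ac C.M.r_neg C.M.r_neg2 C.M.r_neg1)
  next
    fix c a b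
    assume r: "r = Poly_Mapping.single (c \<odot>\<^bsub>A\<^esub> a, b) 1 - Poly_Mapping.single (a, b) c"
      and c: "a \<in> carrier A" "b \<in> carrier B"
    show ?thesis unfolding r using c \<beta>D(3)
      by (simp add: m sc s one \<beta>D(7) C.M.minus_eq C.M.r_neg)
  next
    fix c a b
    assume r: "r = Poly_Mapping.single (a, c \<odot>\<^bsub>B\<^esub> b) 1 - Poly_Mapping.single (a, b) c"
      and c: "a \<in> carrier A" "b \<in> carrier B"
    show ?thesis unfolding r using c \<beta>D(3)
      by (simp add: m sc s one \<beta>D(6) C.M.minus_eq C.M.r_neg)
  qed
  have "pm.subspace {F \<in> carrier F\<^sub>0. ?L F = \<zero>\<^bsub>C\<^esub>}"
  proof (rule pm.subspaceI)
    show "0 \<in> {F \<in> carrier F\<^sub>0. ?L F = \<zero>\<^bsub>C\<^esub>}"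
      using lin_map_zero[OF vsp_monoid_alg C lin] by (simp add: monoid_alg_simps)
  qed (use M.add.m_closed lin_mapD(2,3)[OF lin] smult_closed in \<open>auto simp: monoid_alg_simps(4,5)\<close>)
  then have "tensor_null A B \<subseteq> {F \<in> carrier F\<^sub>0. ?L F = \<zero>\<^bsub>C\<^esub>}"
    unfolding tensor_null_def using rel tensor_rels_closed by (intro pm.span_minimal) auto
  then show ?thesis using F by auto
qed

lemma tensor_lift:
  assumes C: "vsp C" and \<beta>: "bilin A B C \<beta>"
  shows "lin_lift C (\<lambda>(a, b). \<beta> a b) \<in> lin_map (tensor A B) C"
    and "a \<in> carrier A \<Longrightarrow> b \<in> carrier B \<Longrightarrow> lin_lift C (\<lambda>(a, b). \<beta> a b) (pure A B a b) = \<beta> a b"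
proof -
  have bc: "(\<lambda>(a, b). \<beta> a b) \<in> carrier (A \<times>\<times> B) \<rightarrow> carrier C" using bilinD[OF \<beta>] by auto
  show "lin_lift C (\<lambda>(a, b). \<beta> a b) \<in> lin_map (tensor A B) C"
    unfolding tensor_eq by (rule lin_lift_lin[OF C bc bilin_null[OF C \<beta>]])
  show "a \<in> carrier A \<Longrightarrow> b \<in> carrier B \<Longrightarrow> lin_lift C (\<lambda>(a, b). \<beta> a b) (pure A B a b) = \<beta> a b"
    unfolding pure_def using lin_lift_cls[OF C bc bilin_null[OF C \<beta>], of "(a, b)"] by simp
qed

lemma bilin_pure: "bilin A B (tensor A B) (pure A B)"
proof -
  have eq: "tensor_null A B +>\<^bsub>F\<^sub>0\<^esub> F = tensor_null A B +>\<^bsub>F\<^sub>0\<^esub> G"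
    if "F \<in> carrier F\<^sub>0" "G \<in> carrier F\<^sub>0" "F - G \<in> tensor_rels A B" for F G
    using coset_eq_iff[OF that(1,2)] that
    by (simp add: monoid_alg_minus[OF that(1,2)] tensor_null_def pm.span_base)
  have add: "tensor_null A B +>\<^bsub>F\<^sub>0\<^esub> (F + G) =
      (tensor_null A B +>\<^bsub>F\<^sub>0\<^esub> F) \<oplus>\<^bsub>tensor A B\<^esub> (tensor_null A B +>\<^bsub>F\<^sub>0\<^esub> G)"
    if "F \<in> carrier F\<^sub>0" "G \<in> carrier F\<^sub>0" for F G
    using coset_add[OF that] by (simp add: tensor_eq monoid_alg_simps(4))
  have sc: "Poly_Mapping.single (a, b) c \<in> carrier F\<^sub>0" if "a \<in> carrier A" "b \<in> carrier B" for a b c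
    using that by (auto simp: monoid_alg_simps)
  have addc: "F + G \<in> carrier F\<^sub>0" if "F \<in> carrier F\<^sub>0" "G \<in> carrier F\<^sub>0" for F G
    using M.add.m_closed[OF that] by (simp add: monoid_alg_simps(4))
  show ?thesis
  proof (rule bilinI; rule lin_mapI)
    fix a b b' assume "a \<in> carrier A" "b \<in> carrier B" "b' \<in> carrier B"
    then show "pure A B a (b \<oplus>\<^bsub>B\<^esub> b') = pure A B a b \<oplus>\<^bsub>tensor A B\<^esub> pure A B a b'"
      unfolding pure_def by (subst add[symmetric], (auto simp: sc)[2], intro eq addc sc)
        (auto simp: tensor_rels_def diff_diff_eq[symmetric])
  next
    fix a c b assume "a \<in> carrier A" "b \<in> carrier B"
    then show "pure A B a (c \<odot>\<^bsub>B\<^esub> b) = c \<odot>\<^bsub>tensor A B\<^esub> pure A B a b"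
      unfolding pure_def tensor_eq
      by (subst coset_single[symmetric], simp, intro eq sc) (auto simp: tensor_rels_def)
  next
    fix a a' b assume "a \<in> carrier A" "a' \<in> carrier A" "b \<in> carrier B"
    then show "pure A B (a \<oplus>\<^bsub>A\<^esub> a') b = pure A B a b \<oplus>\<^bsub>tensor A B\<^esub> pure A B a' b"
      unfolding pure_def by (subst add[symmetric], (auto simp: sc)[2], intro eq addc sc)
        (auto simp: tensor_rels_def diff_diff_eq[symmetric])
  next
    fix a c b assume "a \<in> carrier A" "b \<in> carrier B"
    then show "pure A B (c \<odot>\<^bsub>A\<^esub> a) b = c \<odot>\<^bsub>tensor A B\<^esub> pure A B a b"
      unfolding pure_def tensor_eq
      by (subst coset_single[symmetric], simp, intro eq sc) (auto simp: tensor_rels_def)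
  qed auto
qed

text \<open>The pure case carries no scalar: \<open>c\<close> is absorbed into the left factor of
  the tensor.\<close>

lemma tensor_induct [consumes 1, case_names zero pure add]:
  assumes "Y \<in> carrier (tensor A B)"
    and "P \<zero>\<^bsub>tensor A B\<^esub>"
    and p: "\<And>a b. a \<in> carrier A \<Longrightarrow> b \<in> carrier B \<Longrightarrow> P (pure A B a b)"
    and "\<And>Y Z. Y \<in> carrier (tensor A B) \<Longrightarrow> Z \<in> carrier (tensor A B) \<Longrightarrow> P Y \<Longrightarrow> P Z \<Longrightarrow>
      P (Y \<oplus>\<^bsub>tensor A B\<^esub> Z)"
  shows "P Y"
  using assms(1) unfolding tensor_eq
proof (induction Y rule: Q_induct)
  case (scaled x c)
  obtain a b where x: "x = (a, b)" "a \<in> carrier A" "b \<in> carrier B" using scaled by auto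
  show ?case using p[of "c \<odot>\<^bsub>A\<^esub> a" b] x bilinD(7)[OF bilin_pure, of a b c]
    by (simp add: pure_def tensor_eq)
qed (use assms in \<open>simp_all add: tensor_eq\<close>)

lemma lin_map_tensor_eq:
  assumes "vsp C" "h \<in> lin_map (tensor A B) C" "h' \<in> lin_map (tensor A B) C"
    and "\<And>a b. a \<in> carrier A \<Longrightarrow> b \<in> carrier B \<Longrightarrow> h (pure A B a b) = h' (pure A B a b)"
    and "Y \<in> carrier (tensor A B)"
  shows "h Y = h' Y"
  by (rule lin_map_Q_eq[OF assms(1) assms(2,3)[unfolded tensor_eq]])
    (use assms(4,5) in \<open>auto simp: pure_def tensor_eq\<close>)

end

lemma tensI: "vsp A \<Longrightarrow> vsp B \<Longrightarrow> tens A B"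
  by (simp add: tens_def)

lemma tensor_map_lin:
  assumes "vsp A" "vsp B" "vsp C" "vsp D" "f \<in> lin_map A C" "g \<in> lin_map B D"
  shows "tensor_map C D f g \<in> lin_map (tensor A B) (tensor C D)"
    and "a \<in> carrier A \<Longrightarrow> b \<in> carrier B \<Longrightarrow> tensor_map C D f g (pure A B a b) = pure C D (f a) (g b)"
proof -
  interpret AB: tens A B using assms by (simp add: tens_def)
  interpret CD: tens C D using assms by (simp add: tens_def)
  have b: "bilin A B (tensor C D) (\<lambda>a b. pure C D (f a) (g b))"
    by (rule bilin_comp[OF CD.bilin_pure assms(5,6) lin_map_id])
  show "tensor_map C D f g \<in> lin_map (tensor A B) (tensor C D)"
    and "a \<in> carrier A \<Longrightarrow> b \<in> carrier B \<Longrightarrow> tensor_map C D f g (pure A B a b) = pure C D (f a) (g b)"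
    unfolding tensor_map_def using AB.tensor_lift[OF CD.vsp_tensor b] by auto
qed

text \<open>\<open>tensor_assoc\<close> nests two lifts, and the inner one depends on the outer
  variable \<open>c\<close>. Linearity in this parameter, checked on pure tensors, is what permits
  the outer lift.\<close>

lemma bilin_tensor_lift:
  assumes A: "vsp A" and B: "vsp B" and C: "vsp C" and D: "vsp D"
    and \<beta>: "\<And>c. c \<in> carrier C \<Longrightarrow> bilin A B D (\<beta> c)"
    and lin: "\<And>a b. a \<in> carrier A \<Longrightarrow> b \<in> carrier B \<Longrightarrow> (\<lambda>c. \<beta> c a b) \<in> lin_map C D"
  shows "bilin (tensor A B) C D (\<lambda>X c. lin_lift D (\<lambda>(a, b). \<beta> c a b) X)"
proof -
  interpret AB: tens A B using A B by (simp add: tens_def)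
  interpret C: Module.module scalar_alg C by fact
  note L = AB.tensor_lift[OF D \<beta>]
  show ?thesis
  proof (rule bilinI)
    show "(\<lambda>X. lin_lift D (\<lambda>(a, b). \<beta> c a b) X) \<in> lin_map (tensor A B) D" if "c \<in> carrier C" for c
      using L(1)[OF that] by simp
    fix X assume X: "X \<in> carrier (tensor A B)"
    show "(\<lambda>c. lin_lift D (\<lambda>(a, b). \<beta> c a b) X) \<in> lin_map C D"
    proof (rule lin_mapI)
      show "lin_lift D (\<lambda>(a, b). \<beta> c a b) X \<in> carrier D" if "c \<in> carrier C" for c
        using L(1)[OF that] X by (auto dest: lin_mapD)
      show "lin_lift D (\<lambda>(a, b). \<beta> (c \<oplus>\<^bsub>C\<^esub> c') a b) X =
          lin_lift D (\<lambda>(a, b). \<beta> c a b) X \<oplus>\<^bsub>D\<^esub> lin_lift D (\<lambda>(a, b). \<beta> c' a b) X"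
        if c: "c \<in> carrier C" "c' \<in> carrier C" for c c'
        by (rule AB.lin_map_tensor_eq[OF D L(1) lin_map_add[OF D L(1) L(1)] _ X])
          (use c in \<open>auto simp: L(2) lin_mapD(2)[OF lin]\<close>)
      show "lin_lift D (\<lambda>(a, b). \<beta> (k \<odot>\<^bsub>C\<^esub> c) a b) X = k \<odot>\<^bsub>D\<^esub> lin_lift D (\<lambda>(a, b). \<beta> c a b) X"
        if c: "c \<in> carrier C" for c k
        by (rule AB.lin_map_tensor_eq[OF D L(1) lin_map_smult[OF D L(1)] _ X])
          (use c in \<open>auto simp: L(2) lin_mapD(3)[OF lin]\<close>)
    qed
  qed
qed

lemma tensor_assoc_lin:
  assumes A: "vsp A" and B: "vsp B" and C: "vsp C"
  shows "tensor_assoc A B C \<in> lin_map (tensor (tensor A B) C) (tensor A (tensor B C))"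
    and "a \<in> carrier A \<Longrightarrow> b \<in> carrier B \<Longrightarrow> c \<in> carrier C \<Longrightarrow>
      tensor_assoc A B C (pure (tensor A B) C (pure A B a b) c) = pure A (tensor B C) a (pure B C b c)"
proof -
  interpret AB: tens A B using A B by (simp add: tens_def)
  interpret BC: tens B C using B C by (simp add: tens_def)
  interpret A_BC: tens A "tensor B C" by (intro tensI A BC.vsp_tensor)
  interpret AB_C: tens "tensor A B" C by (intro tensI C AB.vsp_tensor)
  let ?D = "tensor A (tensor B C)"
  have \<beta>: "bilin A B ?D (\<lambda>a b. pure A (tensor B C) a (pure B C b c))" if "c \<in> carrier C" for c
    using bilin_comp[OF A_BC.bilin_pure lin_map_id bilinD(2)[OF BC.bilin_pure that] lin_map_id] .
  have lin: "(\<lambda>c. pure A (tensor B C) a (pure B C b c)) \<in> lin_map C ?D"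
    if "a \<in> carrier A" "b \<in> carrier B" for a b
    using lin_map_comp[OF bilinD(1)[OF BC.bilin_pure] bilinD(1)[OF A_BC.bilin_pure]] that by blast
  note bl = bilin_tensor_lift[OF A B C A_BC.vsp_tensor \<beta> lin]
  show "tensor_assoc A B C \<in> lin_map (tensor (tensor A B) C) ?D"
    unfolding tensor_assoc_def using AB_C.tensor_lift(1)[OF A_BC.vsp_tensor bl] by simp
  show "tensor_assoc A B C (pure (tensor A B) C (pure A B a b) c) = pure A (tensor B C) a (pure B C b c)"
    if "a \<in> carrier A" "b \<in> carrier B" "c \<in> carrier C"
    unfolding tensor_assoc_def using AB_C.tensor_lift(2)[OF A_BC.vsp_tensor bl] that
      AB.tensor_lift(2)[OF A_BC.vsp_tensor \<beta>] by simp
qed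


section \<open>Tensor products of algebras\<close>

locale tens_alg =
  fixes A :: "('k::field, 'a) module" and B :: "('k, 'b) module"
  assumes kA: "kalg A" and kB: "kalg B"
begin

sublocale A: kalg A by (rule kA)
sublocale B: kalg B by (rule kB)
sublocale tens A B using kA kB by (simp add: tens_def kalg_def)

lemma kalg_F\<^sub>0: "kalg F\<^sub>0"
  by (intro kalg_monoid_alg DirProd_monoid A.monoid_axioms B.monoid_axioms)

text \<open>No computation with the relations is made. Multiplication by a basis element
  \<open>u\<close> turns \<open>pure\<close> into another bilinear map, and
  \<open>bilin_null\<close> says that every bilinear map kills \<open>tensor_null\<close>; a general
  factor is a combination of basis elements.\<close>

lemma tensor_null_ideal: "ideal (tensor_null A B) F\<^sub>0"
proof -
  interpret F: kalg F\<^sub>0 by (rule kalg_F\<^sub>0)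
  let ?cl = "\<lambda>F. tensor_null A B +>\<^bsub>F\<^sub>0\<^esub> F"
  have null: "F \<in> tensor_null A B" if "F \<in> carrier F\<^sub>0" "?cl F = \<zero>\<^bsub>tensor A B\<^esub>" for F
    using a_coset_join1[of "tensor_null A B" F] that submodule.axioms(1)[OF tensor_null_submodule]
    by (simp add: tensor_eq quot_alg_simps(2))
  have sc: "Poly_Mapping.single u c \<in> carrier F\<^sub>0" if "u \<in> carrier (A \<times>\<times> B)" for u c
    using that by (auto simp: monoid_alg_simps)
  have nc: "F \<in> carrier F\<^sub>0" if "F \<in> tensor_null A B" for F using sub_closed(1) that by blast
  note clin = coset_lin[folded tensor_eq]
  \<comment> \<open>\<open>h\<close> stands for left or right multiplication by \<open>u\<close>,
    and \<open>\<beta>\<close> for the bilinear map that it induces on pairs.\<close>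
  have step: "h F \<in> tensor_null A B"
    if h: "h \<in> lin_map F\<^sub>0 F\<^sub>0" and \<beta>: "bilin A B (tensor A B) \<beta>"
      and eq: "\<And>a b. a \<in> carrier A \<Longrightarrow> b \<in> carrier B \<Longrightarrow> ?cl (h (Poly_Mapping.single (a, b) 1)) = \<beta> a b"
      and F: "F \<in> tensor_null A B" for h \<beta> F
  proof (rule null)
    show "h F \<in> carrier F\<^sub>0" using lin_mapD(1)[OF h] nc[OF F] by auto
    have bc: "(\<lambda>(a, b). \<beta> a b) \<in> carrier (A \<times>\<times> B) \<rightarrow> carrier (tensor A B)" using bilinD[OF \<beta>] by auto
    have "?cl (h F) = linext (tensor A B) (\<lambda>(a, b). \<beta> a b) F"
    proof (rule lin_map_monoid_alg_eq[OF vsp_tensor lin_map_comp[OF h clin] linext_lin[OF vsp_tensor bc refl] _ nc[OF F]])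
      fix x assume x: "x \<in> carrier (A \<times>\<times> B)"
      interpret T: Module.module scalar_alg "tensor A B" by (rule vsp_tensor)
      show "?cl (h (Poly_Mapping.single x 1)) = linext (tensor A B) (\<lambda>(a, b). \<beta> a b) (Poly_Mapping.single x 1)"
        using linext_single[OF vsp_tensor bc x, of 1] x eq bilinD(3)[OF \<beta>] T.smult_one by (cases x) auto
    qed
    then show "?cl (h F) = \<zero>\<^bsub>tensor A B\<^esub>" using bilin_null[OF vsp_tensor \<beta> F] by simp
  qed
  have left: "Poly_Mapping.single u 1 \<otimes>\<^bsub>F\<^sub>0\<^esub> F \<in> tensor_null A B"
    if F: "F \<in> tensor_null A B" and u: "u \<in> carrier (A \<times>\<times> B)" for F u
  proof (rule step[OF _ _ _ F])
    show "(\<lambda>F. Poly_Mapping.single u 1 \<otimes>\<^bsub>F\<^sub>0\<^esub> F) \<in> lin_map F\<^sub>0 F\<^sub>0"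
      using bilinD(1)[OF bilin_mult[OF kalg_F\<^sub>0] sc[OF u]] by simp
    show "bilin A B (tensor A B) (\<lambda>a b. pure A B (fst u \<otimes>\<^bsub>A\<^esub> a) (snd u \<otimes>\<^bsub>B\<^esub> b))"
      using bilin_comp[OF bilin_pure bilinD(1)[OF bilin_mult[OF kA]] bilinD(1)[OF bilin_mult[OF kB]] lin_map_id] u
      by auto
  qed (cases u; simp add: monoid_alg_mult_single pure_def)
  have right: "F \<otimes>\<^bsub>F\<^sub>0\<^esub> Poly_Mapping.single u 1 \<in> tensor_null A B"
    if F: "F \<in> tensor_null A B" and u: "u \<in> carrier (A \<times>\<times> B)" for F u
  proof (rule step[OF _ _ _ F])
    show "(\<lambda>F. F \<otimes>\<^bsub>F\<^sub>0\<^esub> Poly_Mapping.single u 1) \<in> lin_map F\<^sub>0 F\<^sub>0"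
      using bilinD(2)[OF bilin_mult[OF kalg_F\<^sub>0] sc[OF u]] by simp
    show "bilin A B (tensor A B) (\<lambda>a b. pure A B (a \<otimes>\<^bsub>A\<^esub> fst u) (b \<otimes>\<^bsub>B\<^esub> snd u))"
      using bilin_comp[OF bilin_pure bilinD(2)[OF bilin_mult[OF kA]] bilinD(2)[OF bilin_mult[OF kB]] lin_map_id] u
      by auto
  qed (cases u; simp add: monoid_alg_mult_single pure_def)
  show ?thesis
  proof (rule idealI[OF F.ring_axioms submodule.axioms(1)[OF tensor_null_submodule]])
    fix F G assume F: "F \<in> tensor_null A B" and "G \<in> carrier F\<^sub>0"
    then have "Poly_Mapping.keys G \<subseteq> carrier (A \<times>\<times> B)" by (simp add: monoid_alg_simps)
    then have "G \<otimes>\<^bsub>F\<^sub>0\<^esub> F \<in> tensor_null A B \<and> F \<otimes>\<^bsub>F\<^sub>0\<^esub> G \<in> tensor_null A B"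
    proof (induction G rule: pm_induct)
      case zero
      show ?case using sub_closed(2) by (simp add: monoid_alg_simps)
    next
      case (single u c)
      have *: "Poly_Mapping.single u c = pm_scale c (Poly_Mapping.single u 1)" by simp
      show ?case unfolding * monoid_alg_mult_scale
        using left[OF F single] right[OF F single] sub_closed(5) by (simp add: monoid_alg_simps(5))
    next
      case (add G H)
      then show ?case using sub_closed(3)
        by (simp add: monoid_alg_mult_add_left monoid_alg_mult_add_right monoid_alg_simps(4))
    qed
    then show "G \<otimes>\<^bsub>F\<^sub>0\<^esub> F \<in> tensor_null A B" "F \<otimes>\<^bsub>F\<^sub>0\<^esub> G \<in> tensor_null A B" by auto
  qed
qed

sublocale TI: kalg_ideal F\<^sub>0 "tensor_null A B"
  by (intro kalg_ideal.intro kalg_F\<^sub>0 tensor_null_ideal)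

lemma kalg_tensor: "kalg (tensor A B)"
  unfolding tensor_eq by (rule TI.kalg_quot)

lemma pure_mult:
  assumes "a \<in> carrier A" "b \<in> carrier B" "a' \<in> carrier A" "b' \<in> carrier B"
  shows "pure A B a b \<otimes>\<^bsub>tensor A B\<^esub> pure A B a' b' = pure A B (a \<otimes>\<^bsub>A\<^esub> a') (b \<otimes>\<^bsub>B\<^esub> b')"
  unfolding pure_def tensor_eq using assms
  by (subst TI.coset_mult[symmetric]) (auto simp: monoid_alg_simps monoid_alg_mult_single)

lemma pure_one: "\<one>\<^bsub>tensor A B\<^esub> = pure A B \<one>\<^bsub>A\<^esub> \<one>\<^bsub>B\<^esub>"
  by (simp add: pure_def tensor_eq quot_alg_simps(3) monoid_alg_simps(2))

text \<open>One variable at a time: first \<open>X\<close> becomes arbitrary against a pure tensor,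
  then \<open>Y\<close>.\<close>

lemma bilin_eq_on_pure:
  assumes C: "vsp C" and \<beta>: "bilin (tensor A B) (tensor A B) C \<beta>" "bilin (tensor A B) (tensor A B) C \<beta>'"
    and eq: "\<And>a b a' b'. a \<in> carrier A \<Longrightarrow> b \<in> carrier B \<Longrightarrow> a' \<in> carrier A \<Longrightarrow> b' \<in> carrier B \<Longrightarrow>
      \<beta> (pure A B a b) (pure A B a' b') = \<beta>' (pure A B a b) (pure A B a' b')"
    and XY: "X \<in> carrier (tensor A B)" "Y \<in> carrier (tensor A B)"
  shows "\<beta> X Y = \<beta>' X Y"
proof -
  have "\<beta> X (pure A B a b) = \<beta>' X (pure A B a b)" if "a \<in> carrier A" "b \<in> carrier B" for a b
    using lin_map_tensor_eq[OF C bilinD(2)[OF \<beta>(1)] bilinD(2)[OF \<beta>(2)] _ XY(1), of "pure A B a b" "pure A B a b"]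
      eq that by auto
  then show ?thesis
    using lin_map_tensor_eq[OF C bilinD(1)[OF \<beta>(1)] bilinD(1)[OF \<beta>(2)] _ XY(2), of X X] XY by auto
qed

lemma tensor_alg_homI:
  assumes C: "kalg C" and h: "h \<in> lin_map (tensor A B) C"
    and one: "h (pure A B \<one>\<^bsub>A\<^esub> \<one>\<^bsub>B\<^esub>) = \<one>\<^bsub>C\<^esub>"
    and mult: "\<And>a b a' b'. a \<in> carrier A \<Longrightarrow> b \<in> carrier B \<Longrightarrow> a' \<in> carrier A \<Longrightarrow> b' \<in> carrier B \<Longrightarrow>
      h (pure A B (a \<otimes>\<^bsub>A\<^esub> a') (b \<otimes>\<^bsub>B\<^esub> b')) = h (pure A B a b) \<otimes>\<^bsub>C\<^esub> h (pure A B a' b')"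
  shows "h \<in> alg_hom (tensor A B) C"
proof (rule alg_homI[OF h])
  show "h \<one>\<^bsub>tensor A B\<^esub> = \<one>\<^bsub>C\<^esub>" using one by (simp add: pure_one)
  show "h (X \<otimes>\<^bsub>tensor A B\<^esub> Y) = h X \<otimes>\<^bsub>C\<^esub> h Y"
    if "X \<in> carrier (tensor A B)" "Y \<in> carrier (tensor A B)" for X Y
  proof (rule bilin_eq_on_pure[OF kalg_vsp[OF C] _ _ _ that])
    show "bilin (tensor A B) (tensor A B) C (\<lambda>X Y. h (X \<otimes>\<^bsub>tensor A B\<^esub> Y))"
      by (rule bilin_comp[OF bilin_mult[OF kalg_tensor] lin_map_id lin_map_id h])
    show "bilin (tensor A B) (tensor A B) C (\<lambda>X Y. h X \<otimes>\<^bsub>C\<^esub> h Y)"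
      by (rule bilin_comp[OF bilin_mult[OF C] h h lin_map_id])
  qed (simp add: pure_mult mult)
qed

lemma tensor_comm:
  assumes "\<And>x y. x \<in> carrier A \<Longrightarrow> y \<in> carrier A \<Longrightarrow> x \<otimes>\<^bsub>A\<^esub> y = y \<otimes>\<^bsub>A\<^esub> x"
    and "\<And>x y. x \<in> carrier B \<Longrightarrow> y \<in> carrier B \<Longrightarrow> x \<otimes>\<^bsub>B\<^esub> y = y \<otimes>\<^bsub>B\<^esub> x"
    and "X \<in> carrier (tensor A B)" "Y \<in> carrier (tensor A B)"
  shows "X \<otimes>\<^bsub>tensor A B\<^esub> Y = Y \<otimes>\<^bsub>tensor A B\<^esub> X"
  by (rule bilin_eq_on_pure[OF vsp_tensor bilin_mult[OF kalg_tensor] bilin_swap[OF bilin_mult[OF kalg_tensor]] _ assms(3,4)])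
    (use assms(1,2) in \<open>auto simp: pure_mult\<close>)

end

lemma tensor_map_alg_hom:
  assumes "kalg A" "kalg B" "kalg C" "kalg D" "f \<in> alg_hom A C" "g \<in> alg_hom B D"
  shows "tensor_map C D f g \<in> alg_hom (tensor A B) (tensor C D)"
proof -
  interpret AB: tens_alg A B using assms by (simp add: tens_alg_def)
  interpret CD: tens_alg C D using assms by (simp add: tens_alg_def)
  note T = tensor_map_lin[OF AB.vA AB.vB CD.vA CD.vB alg_hom_lin[OF assms(5)] alg_hom_lin[OF assms(6)]]
  show ?thesis
    by (rule AB.tensor_alg_homI[OF CD.kalg_tensor T(1)])
      (auto simp: T(2) CD.pure_one CD.pure_mult alg_homD[OF assms(5)] alg_homD[OF assms(6)])
qed


lemma (in abelian_group) add_minus_minus: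
  assumes "x \<in> carrier G" "y \<in> carrier G"
  shows "x \<oplus> y \<ominus> x \<ominus> y = \<zero>"
proof -
  have "x \<oplus> y \<ominus> x = y" using add_minus_cancel[of y x] a_comm[of x y] assms by simp
  then show ?thesis using assms by (simp add: a_minus_def r_neg)
qed

section \<open>Separating families of linear forms\<close>

text \<open>A list, unlike a finite set, admits repeated terms and has a first term, as the
  induction on the number of terms of a tensor requires.\<close>

definition lsum :: "('k::field, 'c) module \<Rightarrow> ('x \<Rightarrow> 'c) \<Rightarrow> 'x list \<Rightarrow> 'c" where
  "lsum C f xs = foldr (\<lambda>x s. f x \<oplus>\<^bsub>C\<^esub> s) xs \<zero>\<^bsub>C\<^esub>"

lemma lsum_simps [simp]: "lsum C f [] = \<zero>\<^bsub>C\<^esub>" "lsum C f (x # xs) = f x \<oplus>\<^bsub>C\<^esub> lsum C f xs"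
  by (simp_all add: lsum_def)

lemma lsum_scalar: "lsum scalar_alg f xs = sum_list (map f xs)"
  by (induction xs) auto

lemma lsum_closed:
  assumes "vsp C" "\<And>x. x \<in> set xs \<Longrightarrow> f x \<in> carrier C"
  shows "lsum C f xs \<in> carrier C"
proof -
  interpret Module.module scalar_alg C by fact
  show ?thesis using assms(2) by (induction xs) auto
qed

lemma lsum_append:
  assumes "vsp C" "\<And>x. x \<in> set xs \<union> set ys \<Longrightarrow> f x \<in> carrier C"
  shows "lsum C f (xs @ ys) = lsum C f xs \<oplus>\<^bsub>C\<^esub> lsum C f ys"
proof -
  interpret Module.module scalar_alg C by fact
  show ?thesis using assms(2)
  proof (induction xs)
    case Nil
    then show ?case using lsum_closed[OF assms(1), of ys f] by simp
  next
    case (Cons x xs)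
    then show ?case using lsum_closed[OF assms(1), of ys f] lsum_closed[OF assms(1), of xs f]
      by (simp add: M.a_assoc)
  qed
qed

lemma lin_map_lsum:
  assumes "vsp A" "vsp B" "h \<in> lin_map A B" "\<And>x. x \<in> set xs \<Longrightarrow> f x \<in> carrier A"
  shows "h (lsum A f xs) = lsum B (\<lambda>x. h (f x)) xs"
  using assms(4)
proof (induction xs)
  case Nil
  show ?case using lin_map_zero[OF assms(1-3)] by simp
next
  case (Cons x xs)
  then show ?case using lin_mapD(2)[OF assms(3)] lsum_closed[OF assms(1), of xs f] by simp
qed

definition separates :: "('k::field, 'a) module \<Rightarrow> ('a \<Rightarrow> 'k) set \<Rightarrow> bool" where
  "separates A \<Phi> \<longleftrightarrow> \<Phi> \<subseteq> lin_map A scalar_alg \<and>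
     (\<forall>x\<in>carrier A. (\<forall>\<phi>\<in>\<Phi>. \<phi> x = 0) \<longrightarrow> x = \<zero>\<^bsub>A\<^esub>)"

lemma separates_eq:
  assumes "vsp A" "separates A \<Phi>" "x \<in> carrier A" "y \<in> carrier A" "\<And>\<phi>. \<phi> \<in> \<Phi> \<Longrightarrow> \<phi> x = \<phi> y"
  shows "x = y"
proof -
  interpret Module.module scalar_alg A by fact
  have "\<phi> (x \<ominus>\<^bsub>A\<^esub> y) = 0" if "\<phi> \<in> \<Phi>" for \<phi>
  proof -
    have "\<phi> \<in> lin_map A scalar_alg" using assms(2) that by (auto simp: separates_def)
    then have "\<phi> (x \<ominus>\<^bsub>A\<^esub> y) + \<phi> y = \<phi> x"
      using lin_mapD(2)[of \<phi> A scalar_alg "x \<ominus>\<^bsub>A\<^esub> y" y] assms(3,4) minus_add_cancel[of x y] by simp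
    then show ?thesis using assms(5)[OF that] by simp
  qed
  then have "x \<ominus>\<^bsub>A\<^esub> y = \<zero>\<^bsub>A\<^esub>" using assms(2-4) by (auto simp: separates_def)
  then show ?thesis using minus_add_cancel[of x y] assms(3,4) by simp
qed

text \<open>The number of terms of \<open>\<Sum> a \<otimes> b\<close> decreases: a form \<open>\<phi>\<close> with \<open>\<phi> a \<noteq> 0\<close> for the first term makes
  the first \<open>b\<close> a linear combination of the others.\<close>

lemma bilin_separates:
  assumes vA: "vsp A" and vB: "vsp B" and vC: "vsp C" and \<mu>: "bilin A B C \<mu>"
    and \<Phi>: "separates A \<Phi>" and \<Psi>: "separates B \<Psi>"
    and "set xs \<subseteq> carrier A \<times> carrier B"
    and "\<And>\<phi> \<psi>. \<phi> \<in> \<Phi> \<Longrightarrow> \<psi> \<in> \<Psi> \<Longrightarrow> (\<Sum>(a, b)\<leftarrow>xs. \<phi> a * \<psi> b) = 0"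
  shows "lsum C (\<lambda>(a, b). \<mu> a b) xs = \<zero>\<^bsub>C\<^esub>"
  using assms(7,8)
proof (induction "length xs" arbitrary: xs)
  case 0
  then show ?case by simp
next
  case (Suc n)
  interpret A: Module.module scalar_alg A by fact
  interpret B: Module.module scalar_alg B by fact
  interpret C: Module.module scalar_alg C by fact
  note \<mu>D = bilinD[OF \<mu>]
  have lin: "\<phi> \<in> lin_map A scalar_alg" if "\<phi> \<in> \<Phi>" for \<phi> using \<Phi> that by (auto simp: separates_def)
  have lin': "\<psi> \<in> lin_map B scalar_alg" if "\<psi> \<in> \<Psi>" for \<psi> using \<Psi> that by (auto simp: separates_def)
  obtain a b ys where xs: "xs = (a, b) # ys" using Suc(2) by (cases xs) auto
  have a: "a \<in> carrier A" and b: "b \<in> carrier B" and ys: "set ys \<subseteq> carrier A \<times> carrier B"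
    using Suc(3) xs by auto
  have n: "n = length ys" using Suc(2) xs by simp
  show ?case
  proof (cases "\<forall>\<phi>\<in>\<Phi>. \<phi> a = 0")
    case True
    then have "a = \<zero>\<^bsub>A\<^esub>" using \<Phi> a by (auto simp: separates_def)
    moreover have "\<mu> \<zero>\<^bsub>A\<^esub> b = \<zero>\<^bsub>C\<^esub>"
      using lin_map_zero[OF vA vC \<mu>D(2)[OF b]] .
    moreover have "lsum C (\<lambda>(a, b). \<mu> a b) ys = \<zero>\<^bsub>C\<^esub>"
    proof (rule Suc(1)[OF n ys])
      show "(\<Sum>(a, b)\<leftarrow>ys. \<phi> a * \<psi> b) = 0" if "\<phi> \<in> \<Phi>" "\<psi> \<in> \<Psi>" for \<phi> \<psi>
      proof -
        have "\<phi> a = 0" using True that(1) by blast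
        then show ?thesis using Suc(4)[OF that] by (simp add: xs)
      qed
    qed
    ultimately show ?thesis by (simp add: xs)
  next
    case False
    then obtain \<phi>0 where \<phi>0: "\<phi>0 \<in> \<Phi>" "\<phi>0 a \<noteq> 0" by blast
    \<comment> \<open>The hypothesis for \<open>\<phi>0\<close>, divided by
      \<open>\<phi>0 a\<close>, says that every \<open>\<psi>\<close> kills \<open>z\<close>, so
      \<open>b\<close> is minus the sum of the \<open>d x \<odot> y\<close>. Substituting this into
      the first term produces the shorter list \<open>zs\<close> with the same value.\<close>
    define d where "d x = \<phi>0 x / \<phi>0 a" for x
    define z where "z = b \<oplus>\<^bsub>B\<^esub> lsum B (\<lambda>(x, y). d x \<odot>\<^bsub>B\<^esub> y) ys"
    define zs where "zs = map (\<lambda>(x, y). (x \<oplus>\<^bsub>A\<^esub> (- d x) \<odot>\<^bsub>A\<^esub> a, y)) ys"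
    have lc: "lsum B (\<lambda>(x, y). d x \<odot>\<^bsub>B\<^esub> y) ys \<in> carrier B"
      by (rule lsum_closed[OF vB]) (use ys in auto)
    then have zc: "z \<in> carrier B" unfolding z_def using b by simp
    have \<psi>z_eq: "\<psi> z = \<psi> b + (\<Sum>(x, y)\<leftarrow>ys. d x * \<psi> y)" if \<psi>: "\<psi> \<in> \<Psi>" for \<psi>
    proof -
      have "\<psi> z = \<psi> b + \<psi> (lsum B (\<lambda>(x, y). d x \<odot>\<^bsub>B\<^esub> y) ys)"
        unfolding z_def using lin_mapD(2)[OF lin'[OF \<psi>] b lc] by simp
      also have "\<psi> (lsum B (\<lambda>(x, y). d x \<odot>\<^bsub>B\<^esub> y) ys) = (\<Sum>p\<leftarrow>ys. \<psi> ((\<lambda>(x, y). d x \<odot>\<^bsub>B\<^esub> y) p))"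
        by (subst lin_map_lsum[OF vB vsp_scalar lin'[OF \<psi>]])
          (use ys in \<open>auto simp: lsum_scalar\<close>)
      also have "\<dots> = (\<Sum>(x, y)\<leftarrow>ys. d x * \<psi> y)"
        using ys lin_mapD(3)[OF lin'[OF \<psi>]] by (intro arg_cong[where f=sum_list] map_cong) auto
      finally show ?thesis .
    qed
    have \<psi>z: "\<psi> z = 0" if \<psi>: "\<psi> \<in> \<Psi>" for \<psi>
    proof -
      have "\<phi>0 a * \<psi> z = \<phi>0 a * \<psi> b + (\<Sum>(x, y)\<leftarrow>ys. \<phi>0 x * \<psi> y)"
        unfolding \<psi>z_eq[OF \<psi>] using \<phi>0(2)
        by (simp add: distrib_left sum_list_const_mult[symmetric] d_def case_prod_unfold)
      then show ?thesis using Suc(4)[OF \<phi>0(1) \<psi>] \<phi>0(2) by (simp add: xs)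
    qed
    then have z0: "z = \<zero>\<^bsub>B\<^esub>" using \<Psi> zc by (auto simp: separates_def)
    have "lsum C (\<lambda>(a, b). \<mu> a b) zs = \<zero>\<^bsub>C\<^esub>"
    proof (rule Suc(1))
      show "n = length zs" using n by (simp add: zs_def)
      show "set zs \<subseteq> carrier A \<times> carrier B" using ys a by (auto simp: zs_def)
      fix \<phi> \<psi> assume \<phi>: "\<phi> \<in> \<Phi>" and \<psi>: "\<psi> \<in> \<Psi>"
      have "(\<Sum>(a, b)\<leftarrow>zs. \<phi> a * \<psi> b) = (\<Sum>(x, y)\<leftarrow>ys. \<phi> x * \<psi> y - \<phi> a * (d x * \<psi> y))"
        unfolding zs_def map_map
        by (intro arg_cong[where f=sum_list] map_cong refl)
          (use ys a lin_mapD[OF lin[OF \<phi>]] in \<open>auto simp: algebra_simps\<close>)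
      also have "\<dots> = (\<Sum>(x, y)\<leftarrow>ys. \<phi> x * \<psi> y) - \<phi> a * (\<Sum>(x, y)\<leftarrow>ys. d x * \<psi> y)"
        by (simp add: sum_list_subtractf sum_list_const_mult[symmetric] case_prod_unfold)
      also have "(\<Sum>(x, y)\<leftarrow>ys. d x * \<psi> y) = - \<psi> b"
        using \<psi>z[OF \<psi>] \<psi>z_eq[OF \<psi>] by (simp add: add_eq_0_iff)
      also have "(\<Sum>(x, y)\<leftarrow>ys. \<phi> x * \<psi> y) - \<phi> a * - \<psi> b = 0"
        using Suc(4)[OF \<phi> \<psi>] by (simp add: xs algebra_simps)
      finally show "(\<Sum>(a, b)\<leftarrow>zs. \<phi> a * \<psi> b) = 0" .
    qed
    \<comment> \<open>The corrections \<open>(- d x) \<odot> a\<close> in \<open>zs\<close>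
      contribute minus the value of \<open>\<mu> a\<close> at the combination of the
      \<open>y\<close>.\<close>
    moreover have "lsum C (\<lambda>(a, b). \<mu> a b) zs \<oplus>\<^bsub>C\<^esub> \<mu> a (lsum B (\<lambda>(x, y). d x \<odot>\<^bsub>B\<^esub> y) ys) =
        lsum C (\<lambda>(a, b). \<mu> a b) ys"
      unfolding zs_def using ys
    proof (induction ys)
      case Nil
      show ?case using lin_map_zero[OF vB vC \<mu>D(1)[OF a]] by simp
    next
      case (Cons p ys)
      obtain x y where p: "p = (x, y)" "x \<in> carrier A" "y \<in> carrier B" using Cons by (cases p) auto
      have ys: "set ys \<subseteq> carrier A \<times> carrier B" using Cons by auto
      have c1: "lsum C (\<lambda>(a, b). \<mu> a b) (map (\<lambda>(x, y). (x \<oplus>\<^bsub>A\<^esub> (- d x) \<odot>\<^bsub>A\<^esub> a, y)) ys) \<in> carrier C" (is "?s \<in> _")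
        by (rule lsum_closed[OF vC]) (use ys a in \<open>auto intro!: \<mu>D(3)\<close>)
      have c2: "lsum B (\<lambda>(x, y). d x \<odot>\<^bsub>B\<^esub> y) ys \<in> carrier B" (is "?t \<in> _")
        by (rule lsum_closed[OF vB]) (use ys in auto)
      have cy: "\<mu> a y \<in> carrier C" "\<mu> x y \<in> carrier C" "\<mu> a ?t \<in> carrier C" using a p c2 \<mu>D(3) by auto
      have canc: "(- d x) \<odot>\<^bsub>C\<^esub> \<mu> a y \<oplus>\<^bsub>C\<^esub> d x \<odot>\<^bsub>C\<^esub> \<mu> a y = \<zero>\<^bsub>C\<^esub>"
        using C.smult_l_distr[of "- d x" "d x" "\<mu> a y"] cy C.smult_l_null by simp
      have "\<mu> (x \<oplus>\<^bsub>A\<^esub> (- d x) \<odot>\<^bsub>A\<^esub> a) y \<oplus>\<^bsub>C\<^esub> ?s \<oplus>\<^bsub>C\<^esub> \<mu> a (d x \<odot>\<^bsub>B\<^esub> y \<oplus>\<^bsub>B\<^esub> ?t) =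
        (\<mu> x y \<oplus>\<^bsub>C\<^esub> (?s \<oplus>\<^bsub>C\<^esub> \<mu> a ?t)) \<oplus>\<^bsub>C\<^esub> ((- d x) \<odot>\<^bsub>C\<^esub> \<mu> a y \<oplus>\<^bsub>C\<^esub> d x \<odot>\<^bsub>C\<^esub> \<mu> a y)"
        using p a c1 c2 cy by (simp add: \<mu>D(4-7) C.M.a_ac)
      moreover have "lsum C (\<lambda>(a, b). \<mu> a b) ys \<in> carrier C"
        by (rule lsum_closed[OF vC]) (use ys \<mu>D(3) in auto)
      ultimately show ?case unfolding canc using p Cons.IH[OF ys] cy c1 by simp
    qed
    moreover have "\<mu> a b \<oplus>\<^bsub>C\<^esub> \<mu> a (lsum B (\<lambda>(x, y). d x \<odot>\<^bsub>B\<^esub> y) ys) = \<zero>\<^bsub>C\<^esub>"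
      using \<mu>D(4)[OF a b lc] z0 lin_map_zero[OF vB vC \<mu>D(1)[OF a]] unfolding z_def by simp
    ultimately show ?thesis using \<mu>D(3)[OF a lc] \<mu>D(3)[OF a b] by (simp add: xs)
  qed
qed

text \<open>The form \<open>\<phi> \<otimes> \<psi>\<close> with the tensor square of the field
  identified with the field by multiplication; \<open>tensor_map\<close> would take values in a
  quotient of formal sums instead.\<close>

definition ften :: "('a \<Rightarrow> 'k::field) \<Rightarrow> ('b \<Rightarrow> 'k) \<Rightarrow> ('a \<times> 'b \<Rightarrow>\<^sub>0 'k) set \<Rightarrow> 'k" where
  "ften \<phi> \<psi> = lin_lift scalar_alg (\<lambda>(a, b). \<phi> a * \<psi> b)"

context tens
begin

lemma bilin_ften:
  assumes "\<phi> \<in> lin_map A scalar_alg" "\<psi> \<in> lin_map B scalar_alg"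
  shows "bilin A B scalar_alg (\<lambda>a b. \<phi> a * \<psi> b)"
  by (rule bilinI; rule lin_mapI)
    (use lin_mapD[OF assms(1)] lin_mapD[OF assms(2)] in \<open>auto simp: algebra_simps\<close>)

lemma ften_lin:
  assumes "\<phi> \<in> lin_map A scalar_alg" "\<psi> \<in> lin_map B scalar_alg"
  shows "ften \<phi> \<psi> \<in> lin_map (tensor A B) scalar_alg"
    and "a \<in> carrier A \<Longrightarrow> b \<in> carrier B \<Longrightarrow> ften \<phi> \<psi> (pure A B a b) = \<phi> a * \<psi> b"
  unfolding ften_def using tensor_lift[OF vsp_scalar bilin_ften[OF assms]] by auto

lemma tensor_decomp:
  assumes "Y \<in> carrier (tensor A B)"
  shows "\<exists>xs. set xs \<subseteq> carrier A \<times> carrier B \<and> Y = lsum (tensor A B) (\<lambda>(a, b). pure A B a b) xs"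
  using assms
proof (induction Y rule: tensor_induct)
  case zero
  show ?case by (rule exI[of _ "[]"]) simp
next
  case (pure a b)
  interpret T: Module.module scalar_alg "tensor A B" by (rule vsp_tensor)
  show ?case by (rule exI[of _ "[(a, b)]"]) (use pure in auto)
next
  case (add Y Z)
  then obtain xs ys where
    "set xs \<subseteq> carrier A \<times> carrier B" "Y = lsum (tensor A B) (\<lambda>(a, b). pure A B a b) xs"
    "set ys \<subseteq> carrier A \<times> carrier B" "Z = lsum (tensor A B) (\<lambda>(a, b). pure A B a b) ys"
    by blast
  then show ?case
    by (intro exI[of _ "xs @ ys"]) (auto intro!: lsum_append[OF vsp_tensor, symmetric])
qed

text \<open>A tensor is a finite list of pure ones, so this is \<open>bilin_separates\<close> for
  the universal bilinear map \<open>pure\<close>.\<close>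

lemma separates_tensor:
  assumes \<Phi>: "separates A \<Phi>" and \<Psi>: "separates B \<Psi>"
  shows "separates (tensor A B) {ften \<phi> \<psi> | \<phi> \<psi>. \<phi> \<in> \<Phi> \<and> \<psi> \<in> \<Psi>}"
  unfolding separates_def
proof (intro conjI ballI impI)
  have lin: "\<phi> \<in> lin_map A scalar_alg" if "\<phi> \<in> \<Phi>" for \<phi> using \<Phi> that by (auto simp: separates_def)
  have lin': "\<psi> \<in> lin_map B scalar_alg" if "\<psi> \<in> \<Psi>" for \<psi> using \<Psi> that by (auto simp: separates_def)
  show "{ften \<phi> \<psi> | \<phi> \<psi>. \<phi> \<in> \<Phi> \<and> \<psi> \<in> \<Psi>} \<subseteq> lin_map (tensor A B) scalar_alg"
    using lin lin' ften_lin(1) by auto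
  fix Y assume "Y \<in> carrier (tensor A B)" and z: "\<forall>\<chi>\<in>{ften \<phi> \<psi> | \<phi> \<psi>. \<phi> \<in> \<Phi> \<and> \<psi> \<in> \<Psi>}. \<chi> Y = 0"
  then obtain xs where xs: "set xs \<subseteq> carrier A \<times> carrier B" "Y = lsum (tensor A B) (\<lambda>(a, b). pure A B a b) xs"
    using tensor_decomp by blast
  have "(\<Sum>(a, b)\<leftarrow>xs. \<phi> a * \<psi> b) = 0" if "\<phi> \<in> \<Phi>" "\<psi> \<in> \<Psi>" for \<phi> \<psi>
  proof -
    note l = ften_lin[OF lin[OF that(1)] lin'[OF that(2)]]
    have "ften \<phi> \<psi> Y = (\<Sum>p\<leftarrow>xs. ften \<phi> \<psi> ((\<lambda>(a, b). pure A B a b) p))"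
      unfolding xs(2) using lin_map_lsum[OF vsp_tensor vsp_scalar l(1), of xs "\<lambda>(a, b). pure A B a b"] xs(1)
      by (auto simp: lsum_scalar)
    also have "\<dots> = (\<Sum>(a, b)\<leftarrow>xs. \<phi> a * \<psi> b)"
      using xs(1) l(2) by (intro arg_cong[where f=sum_list] map_cong) auto
    finally have "ften \<phi> \<psi> Y = (\<Sum>(a, b)\<leftarrow>xs. \<phi> a * \<psi> b)" .
    moreover have "ften \<phi> \<psi> Y = 0" using z that by blast
    ultimately show ?thesis by simp
  qed
  then show "Y = \<zero>\<^bsub>tensor A B\<^esub>"
    unfolding xs(2) by (intro bilin_separates[OF vA vB vsp_tensor bilin_pure \<Phi> \<Psi> xs(1)])
qed

end


section \<open>Tensor algebras\<close>

lemma free_monoid_simps [simp]: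
  "carrier (free_monoid X) = lists X" "us \<otimes>\<^bsub>free_monoid X\<^esub> vs = us @ vs" "\<one>\<^bsub>free_monoid X\<^esub> = []"
  by (simp_all add: free_monoid_def)

lemma monoid_free_monoid: "Group.monoid (free_monoid X)"
  by (rule monoidI) auto

lemma monoid_alg_mult_diff_left:
  "(F - F') \<otimes>\<^bsub>monoid_alg M\<^esub> G = F \<otimes>\<^bsub>monoid_alg M\<^esub> G - F' \<otimes>\<^bsub>monoid_alg M\<^esub> G"
  by (simp add: eq_diff_eq monoid_alg_mult_add_left[symmetric])

lemma monoid_alg_mult_diff_right:
  "G \<otimes>\<^bsub>monoid_alg M\<^esub> (F - F') = G \<otimes>\<^bsub>monoid_alg M\<^esub> F - G \<otimes>\<^bsub>monoid_alg M\<^esub> F'"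
  by (simp add: eq_diff_eq monoid_alg_mult_add_right[symmetric])

text \<open>A multilinear map on the words of each length, with no relation between different
  lengths: the datum that \<open>mlin_lift\<close> turns into a linear map out of the tensor
  algebra.\<close>

definition mlin :: "('k::field, 'v) module \<Rightarrow> ('k, 'c) module \<Rightarrow> ('v list \<Rightarrow> 'c) \<Rightarrow> bool" where
  "mlin V C g \<longleftrightarrow> g \<in> lists (carrier V) \<rightarrow> carrier C \<and>
     (\<forall>us\<in>lists (carrier V). \<forall>vs\<in>lists (carrier V). \<forall>v\<in>carrier V. \<forall>w\<in>carrier V.
        g (us @ (v \<oplus>\<^bsub>V\<^esub> w) # vs) = g (us @ v # vs) \<oplus>\<^bsub>C\<^esub> g (us @ w # vs)) \<and>
     (\<forall>us\<in>lists (carrier V). \<forall>vs\<in>lists (carrier V). \<forall>v\<in>carrier V. \<forall>c.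
        g (us @ (c \<odot>\<^bsub>V\<^esub> v) # vs) = c \<odot>\<^bsub>C\<^esub> g (us @ v # vs))"

locale tensalg =
  fixes V :: "('k::field, 'v) module"
  assumes vV: "vsp V"
begin

sublocale V: Module.module scalar_alg V by (rule vV)

abbreviation "FA \<equiv> (free_alg V :: ('k, 'v list \<Rightarrow>\<^sub>0 'k) module)"
abbreviation "T \<equiv> tensor_alg V"
abbreviation "word vs \<equiv> tensor_alg_ideal V +>\<^bsub>FA\<^esub> Poly_Mapping.single vs 1"

definition tensor_alg_gens :: "('v list \<Rightarrow>\<^sub>0 'k) set" where
  "tensor_alg_gens =
     {Poly_Mapping.single [v \<oplus>\<^bsub>V\<^esub> w] 1 - Poly_Mapping.single [v] 1 - Poly_Mapping.single [w] 1
         | v w. v \<in> carrier V \<and> w \<in> carrier V} \<union>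
      {Poly_Mapping.single [c \<odot>\<^bsub>V\<^esub> v] 1 - Poly_Mapping.single [v] c | c v. v \<in> carrier V}"

lemma FA_eq: "FA = monoid_alg (free_monoid (carrier V))"
  by (simp add: free_alg_def)

lemma kalg_FA: "kalg FA"
  unfolding FA_eq by (rule kalg_monoid_alg[OF monoid_free_monoid])

lemma single_FA: "vs \<in> lists (carrier V) \<Longrightarrow> Poly_Mapping.single vs c \<in> carrier FA"
  by (auto simp: FA_eq monoid_alg_simps)

lemma FA_minus:
  "F \<in> carrier FA \<Longrightarrow> G \<in> carrier FA \<Longrightarrow> F - G = F \<ominus>\<^bsub>FA\<^esub> G"
  unfolding FA_eq by (rule monoid_alg_minus[symmetric])

lemma FA_minus_closed: "F \<in> carrier FA \<Longrightarrow> G \<in> carrier FA \<Longrightarrow> F - G \<in> carrier FA"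
proof -
  interpret FA: kalg FA by (rule kalg_FA)
  show "F \<in> carrier FA \<Longrightarrow> G \<in> carrier FA \<Longrightarrow> F - G \<in> carrier FA"
    using FA_minus FA.minus_closed by metis
qed

lemma tensor_alg_gens_closed: "tensor_alg_gens \<subseteq> carrier FA"
  unfolding tensor_alg_gens_def by (auto intro!: FA_minus_closed single_FA)

lemma tensor_alg_ideal_eq: "tensor_alg_ideal V = genideal FA tensor_alg_gens"
  by (simp add: tensor_alg_ideal_def tensor_alg_gens_def)

lemma ideal_T: "ideal (tensor_alg_ideal V) FA"
  unfolding tensor_alg_ideal_eq
  by (rule ring.genideal_ideal[OF kalg_ring[OF kalg_FA] tensor_alg_gens_closed])

sublocale TI: kalg_ideal FA "tensor_alg_ideal V"
  by (intro kalg_ideal.intro kalg_FA ideal_T)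

sublocale FQ: free_quot "free_monoid (carrier V)" "tensor_alg_ideal V"
  using TI.sub by (simp add: free_quot_def FA_eq)

lemma T_eq: "T = quot_alg FA (tensor_alg_ideal V)"
  by (simp add: tensor_alg_def)

lemma kalg_T: "kalg T"
  unfolding T_eq by (rule TI.kalg_quot)

sublocale T: kalg T by (rule kalg_T)

lemma vT: "vsp T" by (rule kalg_vsp[OF kalg_T])

lemma word_closed [simp, intro]: "vs \<in> lists (carrier V) \<Longrightarrow> word vs \<in> carrier T"
  using FQ.cls_closed[of vs] by (simp add: T_eq FA_eq)

lemma word_mult:
  "us \<in> lists (carrier V) \<Longrightarrow> vs \<in> lists (carrier V) \<Longrightarrow> word us \<otimes>\<^bsub>T\<^esub> word vs = word (us @ vs)"
  unfolding T_eq using single_FA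
  by (subst TI.coset_mult[symmetric]) (auto simp: FA_eq monoid_alg_mult_single)

lemma word_Nil: "word [] = \<one>\<^bsub>T\<^esub>"
  by (simp add: T_eq quot_alg_simps(3) FA_eq monoid_alg_simps(2))

lemma inc_word: "tensor_alg_inc V v = word [v]"
  by (simp add: tensor_alg_inc_def)

lemma word_Cons: "v \<in> carrier V \<Longrightarrow> vs \<in> lists (carrier V) \<Longrightarrow> word (v # vs) = tensor_alg_inc V v \<otimes>\<^bsub>T\<^esub> word vs"
  using word_mult[of "[v]" vs] by (simp add: inc_word)

lemma inc_lin: "tensor_alg_inc V \<in> lin_map V T"
proof -
  have eq: "tensor_alg_ideal V +>\<^bsub>FA\<^esub> F = tensor_alg_ideal V +>\<^bsub>FA\<^esub> G"
    if "F \<in> carrier FA" "G \<in> carrier FA" "F - G \<in> tensor_alg_gens" for F G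
  proof -
    have "F - G \<in> tensor_alg_ideal V" unfolding tensor_alg_ideal_eq
      using TI.genideal_self[OF tensor_alg_gens_closed] that(3) by auto
    then show ?thesis using TI.coset_eq_iff[OF that(1,2)] FA_minus[OF that(1,2)] by simp
  qed
  have sc: "Poly_Mapping.single [v] c \<in> carrier FA" if "v \<in> carrier V" for v c
    using that by (intro single_FA) auto
  have ac: "Poly_Mapping.single [v] c + Poly_Mapping.single [w] d \<in> carrier FA"
    if "v \<in> carrier V" "w \<in> carrier V" for v w c d
    using TI.M.add.m_closed[OF sc[OF that(1)] sc[OF that(2)]] by (simp add: FA_eq monoid_alg_simps(4))
  show ?thesis
  proof (rule lin_mapI)
    show "tensor_alg_inc V v \<in> carrier T" if "v \<in> carrier V" for v using that by (simp add: inc_word)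
    show "tensor_alg_inc V (v \<oplus>\<^bsub>V\<^esub> w) = tensor_alg_inc V v \<oplus>\<^bsub>T\<^esub> tensor_alg_inc V w"
      if "v \<in> carrier V" "w \<in> carrier V" for v w
    proof -
      have "tensor_alg_inc V (v \<oplus>\<^bsub>V\<^esub> w) = tensor_alg_ideal V +>\<^bsub>FA\<^esub> (Poly_Mapping.single [v] 1 + Poly_Mapping.single [w] 1)"
        unfolding inc_word using that
        by (intro eq sc ac) (auto simp: tensor_alg_gens_def diff_diff_eq[symmetric])
      then show ?thesis
        using TI.coset_add[OF sc[OF that(1)] sc[OF that(2)]] by (simp add: inc_word T_eq FA_eq monoid_alg_simps(4))
    qed
    show "tensor_alg_inc V (c \<odot>\<^bsub>V\<^esub> v) = c \<odot>\<^bsub>T\<^esub> tensor_alg_inc V v"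
      if "v \<in> carrier V" for v c
    proof -
      have "tensor_alg_inc V (c \<odot>\<^bsub>V\<^esub> v) = tensor_alg_ideal V +>\<^bsub>FA\<^esub> (Poly_Mapping.single [v] c)"
        unfolding inc_word using that by (intro eq sc) (auto simp: tensor_alg_gens_def)
      then show ?thesis
        using TI.coset_smult[OF sc[OF that], of c 1] by (simp add: inc_word T_eq FA_eq monoid_alg_simps(5))
    qed
  qed
qed

lemma T_induct [consumes 1, case_names zero scaled add]:
  assumes "Y \<in> carrier T"
    and "P \<zero>\<^bsub>T\<^esub>"
    and "\<And>vs c. vs \<in> lists (carrier V) \<Longrightarrow> P (c \<odot>\<^bsub>T\<^esub> word vs)"
    and "\<And>Y Z. Y \<in> carrier T \<Longrightarrow> Z \<in> carrier T \<Longrightarrow> P Y \<Longrightarrow> P Z \<Longrightarrow> P (Y \<oplus>\<^bsub>T\<^esub> Z)"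
  shows "P Y"
  using assms FQ.Q_induct[of Y P] by (simp add: T_eq FA_eq)

lemma lin_map_T_eq:
  assumes "vsp C" "h \<in> lin_map T C" "h' \<in> lin_map T C"
    and "\<And>vs. vs \<in> lists (carrier V) \<Longrightarrow> h (word vs) = h' (word vs)"
    and "Y \<in> carrier T"
  shows "h Y = h' Y"
  using assms FQ.lin_map_Q_eq[of C h h' Y] by (simp add: T_eq FA_eq)

lemma bilin_T_eq:
  assumes "vsp C" "bilin T T C \<beta>" "bilin T T C \<beta>'"
    and "\<And>us vs. us \<in> lists (carrier V) \<Longrightarrow> vs \<in> lists (carrier V) \<Longrightarrow> \<beta> (word us) (word vs) = \<beta>' (word us) (word vs)"
    and "X \<in> carrier T" "Y \<in> carrier T"
  shows "\<beta> X Y = \<beta>' X Y"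
proof -
  have "\<beta> X (word vs) = \<beta>' X (word vs)" if "vs \<in> lists (carrier V)" for vs
    using lin_map_T_eq[OF assms(1) bilinD(2)[OF assms(2), of "word vs"] bilinD(2)[OF assms(3), of "word vs"] assms(4) assms(5)]
      that by auto
  then show ?thesis
    using lin_map_T_eq[OF assms(1) bilinD(1)[OF assms(2,5)] bilinD(1)[OF assms(3,5)] _ assms(6)] by auto
qed

text \<open>A generator placed between two words is a relation of multilinearity in a single slot,
  so \<open>g\<close> kills it; \<open>genideal_vanish\<close> asks for nothing more once the outer
  words are replaced by arbitrary elements.\<close>

lemma mlin_null:
  assumes C: "vsp C" and g: "mlin V C g" and F: "F \<in> tensor_alg_ideal V"
  shows "linext C g F = \<zero>\<^bsub>C\<^esub>"
proof -
  interpret C: Module.module scalar_alg C by fact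
  let ?L = "linext C g"
  have gc: "g \<in> carrier (free_monoid (carrier V)) \<rightarrow> carrier C" using g by (simp add: mlin_def)
  have gcl: "g vs \<in> carrier C" if "vs \<in> lists (carrier V)" for vs using gc that by auto
  have lin: "?L \<in> lin_map FA C" unfolding FA_eq by (rule linext_lin[OF C gc refl])
  have s: "?L (Poly_Mapping.single vs c) = c \<odot>\<^bsub>C\<^esub> g vs" if "vs \<in> lists (carrier V)" for vs c
    using linext_single[OF C gc, of vs c] that by simp
  have one: "1 \<odot>\<^bsub>C\<^esub> y = y" if "y \<in> carrier C" for y
    using C.smult_one[OF that] by simp
  have m: "?L (F - G) = ?L F \<ominus>\<^bsub>C\<^esub> ?L G" if "F \<in> carrier FA" "G \<in> carrier FA" for F G
    using lin_map_minus[OF kalg_vsp[OF kalg_FA] C lin that] FA_minus[OF that] by simp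
  have words: "?L (Poly_Mapping.single us 1 \<otimes>\<^bsub>FA\<^esub> r \<otimes>\<^bsub>FA\<^esub> Poly_Mapping.single vs 1) = \<zero>\<^bsub>C\<^esub>"
    if r: "r \<in> tensor_alg_gens" and us: "us \<in> lists (carrier V)" and vs: "vs \<in> lists (carrier V)" for r us vs
  proof -
    have c: "us @ v # vs \<in> lists (carrier V)" if "v \<in> carrier V" for v using us vs that by auto
    from r consider v w where "r = Poly_Mapping.single [v \<oplus>\<^bsub>V\<^esub> w] 1 - Poly_Mapping.single [v] 1 - Poly_Mapping.single [w] 1"
        "v \<in> carrier V" "w \<in> carrier V"
      | k v where "r = Poly_Mapping.single [k \<odot>\<^bsub>V\<^esub> v] 1 - Poly_Mapping.single [v] k" "v \<in> carrier V"
      unfolding tensor_alg_gens_def by blast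
    then show ?thesis
    proof cases
      case 1
      have "Poly_Mapping.single us 1 \<otimes>\<^bsub>FA\<^esub> r \<otimes>\<^bsub>FA\<^esub> Poly_Mapping.single vs 1 =
        Poly_Mapping.single (us @ (v \<oplus>\<^bsub>V\<^esub> w) # vs) 1 - Poly_Mapping.single (us @ v # vs) 1 - Poly_Mapping.single (us @ w # vs) 1"
        unfolding 1(1) FA_eq
        by (simp add: monoid_alg_mult_diff_left monoid_alg_mult_diff_right monoid_alg_mult_single)
      moreover have "g (us @ (v \<oplus>\<^bsub>V\<^esub> w) # vs) = g (us @ v # vs) \<oplus>\<^bsub>C\<^esub> g (us @ w # vs)"
        using g us vs 1 by (auto simp: mlin_def)
      ultimately show ?thesis
        using c[OF 1(2)] c[OF 1(3)] c[OF V.M.add.m_closed[OF 1(2,3)]]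
        by (simp add: m FA_minus_closed single_FA s one gcl C.M.add_minus_minus)
    next
      case 2
      have "Poly_Mapping.single us 1 \<otimes>\<^bsub>FA\<^esub> r \<otimes>\<^bsub>FA\<^esub> Poly_Mapping.single vs 1 =
        Poly_Mapping.single (us @ (k \<odot>\<^bsub>V\<^esub> v) # vs) 1 - Poly_Mapping.single (us @ v # vs) k"
        unfolding 2(1) FA_eq
        by (simp add: monoid_alg_mult_diff_left monoid_alg_mult_diff_right monoid_alg_mult_single)
      moreover have "g (us @ (k \<odot>\<^bsub>V\<^esub> v) # vs) = k \<odot>\<^bsub>C\<^esub> g (us @ v # vs)"
        using g us vs 2 by (auto simp: mlin_def)
      ultimately show ?thesis
        using c[OF 2(2)] c[OF V.smult_closed[OF _ 2(2), of k]]
        by (simp add: m single_FA s one gcl C.M.minus_eq C.M.r_neg)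
    qed
  qed
  note B = bilin_mult[OF kalg_FA]
  show ?thesis
  proof (rule genideal_vanish[OF kalg_FA C lin tensor_alg_gens_closed _ F[unfolded tensor_alg_ideal_eq]])
    fix r F G assume r: "r \<in> tensor_alg_gens" and F: "F \<in> carrier FA" and G: "G \<in> carrier FA"
    have rc: "r \<in> carrier FA" using r tensor_alg_gens_closed by auto
    \<comment> \<open>Extension by linearity in two passes: first the right factor, then the left
      one, runs through all of \<open>FA\<close>.\<close>
    have 1: "?L (Poly_Mapping.single us 1 \<otimes>\<^bsub>FA\<^esub> r \<otimes>\<^bsub>FA\<^esub> G) = \<zero>\<^bsub>C\<^esub>" if us: "us \<in> lists (carrier V)" for us
      by (rule lin_map_monoid_alg_eq[OF C lin_map_comp[OF bilinD(1)[OF B[unfolded FA_eq]] lin[unfolded FA_eq]] lin_map_const_zero[OF C],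
            unfolded FA_eq[symmetric], of "Poly_Mapping.single us 1 \<otimes>\<^bsub>FA\<^esub> r" G])
        (use words[OF r us] rc us G single_FA in auto)
    show "?L (F \<otimes>\<^bsub>FA\<^esub> r \<otimes>\<^bsub>FA\<^esub> G) = \<zero>\<^bsub>C\<^esub>"
      using lin_map_monoid_alg_eq[OF C lin_map_comp[OF lin_map_comp[OF bilinD(2)[OF B[unfolded FA_eq]] bilinD(2)[OF B[unfolded FA_eq]]] lin[unfolded FA_eq]] lin_map_const_zero[OF C],
            unfolded FA_eq[symmetric], of r G F] 1 rc F G by auto
  qed
qed

lemma mlin_lift:
  assumes C: "vsp C" and g: "mlin V C g"
  shows "lin_lift C g \<in> lin_map T C"
    and "vs \<in> lists (carrier V) \<Longrightarrow> lin_lift C g (word vs) = g vs"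
proof -
  have gc: "g \<in> carrier (free_monoid (carrier V)) \<rightarrow> carrier C" using g by (simp add: mlin_def)
  show "lin_lift C g \<in> lin_map T C"
    using FQ.lin_lift_lin[OF C gc mlin_null[OF C g]] by (simp add: T_eq FA_eq)
  show "vs \<in> lists (carrier V) \<Longrightarrow> lin_lift C g (word vs) = g vs"
    using FQ.lin_lift_cls[OF C gc mlin_null[OF C g], of vs] by (simp add: FA_eq)
qed

lemma mlinI:
  assumes "\<And>vs. vs \<in> lists (carrier V) \<Longrightarrow> g vs \<in> carrier C"
    and "\<And>us vs. us \<in> lists (carrier V) \<Longrightarrow> vs \<in> lists (carrier V) \<Longrightarrow> (\<lambda>v. g (us @ v # vs)) \<in> lin_map V C"
  shows "mlin V C g"
  unfolding mlin_def
proof (intro conjI ballI allI)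
  show "g \<in> lists (carrier V) \<rightarrow> carrier C" using assms(1) by auto
qed (use lin_mapD(2,3)[OF assms(2)] in auto)

lemma mlin_foldr:
  assumes A: "kalg A" and g: "g \<in> lin_map V A"
  shows "mlin V A (\<lambda>vs. foldr (\<lambda>v x. g v \<otimes>\<^bsub>A\<^esub> x) vs \<one>\<^bsub>A\<^esub>)"
    and "us \<in> lists (carrier V) \<Longrightarrow> vs \<in> lists (carrier V) \<Longrightarrow>
      foldr (\<lambda>v x. g v \<otimes>\<^bsub>A\<^esub> x) (us @ vs) \<one>\<^bsub>A\<^esub> =
      foldr (\<lambda>v x. g v \<otimes>\<^bsub>A\<^esub> x) us \<one>\<^bsub>A\<^esub> \<otimes>\<^bsub>A\<^esub> foldr (\<lambda>v x. g v \<otimes>\<^bsub>A\<^esub> x) vs \<one>\<^bsub>A\<^esub>"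
proof -
  interpret A: kalg A by fact
  let ?g = "\<lambda>vs. foldr (\<lambda>v x. g v \<otimes>\<^bsub>A\<^esub> x) vs \<one>\<^bsub>A\<^esub>"
  have cl: "?g vs \<in> carrier A" if "vs \<in> lists (carrier V)" for vs
    using that by (induction vs) (auto simp: lin_mapD(1)[OF g])
  show app: "?g (us @ vs) = ?g us \<otimes>\<^bsub>A\<^esub> ?g vs" if "us \<in> lists (carrier V)" "vs \<in> lists (carrier V)" for us vs
    using that cl[OF that(2)] by (induction us) (auto simp: lin_mapD(1)[OF g] A.m_assoc cl)
  show "mlin V A ?g"
  proof (rule mlinI[OF cl])
    fix us vs assume us: "us \<in> lists (carrier V)" and vs: "vs \<in> lists (carrier V)"
    show "(\<lambda>v. ?g (us @ v # vs)) \<in> lin_map V A"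
    proof (rule lin_mapI)
      show "?g (us @ v # vs) \<in> carrier A" if "v \<in> carrier V" for v using that us vs by (intro cl) auto
    qed (use us vs cl lin_mapD[OF g] in \<open>simp_all del: foldr_append add: app A.l_distr A.r_distr A.smult_mult A.mult_smult\<close>)
  qed
qed

text \<open>The product formula is bilinear in its two arguments, so it suffices on words, where it
  says that the fold of a concatenation is the product of the folds.\<close>

lemma tensor_alg_lift:
  assumes A: "kalg A" and g: "g \<in> lin_map V A"
  shows "tensor_alg_lift A g \<in> alg_hom T A"
    and "v \<in> carrier V \<Longrightarrow> tensor_alg_lift A g (tensor_alg_inc V v) = g v"
proof -
  interpret A: kalg A by fact
  note m = mlin_foldr[OF A g]
  note L = mlin_lift[OF kalg_vsp[OF A] m(1), folded tensor_alg_lift_def]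
  show "tensor_alg_lift A g \<in> alg_hom T A"
  proof (rule alg_homI[OF L(1)])
    show "tensor_alg_lift A g \<one>\<^bsub>T\<^esub> = \<one>\<^bsub>A\<^esub>" using L(2)[of "[]"] by (simp add: word_Nil)
    show "tensor_alg_lift A g (X \<otimes>\<^bsub>T\<^esub> Y) = tensor_alg_lift A g X \<otimes>\<^bsub>A\<^esub> tensor_alg_lift A g Y"
      if "X \<in> carrier T" "Y \<in> carrier T" for X Y
      by (rule bilin_T_eq[OF kalg_vsp[OF A]
            bilin_comp[OF bilin_mult[OF kalg_T] lin_map_id lin_map_id L(1)]
            bilin_comp[OF bilin_mult[OF A] L(1) L(1) lin_map_id] _ that])
        (simp del: foldr_append add: word_mult L(2) m(2))
  qed
  show "v \<in> carrier V \<Longrightarrow> tensor_alg_lift A g (tensor_alg_inc V v) = g v"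
    using L(2)[of "[v]"] lin_mapD(1)[OF g] by (simp add: inc_word)
qed

lemma alg_hom_T_eq:
  assumes A: "kalg A" and h: "h \<in> alg_hom T A" "h' \<in> alg_hom T A"
    and eq: "\<And>v. v \<in> carrier V \<Longrightarrow> h (tensor_alg_inc V v) = h' (tensor_alg_inc V v)"
    and Y: "Y \<in> carrier T"
  shows "h Y = h' Y"
proof (rule lin_map_T_eq[OF kalg_vsp[OF A] alg_hom_lin[OF h(1)] alg_hom_lin[OF h(2)] _ Y])
  fix vs assume "vs \<in> lists (carrier V)"
  then show "h (word vs) = h' (word vs)"
  proof (induction vs)
    case Nil
    show ?case using alg_homD(4)[OF h(1)] alg_homD(4)[OF h(2)] by (simp add: word_Nil)
  next
    case (Cons v vs)
    then show ?case
      using alg_homD(3)[OF h(1)] alg_homD(3)[OF h(2)] eq lin_mapD(1)[OF inc_lin] by (simp add: word_Cons)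
  qed
qed


section \<open>Evaluation of tensors on words of linear forms\<close>

definition wev :: "('v \<Rightarrow> 'k) list \<Rightarrow> ('v list \<Rightarrow>\<^sub>0 'k) set \<Rightarrow> 'k" where
  "wev \<phi>s = lin_lift scalar_alg
     (\<lambda>vs. if length vs = length \<phi>s then prod_list (map2 (\<lambda>v \<phi>. \<phi> v) vs \<phi>s) else 0)"

lemma mlin_wev:
  assumes "\<phi>s \<in> lists (lin_map V scalar_alg)"
  shows "mlin V scalar_alg (\<lambda>vs. if length vs = length \<phi>s then prod_list (map2 (\<lambda>v \<phi>. \<phi> v) vs \<phi>s) else 0)"
proof (rule mlinI)
  fix us vs assume us: "us \<in> lists (carrier V)" and vs: "vs \<in> lists (carrier V)"
  show "(\<lambda>v. if length (us @ v # vs) = length \<phi>s then prod_list (map2 (\<lambda>v \<phi>. \<phi> v) (us @ v # vs) \<phi>s) else 0)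
    \<in> lin_map V scalar_alg"
  proof (cases "length us + length vs + 1 = length \<phi>s")
    case True
    \<comment> \<open>The form that meets \<open>v\<close> has index \<open>length us\<close>; all
      other forms contribute a constant factor.\<close>
    define \<alpha> \<phi> \<beta> where "\<alpha> = take (length us) \<phi>s" and "\<phi> = \<phi>s ! length us" and "\<beta> = drop (Suc (length us)) \<phi>s"
    have eq: "\<phi>s = \<alpha> @ \<phi> # \<beta>" "length \<alpha> = length us" "length \<beta> = length vs"
      unfolding \<alpha>_def \<phi>_def \<beta>_def using True by (auto simp: id_take_nth_drop[symmetric])
    have \<phi>: "\<phi> \<in> lin_map V scalar_alg" using assms eq(1) by auto
    show ?thesis unfolding eq(1) using eq(2,3) lin_mapD(2,3)[OF \<phi>]
      by (intro lin_mapI) (simp_all add: algebra_simps)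
  next
    case False
    then show ?thesis by (intro lin_mapI) auto
  qed
qed auto

lemma wev_lin: "\<phi>s \<in> lists (lin_map V scalar_alg) \<Longrightarrow> wev \<phi>s \<in> lin_map T scalar_alg"
  unfolding wev_def by (rule mlin_lift(1)[OF vsp_scalar mlin_wev])

lemma wev_word:
  "\<phi>s \<in> lists (lin_map V scalar_alg) \<Longrightarrow> vs \<in> lists (carrier V) \<Longrightarrow>
   wev \<phi>s (word vs) = (if length vs = length \<phi>s then prod_list (map2 (\<lambda>v \<phi>. \<phi> v) vs \<phi>s) else 0)"
  unfolding wev_def by (subst mlin_lift(2)[OF vsp_scalar mlin_wev]) simp_all

text \<open>Transposed, concatenation becomes deconcatenation. On words only the cut at
  \<open>length us\<close> contributes, since a word pairs to zero with a list of forms of a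
  different length.\<close>

lemma wev_mult:
  assumes \<phi>s: "\<phi>s \<in> lists (lin_map V scalar_alg)" and X: "X \<in> carrier T" and Y: "Y \<in> carrier T"
  shows "wev \<phi>s (X \<otimes>\<^bsub>T\<^esub> Y) = (\<Sum>i\<le>length \<phi>s. wev (take i \<phi>s) X * wev (drop i \<phi>s) Y)"
proof -
  have td: "take i \<phi>s \<in> lists (lin_map V scalar_alg)" "drop i \<phi>s \<in> lists (lin_map V scalar_alg)" for i
    using \<phi>s by (auto dest: in_set_takeD in_set_dropD)
  note l = lin_mapD[OF wev_lin[OF td(1)]] lin_mapD[OF wev_lin[OF td(2)]]
  have b: "bilin T T scalar_alg (\<lambda>X Y. \<Sum>i\<le>length \<phi>s. wev (take i \<phi>s) X * wev (drop i \<phi>s) Y)"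
    by (rule bilinI; rule lin_mapI)
      (simp_all add: l algebra_simps sum.distrib sum_distrib_left)
  show ?thesis
  proof (rule bilin_T_eq[OF vsp_scalar bilin_comp[OF bilin_mult[OF kalg_T] lin_map_id lin_map_id wev_lin[OF \<phi>s]] b _ X Y])
    fix us vs assume us: "us \<in> lists (carrier V)" and vs: "vs \<in> lists (carrier V)"
    have uv: "us @ vs \<in> lists (carrier V)" using us vs by auto
    have "(\<Sum>i\<le>length \<phi>s. wev (take i \<phi>s) (word us) * wev (drop i \<phi>s) (word vs)) =
      (\<Sum>i\<in>{i. i \<le> length \<phi>s \<and> i = length us}. wev (take i \<phi>s) (word us) * wev (drop i \<phi>s) (word vs))"
      by (rule sum.mono_neutral_right) (auto simp: wev_word[OF td(1) us])
    also have "\<dots> = wev \<phi>s (word (us @ vs))"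
    proof (cases "length us \<le> length \<phi>s")
      case True
      then have "{i. i \<le> length \<phi>s \<and> i = length us} = {length us}" by auto
      moreover have "map2 (\<lambda>v \<phi>. \<phi> v) (us @ vs) \<phi>s =
        map2 (\<lambda>v \<phi>. \<phi> v) us (take (length us) \<phi>s) @ map2 (\<lambda>v \<phi>. \<phi> v) vs (drop (length us) \<phi>s)"
        by (subst (1) append_take_drop_id[of "length us" \<phi>s, symmetric], subst zip_append) (use True in auto)
      ultimately show ?thesis using True
        by (auto simp: wev_word[OF td(1) us] wev_word[OF td(2) vs] wev_word[OF \<phi>s uv])
    next
      case False
      then have e: "{i. i \<le> length \<phi>s \<and> i = length us} = {}" by auto
      show ?thesis unfolding e using False by (simp add: wev_word[OF \<phi>s uv])
    qed
    finally show "wev \<phi>s (word us \<otimes>\<^bsub>T\<^esub> word vs) =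
        (\<Sum>i\<le>length \<phi>s. wev (take i \<phi>s) (word us) * wev (drop i \<phi>s) (word vs))"
      using us vs by (simp add: word_mult)
  qed
qed

lemma wev_inc:
  assumes "\<phi>s \<in> lists (lin_map V scalar_alg)" "v \<in> carrier V"
  shows "wev \<phi>s (tensor_alg_inc V v) = (case \<phi>s of [\<phi>] \<Rightarrow> \<phi> v | _ \<Rightarrow> 0)"
  using wev_word[OF assms(1), of "[v]"] assms(2) by (auto simp: inc_word split: list.splits)

lemma wev_one:
  assumes "\<phi>s \<in> lists (lin_map V scalar_alg)"
  shows "wev \<phi>s \<one>\<^bsub>T\<^esub> = (if \<phi>s = [] then 1 else 0)"
  using wev_word[OF assms, of "[]"] by (simp add: word_Nil)

text \<open>A left factor of degree one leaves only the cut after the first form.\<close>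

lemma wev_inc_mult:
  assumes \<phi>s: "\<phi>s \<in> lists (lin_map V scalar_alg)" and v: "v \<in> carrier V" and Y: "Y \<in> carrier T"
  shows "wev \<phi>s (tensor_alg_inc V v \<otimes>\<^bsub>T\<^esub> Y) = (case \<phi>s of [] \<Rightarrow> 0 | \<phi> # \<psi>s \<Rightarrow> \<phi> v * wev \<psi>s Y)"
proof -
  have td: "take i \<phi>s \<in> lists (lin_map V scalar_alg)" for i
    using \<phi>s by (auto dest: in_set_takeD)
  have w: "wev (take i \<phi>s) (tensor_alg_inc V v) = 0" if "i \<le> length \<phi>s" "i \<noteq> 1" for i
    using wev_word[OF td, of "[v]" i] v that by (auto simp: inc_word)
  have "wev \<phi>s (tensor_alg_inc V v \<otimes>\<^bsub>T\<^esub> Y) =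
    (\<Sum>i\<le>length \<phi>s. wev (take i \<phi>s) (tensor_alg_inc V v) * wev (drop i \<phi>s) Y)"
    by (rule wev_mult[OF \<phi>s lin_mapD(1)[OF inc_lin v] Y])
  also have "\<dots> = (\<Sum>i\<in>{i. i \<le> length \<phi>s \<and> i = 1}. wev (take i \<phi>s) (tensor_alg_inc V v) * wev (drop i \<phi>s) Y)"
    by (rule sum.mono_neutral_right) (use w in auto)
  also have "\<dots> = (case \<phi>s of [] \<Rightarrow> 0 | \<phi> # \<psi>s \<Rightarrow> \<phi> v * wev \<psi>s Y)"
  proof (cases \<phi>s)
    case (Cons \<phi> \<psi>s)
    then have "{i. i \<le> length \<phi>s \<and> i = 1} = {1}" by auto
    moreover have "wev (take 1 \<phi>s) (tensor_alg_inc V v) = \<phi> v"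
      using wev_inc[OF td[of 1] v] Cons by simp
    ultimately show ?thesis by (simp add: Cons)
  next
    case Nil
    then have e: "{i. i \<le> length \<phi>s \<and> i = 1} = {}" by auto
    show ?thesis unfolding e using Nil by simp
  qed
  finally show ?thesis .
qed

text \<open>The filtration by word length, given through representatives. The bound is strict:
  \<open>deg_less 0\<close> is the zero space and \<open>deg_less 1\<close> consists of the
  scalars.\<close>

definition deg_less :: "nat \<Rightarrow> ('v list \<Rightarrow>\<^sub>0 'k) set set" where
  "deg_less m = (\<lambda>F. tensor_alg_ideal V +>\<^bsub>FA\<^esub> F) ` {F. Poly_Mapping.keys F \<subseteq> {vs \<in> lists (carrier V). length vs < m}}"

lemma deg_less_sub: "submodule (deg_less m) scalar_alg T"
proof (rule submodule_scalarI[OF vT])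
  have c: "F \<in> carrier FA" if "Poly_Mapping.keys F \<subseteq> {vs \<in> lists (carrier V). length vs < m}" for F
    using that by (auto simp: FA_eq monoid_alg_simps)
  show "deg_less m \<subseteq> carrier T" unfolding deg_less_def T_eq using c by (auto simp: quot_alg_simps(1))
  show "\<zero>\<^bsub>T\<^esub> \<in> deg_less m" unfolding deg_less_def T_eq quot_alg_simps(2)
    using TI.coset_zero by (intro image_eqI[of _ _ 0]) (auto simp: FA_eq monoid_alg_simps(3))
  show "X \<oplus>\<^bsub>T\<^esub> Y \<in> deg_less m" if XY: "X \<in> deg_less m" "Y \<in> deg_less m" for X Y
  proof -
    obtain F G where FG: "X = tensor_alg_ideal V +>\<^bsub>FA\<^esub> F" "Y = tensor_alg_ideal V +>\<^bsub>FA\<^esub> G"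
      "Poly_Mapping.keys F \<subseteq> {vs \<in> lists (carrier V). length vs < m}"
      "Poly_Mapping.keys G \<subseteq> {vs \<in> lists (carrier V). length vs < m}"
      using XY unfolding deg_less_def by auto
    have "X \<oplus>\<^bsub>T\<^esub> Y = tensor_alg_ideal V +>\<^bsub>FA\<^esub> (F + G)"
      using TI.coset_add[OF c[OF FG(3)] c[OF FG(4)]] FG(1,2) by (simp add: T_eq FA_eq monoid_alg_simps(4))
    moreover have "Poly_Mapping.keys (F + G) \<subseteq> {vs \<in> lists (carrier V). length vs < m}"
      using order_trans[OF Poly_Mapping.keys_add Un_least[OF FG(3,4)]] .
    ultimately show ?thesis unfolding deg_less_def by blast
  qed
  show "k \<odot>\<^bsub>T\<^esub> X \<in> deg_less m" if X: "X \<in> deg_less m" for X k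
  proof -
    obtain F where F: "X = tensor_alg_ideal V +>\<^bsub>FA\<^esub> F"
      "Poly_Mapping.keys F \<subseteq> {vs \<in> lists (carrier V). length vs < m}"
      using X unfolding deg_less_def by auto
    have "k \<odot>\<^bsub>T\<^esub> X = tensor_alg_ideal V +>\<^bsub>FA\<^esub> (pm_scale k F)"
      using TI.coset_smult[OF c[OF F(2)]] F(1) by (simp add: T_eq FA_eq monoid_alg_simps(5))
    then show ?thesis unfolding deg_less_def using order_trans[OF keys_pm_scale F(2)] by blast
  qed
qed

text \<open>A nonempty word is its first letter times a shorter word. The result has the shape of a
  list of pairs, ready for \<open>bilin_separates\<close>; no uniqueness is claimed.\<close>

lemma deg_less_Suc_decomp:
  assumes "X \<in> deg_less (Suc m)"
  shows "\<exists>c xs. set xs \<subseteq> carrier V \<times> deg_less m \<and>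
    X = c \<odot>\<^bsub>T\<^esub> \<one>\<^bsub>T\<^esub> \<oplus>\<^bsub>T\<^esub> lsum T (\<lambda>(v, t). tensor_alg_inc V v \<otimes>\<^bsub>T\<^esub> t) xs"
proof -
  have dc: "deg_less m \<subseteq> carrier T" using T.submoduleE(1)[OF deg_less_sub] .
  obtain F where F: "X = tensor_alg_ideal V +>\<^bsub>FA\<^esub> F"
    "Poly_Mapping.keys F \<subseteq> {vs \<in> lists (carrier V). length vs < Suc m}"
    using assms unfolding deg_less_def by auto
  have cs: "tensor_alg_ideal V +>\<^bsub>FA\<^esub> Poly_Mapping.single vs c = c \<odot>\<^bsub>T\<^esub> word vs"
    if "vs \<in> lists (carrier V)" for vs c
    using FQ.coset_single[of vs c] that by (simp add: T_eq FA_eq)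
  show ?thesis unfolding F(1) using F(2)
  proof (induction F rule: pm_induct)
    case zero
    have z: "tensor_alg_ideal V +>\<^bsub>FA\<^esub> 0 = \<zero>\<^bsub>T\<^esub>"
      using TI.coset_zero by (simp add: T_eq FA_eq monoid_alg_simps(3) quot_alg_simps(2))
    show ?case unfolding z by (rule exI[of _ 0], rule exI[of _ "[]"]) (use T.smult_l_null in auto)
  next
    case (single vs c)
    then have vs: "vs \<in> lists (carrier V)" "length vs \<le> m" by auto
    show ?case
    proof (cases vs)
      case Nil
      show ?thesis unfolding cs[OF vs(1), of c]
        by (rule exI[of _ c], rule exI[of _ "[]"]) (auto simp: Nil word_Nil)
    next
      case (Cons v us)
      have c: "v \<in> carrier V" "us \<in> lists (carrier V)" "length us < m" using vs Cons by auto
      have "word us \<in> deg_less m" unfolding deg_less_def using c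
        by (intro image_eqI[of _ _ "Poly_Mapping.single us 1"]) auto
      moreover have "c \<odot>\<^bsub>T\<^esub> word vs = tensor_alg_inc V (c \<odot>\<^bsub>V\<^esub> v) \<otimes>\<^bsub>T\<^esub> word us"
        using c lin_mapD[OF inc_lin] by (simp add: Cons word_Cons T.smult_mult)
      moreover have "c \<odot>\<^bsub>T\<^esub> word vs \<in> carrier T" using vs by auto
      ultimately show ?thesis unfolding cs[OF vs(1), of c]
        by (intro exI[of _ 0] exI[of _ "[(c \<odot>\<^bsub>V\<^esub> v, word us)]"]) (use c T.smult_l_null in auto)
    qed
  next
    case (add F G)
    have c: "F \<in> carrier FA" "G \<in> carrier FA" using add(1,2) by (auto simp: FA_eq monoid_alg_simps)
    have s: "tensor_alg_ideal V +>\<^bsub>FA\<^esub> (F + G) =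
      (tensor_alg_ideal V +>\<^bsub>FA\<^esub> F) \<oplus>\<^bsub>T\<^esub> (tensor_alg_ideal V +>\<^bsub>FA\<^esub> G)"
      using TI.coset_add[OF c] by (simp add: T_eq FA_eq monoid_alg_simps(4))
    let ?f = "\<lambda>(v, t). tensor_alg_inc V v \<otimes>\<^bsub>T\<^esub> t"
    obtain c xs where x: "set xs \<subseteq> carrier V \<times> deg_less m"
      "tensor_alg_ideal V +>\<^bsub>FA\<^esub> F = c \<odot>\<^bsub>T\<^esub> \<one>\<^bsub>T\<^esub> \<oplus>\<^bsub>T\<^esub> lsum T ?f xs"
      using add(3) by blast
    obtain d ys where y: "set ys \<subseteq> carrier V \<times> deg_less m"
      "tensor_alg_ideal V +>\<^bsub>FA\<^esub> G = d \<odot>\<^bsub>T\<^esub> \<one>\<^bsub>T\<^esub> \<oplus>\<^bsub>T\<^esub> lsum T ?f ys"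
      using add(4) by blast
    have fc: "?f p \<in> carrier T" if "p \<in> carrier V \<times> deg_less m" for p
      using that dc lin_mapD(1)[OF inc_lin] by auto
    have lc: "lsum T ?f xs \<in> carrier T" "lsum T ?f ys \<in> carrier T"
      by (rule lsum_closed[OF vT], use fc x(1) y(1) in blast)+
    have "lsum T ?f (xs @ ys) = lsum T ?f xs \<oplus>\<^bsub>T\<^esub> lsum T ?f ys"
      by (rule lsum_append[OF vT]) (use fc x(1) y(1) in blast)
    moreover have "(c + d) \<odot>\<^bsub>T\<^esub> \<one>\<^bsub>T\<^esub> = c \<odot>\<^bsub>T\<^esub> \<one>\<^bsub>T\<^esub> \<oplus>\<^bsub>T\<^esub> d \<odot>\<^bsub>T\<^esub> \<one>\<^bsub>T\<^esub>"
      using T.smult_l_distr[of c d "\<one>\<^bsub>T\<^esub>"] by simp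
    ultimately show ?case unfolding s x(2) y(2)
      by (intro exI[of _ "c + d"] exI[of _ "xs @ ys"]) (use x(1) y(1) lc in \<open>auto simp: T.a_ac\<close>)
  qed
qed

text \<open>Induction on the degree. The empty word isolates the constant term; a word starting with
  \<open>\<phi>\<close> pairs with \<open>inc v\<close> times \<open>t\<close> as
  \<open>\<phi> v\<close> times an evaluation of \<open>t\<close>, and \<open>t\<close> has smaller
  degree, where evaluations already separate.\<close>

lemma separates_wev:
  assumes \<Phi>: "separates V \<Phi>"
  shows "separates T (wev ` lists \<Phi>)"
proof -
  have \<Phi>l: "\<Phi> \<subseteq> lin_map V scalar_alg" using \<Phi> by (simp add: separates_def)
  then have ll: "\<phi>s \<in> lists \<Phi> \<Longrightarrow> \<phi>s \<in> lists (lin_map V scalar_alg)" for \<phi>s by auto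
  have sub: "deg_less m \<subseteq> carrier T" for m using T.submoduleE(1)[OF deg_less_sub] .
  have vD: "vsp (T\<lparr>carrier := deg_less m\<rparr>)" for m
    by (rule submodule.submodule_is_module[OF deg_less_sub vT])
  have sep: "X = \<zero>\<^bsub>T\<^esub>" if "X \<in> deg_less m" "\<forall>\<phi>s\<in>lists \<Phi>. wev \<phi>s X = 0" for X m
    using that
  proof (induction m arbitrary: X)
    case 0
    then show ?case
      using TI.coset_zero by (auto simp: deg_less_def T_eq FA_eq monoid_alg_simps(3) quot_alg_simps(2))
  next
    case (Suc m)
    let ?f = "\<lambda>(v, t). tensor_alg_inc V v \<otimes>\<^bsub>T\<^esub> t"
    obtain c xs where x: "set xs \<subseteq> carrier V \<times> deg_less m"
      "X = c \<odot>\<^bsub>T\<^esub> \<one>\<^bsub>T\<^esub> \<oplus>\<^bsub>T\<^esub> lsum T ?f xs"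
      using deg_less_Suc_decomp[OF Suc(2)] by blast
    have fc: "?f p \<in> carrier T" if "p \<in> set xs" for p
    proof -
      have "p \<in> carrier V \<times> deg_less m" using that x(1) by blast
      then show ?thesis using sub[of m] lin_mapD(1)[OF inc_lin, of "fst p"] by (cases p) auto
    qed
    have lc: "lsum T ?f xs \<in> carrier T" by (rule lsum_closed[OF vT]) (use fc in auto)
    have ev: "wev \<phi>s X = c * (if \<phi>s = [] then 1 else 0) + (\<Sum>p\<leftarrow>xs. wev \<phi>s (?f p))"
      if "\<phi>s \<in> lists \<Phi>" for \<phi>s
    proof -
      note L = wev_lin[OF ll[OF that]]
      have "wev \<phi>s X = c * wev \<phi>s \<one>\<^bsub>T\<^esub> + wev \<phi>s (lsum T ?f xs)"
        unfolding x(2) using lc by (simp add: lin_mapD(2,3)[OF L])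
      then show ?thesis
        using lin_map_lsum[OF vT vsp_scalar L fc] by (simp add: wev_one[OF ll[OF that]] lsum_scalar)
    qed
    have i: "wev \<phi>s (?f p) = (case \<phi>s of [] \<Rightarrow> 0 | \<phi> # \<psi>s \<Rightarrow> \<phi> (fst p) * wev \<psi>s (snd p))"
      if "\<phi>s \<in> lists \<Phi>" "p \<in> set xs" for \<phi>s p
      using wev_inc_mult[OF ll[OF that(1)], of "fst p" "snd p"] x(1) that(2) sub[of m]
      by (cases p) auto
    have "c = 0" using ev[of "[]"] Suc(3) i[of "[]"] by (simp cong: map_cong)
    moreover have "lsum T ?f xs = \<zero>\<^bsub>T\<^esub>"
    \<comment> \<open>The bilinear map is the multiplication into \<open>T\<close> itself; this is
      why \<open>bilin_separates\<close> is stated for an arbitrary target \<open>C\<close> and not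
      just for the tensor product.\<close>
    proof (rule bilin_separates[OF vV vD vT _ \<Phi>])
      have l1: "tensor_alg_inc V \<in> lin_map V T" by (rule inc_lin)
      have l2: "(\<lambda>t. t) \<in> lin_map (T\<lparr>carrier := deg_less m\<rparr>) T" using sub[of m] by (auto intro!: lin_mapI)
      show "bilin V (T\<lparr>carrier := deg_less m\<rparr>) T (\<lambda>v t. tensor_alg_inc V v \<otimes>\<^bsub>T\<^esub> t)"
        using bilin_comp[OF bilin_mult[OF kalg_T] l1 l2 lin_map_id] .
      show "separates (T\<lparr>carrier := deg_less m\<rparr>) (wev ` lists \<Phi>)"
        unfolding separates_def
      proof (intro conjI ballI impI)
        show "wev ` lists \<Phi> \<subseteq> lin_map (T\<lparr>carrier := deg_less m\<rparr>) scalar_alg"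
          using lin_map_comp[OF l2 wev_lin[OF ll]] by auto
      qed (use Suc.IH in auto)
      show "set xs \<subseteq> carrier V \<times> carrier (T\<lparr>carrier := deg_less m\<rparr>)" using x(1) by auto
      fix \<phi> \<psi> assume "\<phi> \<in> \<Phi>" "\<psi> \<in> wev ` lists \<Phi>"
      then obtain \<psi>s where \<psi>s: "\<psi>s \<in> lists \<Phi>" "\<psi> = wev \<psi>s" "\<phi> # \<psi>s \<in> lists \<Phi>" by auto
      have "(\<Sum>p\<leftarrow>xs. wev (\<phi> # \<psi>s) (?f p)) = 0" using ev[OF \<psi>s(3)] Suc(3) \<psi>s(3) by auto
      moreover have "map (\<lambda>p. wev (\<phi> # \<psi>s) (?f p)) xs = map (\<lambda>(a, b). \<phi> a * \<psi> b) xs"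
        using i[OF \<psi>s(3)] by (intro map_cong refl) (auto simp: \<psi>s(2))
      ultimately show "(\<Sum>(a, b)\<leftarrow>xs. \<phi> a * \<psi> b) = 0" by simp
    qed
    ultimately show ?case using x(2) T.smult_l_null[of "\<one>\<^bsub>T\<^esub>"] by simp
  qed
  show ?thesis unfolding separates_def
  proof (intro conjI ballI impI)
    show "wev ` lists \<Phi> \<subseteq> lin_map T scalar_alg" using wev_lin[OF ll] by auto
    fix X assume X: "X \<in> carrier T" and z: "\<forall>\<phi>\<in>wev ` lists \<Phi>. \<phi> X = 0"
    obtain F where F: "F \<in> carrier FA" "X = tensor_alg_ideal V +>\<^bsub>FA\<^esub> F"
      using X by (auto simp: T_eq quot_alg_simps(1))
    \<comment> \<open>Every element lies in the filtration: one more than the longest word of a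
      representative is a bound.\<close>
    have "Poly_Mapping.keys F \<subseteq> {vs \<in> lists (carrier V). length vs < Suc (Max (length ` Poly_Mapping.keys F))}"
      using F(1) by (auto simp: FA_eq monoid_alg_simps less_Suc_eq_le)
    then have "X \<in> deg_less (Suc (Max (length ` Poly_Mapping.keys F)))"
      unfolding deg_less_def F(2) by blast
    then show "X = \<zero>\<^bsub>T\<^esub>" using sep z by auto
  qed
qed

end


section \<open>Abelianizations and symmetric algebras\<close>

definition comm_alg :: "('k::field, 'a) module \<Rightarrow> bool" where
  "comm_alg A \<longleftrightarrow> kalg A \<and> (\<forall>x\<in>carrier A. \<forall>y\<in>carrier A. x \<otimes>\<^bsub>A\<^esub> y = y \<otimes>\<^bsub>A\<^esub> x)"

lemma comm_algD:
  assumes "comm_alg A"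
  shows "kalg A" "x \<in> carrier A \<Longrightarrow> y \<in> carrier A \<Longrightarrow> x \<otimes>\<^bsub>A\<^esub> y = y \<otimes>\<^bsub>A\<^esub> x"
  using assms by (auto simp: comm_alg_def)

lemma comm_alg_scalar: "comm_alg scalar_alg"
  by (simp add: comm_alg_def kalg_scalar mult.commute)

lemma comm_alg_tensor: "comm_alg A \<Longrightarrow> comm_alg B \<Longrightarrow> comm_alg (tensor A B)"
proof -
  assume A: "comm_alg A" and B: "comm_alg B"
  then interpret tens_alg A B by (simp add: tens_alg_def comm_alg_def)
  show ?thesis unfolding comm_alg_def
    using kalg_tensor tensor_comm comm_algD(2)[OF A] comm_algD(2)[OF B] by blast
qed

context kalg
begin

definition commutators :: "'a set" where
  "commutators = {(x \<otimes> y) \<ominus> (y \<otimes> x) | x y. x \<in> carrier A \<and> y \<in> carrier A}"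

lemma commutators_closed: "commutators \<subseteq> carrier A"
  by (auto simp: commutators_def)

lemma commutator_ideal_eq: "commutator_ideal A = genideal A commutators"
  by (simp add: commutator_ideal_def commutators_def)

lemma ideal_commutator: "ideal (commutator_ideal A) A"
  unfolding commutator_ideal_eq by (rule genideal_ideal[OF commutators_closed])

lemma kalg_ideal_commutator: "kalg_ideal A (commutator_ideal A)"
  by (intro kalg_ideal.intro kalg_axioms ideal_commutator)

lemma abel_proj_hom: "abel_proj A \<in> alg_hom A (abelianization A)"
  unfolding abel_proj_def[abs_def] abelianization_def by (rule kalg_ideal.coset_alg_hom[OF kalg_ideal_commutator])

lemma abel_proj_surj: "X \<in> carrier (abelianization A) \<Longrightarrow> \<exists>x\<in>carrier A. X = abel_proj A x"
  by (auto simp: abelianization_def quot_alg_simps(1) abel_proj_def)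

lemma comm_alg_abelianization: "comm_alg (abelianization A)"
  unfolding comm_alg_def
proof (intro conjI ballI)
  interpret CI: kalg_ideal A "commutator_ideal A" by (rule kalg_ideal_commutator)
  show "kalg (abelianization A)" unfolding abelianization_def by (rule kalg_ideal.kalg_quot[OF kalg_ideal_commutator])
  fix X Y assume "X \<in> carrier (abelianization A)" "Y \<in> carrier (abelianization A)"
  then obtain x y where xy: "x \<in> carrier A" "y \<in> carrier A" "X = abel_proj A x" "Y = abel_proj A y"
    using abel_proj_surj[of X] abel_proj_surj[of Y] by blast
  have "x \<otimes> y \<ominus> y \<otimes> x \<in> commutator_ideal A"
    unfolding commutator_ideal_eq using genideal_self[OF commutators_closed] xy
    by (auto simp: commutators_def)
  then have "abel_proj A (x \<otimes> y) = abel_proj A (y \<otimes> x)"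
    unfolding abel_proj_def using CI.coset_eq_iff[of "x \<otimes> y" "y \<otimes> x"] xy by simp
  then show "X \<otimes>\<^bsub>abelianization A\<^esub> Y = Y \<otimes>\<^bsub>abelianization A\<^esub> X"
    using xy alg_homD(3)[OF abel_proj_hom] by simp
qed

text \<open>A commutative target kills the commutators, and \<open>genideal_vanish\<close> passes
  from them to the ideal. Maps out of the quotient are known henceforth only by their values on
  \<open>abel_proj\<close>.\<close>

lemma abel_factor:
  assumes h: "h \<in> alg_hom A B" and B: "comm_alg B"
  obtains h' where "h' \<in> alg_hom (abelianization A) B" "\<And>x. x \<in> carrier A \<Longrightarrow> h' (abel_proj A x) = h x"
proof -
  interpret B: kalg B by (rule comm_algD(1)[OF B])
  note D = alg_homD[OF h]
  have "h x = \<zero>\<^bsub>B\<^esub>" if "x \<in> commutator_ideal A" for x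
  proof (rule genideal_vanish[OF kalg_axioms kalg_vsp[OF comm_algD(1)[OF B]] alg_hom_lin[OF h]
        commutators_closed _ that[unfolded commutator_ideal_eq]])
    fix s x y assume s: "s \<in> commutators" and x: "x \<in> carrier A" and y: "y \<in> carrier A"
    obtain u v where uv: "s = (u \<otimes> v) \<ominus> (v \<otimes> u)" "u \<in> carrier A" "v \<in> carrier A"
      using s by (auto simp: commutators_def)
    have "h s = h (u \<otimes> v) \<ominus>\<^bsub>B\<^esub> h (v \<otimes> u)"
      unfolding uv(1) using uv
      by (intro lin_map_minus[OF kalg_vsp[OF kalg_axioms] kalg_vsp[OF comm_algD(1)[OF B]] alg_hom_lin[OF h]]) auto
    also have "\<dots> = \<zero>\<^bsub>B\<^esub>"
      using uv D comm_algD(2)[OF B, of "h u" "h v"] by (simp add: B.minus_eq B.r_neg)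
    finally have "h s = \<zero>\<^bsub>B\<^esub>" .
    moreover have "s \<in> carrier A" using s commutators_closed by auto
    ultimately show "h (x \<otimes> s \<otimes> y) = \<zero>\<^bsub>B\<^esub>" using x y by (simp add: D)
  qed
  then obtain h' where "h' \<in> alg_hom (quot_alg A (commutator_ideal A)) B"
    "\<And>x. x \<in> carrier A \<Longrightarrow> h' (commutator_ideal A +> x) = h x"
    using kalg_ideal.quot_alg_factor[OF kalg_ideal_commutator h comm_algD(1)[OF B]] by blast
  then show ?thesis using that unfolding abelianization_def abel_proj_def by blast
qed

end

lemma comm_foldr_mset:
  assumes "comm_monoid M" "mset xs = mset ys" "set xs \<subseteq> carrier M"
  shows "foldr (\<otimes>\<^bsub>M\<^esub>) xs \<one>\<^bsub>M\<^esub> = foldr (\<otimes>\<^bsub>M\<^esub>) ys \<one>\<^bsub>M\<^esub>"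
proof -
  interpret comm_monoid M by fact
  have cl: "foldr (\<otimes>\<^bsub>M\<^esub>) zs \<one>\<^bsub>M\<^esub> \<in> carrier M" if "set zs \<subseteq> carrier M" for zs
    using that by (induction zs) auto
  have mid: "foldr (\<otimes>\<^bsub>M\<^esub>) (us @ x # vs) \<one>\<^bsub>M\<^esub> = x \<otimes>\<^bsub>M\<^esub> foldr (\<otimes>\<^bsub>M\<^esub>) (us @ vs) \<one>\<^bsub>M\<^esub>"
    if "x \<in> carrier M" "set us \<subseteq> carrier M" "set vs \<subseteq> carrier M" for us vs x
    using that(2)
  proof (induction us)
    case (Cons u us)
    have c: "foldr (\<otimes>\<^bsub>M\<^esub>) (us @ vs) \<one>\<^bsub>M\<^esub> \<in> carrier M" using Cons that by (intro cl) auto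
    have "foldr (\<otimes>\<^bsub>M\<^esub>) ((u # us) @ x # vs) \<one>\<^bsub>M\<^esub> = u \<otimes>\<^bsub>M\<^esub> (x \<otimes>\<^bsub>M\<^esub> foldr (\<otimes>\<^bsub>M\<^esub>) (us @ vs) \<one>\<^bsub>M\<^esub>)"
      using Cons by (simp del: foldr_append)
    also have "\<dots> = x \<otimes>\<^bsub>M\<^esub> (u \<otimes>\<^bsub>M\<^esub> foldr (\<otimes>\<^bsub>M\<^esub>) (us @ vs) \<one>\<^bsub>M\<^esub>)"
      using Cons that c by (intro m_lcomm) auto
    finally show ?case by simp
  qed simp
  show ?thesis using assms(2,3)
  proof (induction xs arbitrary: ys)
    case (Cons x xs)
    have "x \<in> set ys" using Cons.prems(1) by (metis list.set_intros(1) set_mset_mset)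
    then obtain us vs where ys: "ys = us @ x # vs" by (meson split_list)
    have m: "mset xs = mset (us @ vs)" using Cons.prems(1) ys by simp
    have s: "set us \<subseteq> carrier M" "set vs \<subseteq> carrier M" "x \<in> carrier M"
      using Cons.prems mset_eq_setD[OF m] by auto
    show ?case using Cons.IH[OF m] Cons.prems(2) mid[OF s(3,1,2)] by (simp add: ys del: foldr_append)
  qed simp
qed

section \<open>Symmetric algebras and their universal property\<close>

context tensalg
begin

text \<open>The image of \<open>V\<close> generates \<open>T\<close> as an algebra, so membership in
  a set closed under the operations is decided on it. Zero is reached as
  \<open>0 \<odot> \<one>\<close>.\<close>

lemma alg_hom_T_in:
  assumes A: "kalg A" and h: "h \<in> alg_hom T A"
    and K: "\<one>\<^bsub>A\<^esub> \<in> K" "\<And>x y. x \<in> K \<Longrightarrow> y \<in> K \<Longrightarrow> x \<oplus>\<^bsub>A\<^esub> y \<in> K" "\<And>c x. x \<in> K \<Longrightarrow> c \<odot>\<^bsub>A\<^esub> x \<in> K"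
      "\<And>x y. x \<in> K \<Longrightarrow> y \<in> K \<Longrightarrow> x \<otimes>\<^bsub>A\<^esub> y \<in> K"
    and inc: "\<And>v. v \<in> carrier V \<Longrightarrow> h (tensor_alg_inc V v) \<in> K"
    and X: "X \<in> carrier T"
  shows "h X \<in> K"
  using X
proof (induction X rule: T_induct)
  case zero
  interpret A: kalg A by fact
  have "h \<zero>\<^bsub>T\<^esub> = \<zero>\<^bsub>A\<^esub>" by (rule lin_map_zero[OF vT kalg_vsp[OF A] alg_hom_lin[OF h]])
  then show ?case using K(3)[OF K(1), of 0] A.smult_l_null[of "\<one>\<^bsub>A\<^esub>"] by simp
next
  case (scaled vs c)
  have "h (word vs) \<in> K" using scaled
  proof (induction vs)
    case Nil
    show ?case using K(1) alg_homD(4)[OF h] by (simp add: word_Nil)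
  next
    case (Cons v vs)
    then show ?case using lin_mapD(1)[OF inc_lin] by (auto simp: word_Cons alg_homD(3)[OF h] intro: K(4) inc)
  qed
  then show ?case using scaled K(3) by (simp add: alg_homD(5)[OF h])
next
  case (add Y Z)
  then show ?case using K(2) by (simp add: alg_homD(2)[OF h])
qed

abbreviation "S \<equiv> sym_alg V"
abbreviation "pr \<equiv> abel_proj T"

lemma comm_alg_S: "comm_alg S"
  unfolding sym_alg_def by (rule T.comm_alg_abelianization)

lemma kalg_S: "kalg S"
  by (rule comm_algD(1)[OF comm_alg_S])

lemma vS: "vsp S"
  by (rule kalg_vsp[OF kalg_S])

lemma pr_hom: "pr \<in> alg_hom T S"
  unfolding sym_alg_def by (rule T.abel_proj_hom)

lemma pr_surj: "X \<in> carrier S \<Longrightarrow> \<exists>x\<in>carrier T. X = pr x"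
  unfolding sym_alg_def by (rule T.abel_proj_surj)

lemma sym_factor:
  assumes "h \<in> alg_hom T B" "comm_alg B"
  obtains h' where "h' \<in> alg_hom S B" "\<And>x. x \<in> carrier T \<Longrightarrow> h' (pr x) = h x"
  using T.abel_factor[OF assms] unfolding sym_alg_def by blast

lemma sym_lift:
  assumes "g \<in> lin_map V B" "comm_alg B"
  obtains h where "h \<in> alg_hom S B" "\<And>v. v \<in> carrier V \<Longrightarrow> h (sym_alg_inc V v) = g v"
proof -
  note L = tensor_alg_lift[OF comm_algD(1)[OF assms(2)] assms(1)]
  obtain h where h: "h \<in> alg_hom S B" "\<And>x. x \<in> carrier T \<Longrightarrow> h (pr x) = tensor_alg_lift B g x"
    using sym_factor[OF L(1) assms(2)] by blast
  show ?thesis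
    by (rule that[OF h(1)]) (use h(2) L(2) lin_mapD(1)[OF inc_lin] in \<open>simp add: sym_alg_inc_def\<close>)
qed

lemma sym_inc_lin: "sym_alg_inc V \<in> lin_map V S"
  unfolding sym_alg_inc_def[abs_def] by (rule lin_map_comp[OF inc_lin alg_hom_lin[OF pr_hom]])

lemma alg_hom_S_eq:
  assumes "kalg A" "h \<in> alg_hom S A" "h' \<in> alg_hom S A"
    and "\<And>v. v \<in> carrier V \<Longrightarrow> h (sym_alg_inc V v) = h' (sym_alg_inc V v)"
    and "Y \<in> carrier S"
  shows "h Y = h' Y"
proof -
  obtain y where y: "y \<in> carrier T" "Y = pr y" using pr_surj[OF assms(5)] by blast
  show ?thesis unfolding y(2)
    by (rule alg_hom_T_eq[OF assms(1) alg_hom_comp[OF pr_hom assms(2)] alg_hom_comp[OF pr_hom assms(3)] _ y(1)])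
      (use assms(4) in \<open>simp add: sym_alg_inc_def\<close>)
qed

lemma pr_word: "vs \<in> lists (carrier V) \<Longrightarrow> pr (word vs) = foldr (\<otimes>\<^bsub>S\<^esub>) (map (sym_alg_inc V) vs) \<one>\<^bsub>S\<^esub>"
proof (induction vs)
  case Nil
  show ?case using alg_homD(4)[OF pr_hom] by (simp add: word_Nil)
next
  case (Cons v vs)
  then show ?case using lin_mapD(1)[OF inc_lin]
    by (simp add: word_Cons alg_homD(3)[OF pr_hom] sym_alg_inc_def)
qed

text \<open>In a commutative algebra a product depends only on the multiset of its factors. This
  makes symmetrization invisible after projection.\<close>

lemma pr_word_mset:
  assumes "mset us = mset vs" "us \<in> lists (carrier V)"
  shows "pr (word us) = pr (word vs)"
proof -
  interpret S: kalg S by (rule kalg_S)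
  have cm: "comm_monoid S"
    by (intro comm_monoid.intro S.monoid_axioms comm_monoid_axioms.intro comm_algD(2)[OF comm_alg_S])
  have vs: "vs \<in> lists (carrier V)" using assms mset_eq_setD by fastforce
  show ?thesis unfolding pr_word[OF assms(2)] pr_word[OF vs]
    by (rule comm_foldr_mset[OF cm]) (use assms lin_mapD(1)[OF sym_inc_lin] in auto)
qed

end


section \<open>Symmetrization\<close>

lemma lin_map_cong:
  assumes "vsp A" "f \<in> lin_map A B" "\<And>x. x \<in> carrier A \<Longrightarrow> f x = g x"
  shows "g \<in> lin_map A B"
proof -
  interpret A: Module.module scalar_alg A by fact
  show ?thesis
    by (rule lin_mapI) (simp_all add: assms(3)[symmetric] lin_mapD[OF assms(2)])
qed

lemma lin_map_finsum_pointwise: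
  assumes A: "vsp A" and B: "vsp B" and "finite K" "\<And>i. i \<in> K \<Longrightarrow> f i \<in> lin_map A B"
  shows "(\<lambda>x. \<Oplus>\<^bsub>B\<^esub>i\<in>K. f i x) \<in> lin_map A B"
  using assms(3,4)
proof (induction K)
  case empty
  interpret B: Module.module scalar_alg B by fact
  show ?case using lin_map_const_zero[OF B] by simp
next
  case (insert i K)
  interpret B: Module.module scalar_alg B by fact
  have "(\<lambda>x. f i x \<oplus>\<^bsub>B\<^esub> (\<Oplus>\<^bsub>B\<^esub>i\<in>K. f i x)) \<in> lin_map A B"
    using insert by (intro lin_map_add[OF B]) auto
  then show ?case
  proof (rule lin_map_cong[OF A])
    show "f i x \<oplus>\<^bsub>B\<^esub> (\<Oplus>\<^bsub>B\<^esub>i\<in>K. f i x) = (\<Oplus>\<^bsub>B\<^esub>j\<in>insert i K. f j x)" if "x \<in> carrier A" for x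
      using insert that by (intro B.finsum_insert[symmetric]) (auto dest: lin_mapD(1))
  qed
qed

lemma finsum_const_smult:
  assumes B: "vsp B" and "finite K" "x \<in> carrier B"
  shows "(\<Oplus>\<^bsub>B\<^esub>i\<in>K. x) = of_nat (card K) \<odot>\<^bsub>B\<^esub> x"
  using assms(2)
proof (induction K)
  interpret B: Module.module scalar_alg B by fact
  {
    case empty
    show ?case using B.smult_l_null[OF assms(3)] by simp
  next
    case (insert i K)
    then show ?case
      using assms(3) B.smult_l_distr[of 1 "of_nat (card K)" x] B.smult_one[OF assms(3)] by simp
  }
qed

lemma finsum_scalar:
  fixes g :: "'i \<Rightarrow> 'k::field"
  assumes "finite K"
  shows "(\<Oplus>\<^bsub>scalar_alg\<^esub>i\<in>K. g i) = (\<Sum>i\<in>K. g i)"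
proof -
  interpret k: kalg "scalar_alg :: ('k, 'k) module" by (rule kalg_scalar)
  show ?thesis using assms by (induction K) auto
qed

context tensalg
begin

text \<open>\<open>permute_list \<sigma> xs\<close> has \<open>xs ! \<sigma> j\<close> at place
  \<open>j\<close>, so the letter from slot \<open>i\<close> ends at the place that
  \<open>\<sigma>\<close> sends to \<open>i\<close>.\<close>

lemma permute_list_update:
  assumes "\<sigma> permutes {..<length xs}" "i < length xs"
  shows "permute_list \<sigma> (xs[i := v]) = (permute_list \<sigma> xs)[inv_into UNIV \<sigma> i := v]"
proof (rule nth_equalityI)
  fix j assume "j < length (permute_list \<sigma> (xs[i := v]))"
  then have j: "j < length xs" by simp
  have "\<sigma> j < length xs" using permutes_in_image[OF assms(1), of j] j by simp
  moreover have "\<sigma> j = i \<longleftrightarrow> j = inv_into UNIV \<sigma> i" using permutes_inverses[OF assms(1)] by metis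
  moreover have "\<sigma> permutes {..<length (xs[i := v])}" using assms(1) by simp
  ultimately show "permute_list \<sigma> (xs[i := v]) ! j = (permute_list \<sigma> xs)[inv_into UNIV \<sigma> i := v] ! j"
    using assms j by (auto simp: permute_list_nth nth_list_update)
qed simp

lemma mlin_slot:
  assumes g: "mlin V C g" and us: "us \<in> lists (carrier V)" and vs: "vs \<in> lists (carrier V)"
  shows "(\<lambda>v. g (us @ v # vs)) \<in> lin_map V C"
proof (rule lin_mapI)
  show "g (us @ v # vs) \<in> carrier C" if "v \<in> carrier V" for v
  proof -
    have "us @ v # vs \<in> lists (carrier V)" using that us vs by auto
    then show ?thesis using g by (auto simp: mlin_def simp del: append_in_lists_conv Cons_in_lists_iff)
  qed
qed (use g us vs in \<open>auto simp: mlin_def\<close>)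

text \<open>A permuted word still depends on \<open>v\<close> through one slot only; locating it at
  \<open>?k\<close> restores the shape of \<open>mlin_slot\<close>. The zero vector in
  \<open>?xs\<close> is a placeholder for \<open>v\<close>.\<close>

lemma mlin_permuted:
  assumes C: "vsp C" and g: "mlin V C g" and us: "us \<in> lists (carrier V)" and vs: "vs \<in> lists (carrier V)"
    and \<sigma>: "\<sigma> permutes {..<length us + 1 + length vs}"
  shows "(\<lambda>v. g (permute_list \<sigma> (us @ v # vs))) \<in> lin_map V C"
proof -
  let ?xs = "us @ \<zero>\<^bsub>V\<^esub> # vs"
  let ?ys = "permute_list \<sigma> ?xs"
  let ?k = "inv_into UNIV \<sigma> (length us)"
  have \<sigma>': "\<sigma> permutes {..<length ?xs}" using \<sigma> by simp
  have k: "?k < length ?ys"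
    using permutes_in_image[OF permutes_inv[OF \<sigma>'], of "length us"] by simp
  have "set ?ys = set ?xs" by (rule set_permute_list[OF \<sigma>'])
  then have ys: "?ys \<in> lists (carrier V)" using us vs by auto
  have eq: "permute_list \<sigma> (us @ v # vs) = take ?k ?ys @ v # drop (Suc ?k) ?ys" for v
  proof -
    have "us @ v # vs = ?xs[length us := v]" by simp
    then have "permute_list \<sigma> (us @ v # vs) = ?ys[?k := v]"
      using permute_list_update[OF \<sigma>', of "length us" v] by simp
    then show ?thesis using upd_conv_take_nth_drop[OF k] by simp
  qed
  have td: "take ?k ?ys \<in> lists (carrier V)" "drop (Suc ?k) ?ys \<in> lists (carrier V)"
    using ys by (auto dest: in_set_takeD in_set_dropD)
  have "(\<lambda>v. g (take ?k ?ys @ v # drop (Suc ?k) ?ys)) \<in> lin_map V C"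
    by (rule mlin_slot[OF g td])
  then show ?thesis
  proof (rule lin_map_cong[OF vV])
    show "g (take ?k ?ys @ v # drop (Suc ?k) ?ys) = g (permute_list \<sigma> (us @ v # vs))" for v
      by (rule arg_cong[OF eq[symmetric]])
  qed
qed

text \<open>The average over all orders of the letters. The factor is a formal
  \<open>inverse\<close>; that it inverts \<open>n!\<close> enters in \<open>pr_Sym\<close>.\<close>

definition symm :: "'v list \<Rightarrow> ('v list \<Rightarrow>\<^sub>0 'k) set" where
  "symm vs = inverse (of_nat (fact (length vs))) \<odot>\<^bsub>T\<^esub>
     (\<Oplus>\<^bsub>T\<^esub>\<sigma>\<in>{\<sigma>. \<sigma> permutes {..<length vs}}. word (permute_list \<sigma> vs))"

definition Sym :: "('v list \<Rightarrow>\<^sub>0 'k) set \<Rightarrow> ('v list \<Rightarrow>\<^sub>0 'k) set" where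
  "Sym = lin_lift T symm"

lemma word_slot_lin:
  assumes us: "us \<in> lists (carrier V)" and vs: "vs \<in> lists (carrier V)"
  shows "(\<lambda>v. word (us @ v # vs)) \<in> lin_map V T"
proof -
  have "(\<lambda>v. word us \<otimes>\<^bsub>T\<^esub> (tensor_alg_inc V v \<otimes>\<^bsub>T\<^esub> word vs)) \<in> lin_map V T"
    using lin_map_comp[OF lin_map_comp[OF inc_lin bilinD(2)[OF bilin_mult[OF kalg_T]]] bilinD(1)[OF bilin_mult[OF kalg_T]]]
      word_closed[OF us] word_closed[OF vs] by blast
  moreover have "word us \<otimes>\<^bsub>T\<^esub> (tensor_alg_inc V v \<otimes>\<^bsub>T\<^esub> word vs) = word (us @ v # vs)" if "v \<in> carrier V" for v
    using that us vs word_mult[of us "v # vs"] by (simp add: word_Cons)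
  ultimately show ?thesis by (rule lin_map_cong[OF vV])
qed

lemma mlin_word: "mlin V T (\<lambda>vs. word vs)"
  by (rule mlinI) (use word_slot_lin in auto)

lemma permute_list_carrier:
  "\<sigma> permutes {..<length vs} \<Longrightarrow> vs \<in> lists (carrier V) \<Longrightarrow> permute_list \<sigma> vs \<in> lists (carrier V)"
  by (auto simp: in_lists_conv_set)

lemma mlin_symm: "mlin V T symm"
proof (rule mlinI)
  fix us vs assume us: "us \<in> lists (carrier V)" and vs: "vs \<in> lists (carrier V)"
  have "(\<lambda>v. inverse (of_nat (fact (length us + 1 + length vs))) \<odot>\<^bsub>T\<^esub>
     (\<Oplus>\<^bsub>T\<^esub>\<sigma>\<in>{\<sigma>. \<sigma> permutes {..<length us + 1 + length vs}}. word (permute_list \<sigma> (us @ v # vs)))) \<in> lin_map V T"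
    using mlin_permuted[OF vT mlin_word us vs]
    by (intro lin_map_smult[OF vT] lin_map_finsum_pointwise[OF vV vT]) (auto simp: finite_permutations)
  then show "(\<lambda>v. symm (us @ v # vs)) \<in> lin_map V T" by (simp add: symm_def)
qed (auto simp: symm_def permute_list_carrier intro!: T.smult_closed T.finsum_closed)

lemma Sym_lin: "Sym \<in> lin_map T T"
  and Sym_word: "vs \<in> lists (carrier V) \<Longrightarrow> Sym (word vs) = symm vs"
  unfolding Sym_def using mlin_lift[OF vT mlin_symm] by auto

text \<open>All \<open>n!\<close> reorderings of a word have the same image in \<open>S\<close>, and
  the normalizing factor cancels their number.\<close>

lemma pr_Sym:
  assumes char: "\<And>n. of_nat (fact n) \<noteq> (0::'k)" and X: "X \<in> carrier T"
  shows "pr (Sym X) = pr X"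
proof (rule lin_map_T_eq[OF vS lin_map_comp[OF Sym_lin alg_hom_lin[OF pr_hom]] alg_hom_lin[OF pr_hom] _ X])
  fix vs assume vs: "vs \<in> lists (carrier V)"
  interpret S: kalg S by (rule kalg_S)
  let ?P = "{\<sigma>. \<sigma> permutes {..<length vs}}"
  have f: "finite ?P" by (simp add: finite_permutations)
  have c: "(\<lambda>\<sigma>. word (permute_list \<sigma> vs)) \<in> ?P \<rightarrow> carrier T"
    using permute_list_carrier vs by auto
  have "pr (\<Oplus>\<^bsub>T\<^esub>\<sigma>\<in>?P. word (permute_list \<sigma> vs)) = (\<Oplus>\<^bsub>S\<^esub>\<sigma>\<in>?P. pr (word (permute_list \<sigma> vs)))"
    by (rule lin_map_finsum[OF vT vS alg_hom_lin[OF pr_hom] f c])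
  also have "\<dots> = (\<Oplus>\<^bsub>S\<^esub>\<sigma>\<in>?P. pr (word vs))"
    using vs alg_homD(1)[OF pr_hom]
    by (intro S.finsum_cong') (auto simp: mset_permute_list intro!: pr_word_mset permute_list_carrier)
  also have "\<dots> = of_nat (fact (length vs)) \<odot>\<^bsub>S\<^esub> pr (word vs)"
    using finsum_const_smult[OF vS f] vs alg_homD(1)[OF pr_hom] by (simp add: card_permutations)
  finally have "pr (\<Oplus>\<^bsub>T\<^esub>\<sigma>\<in>?P. word (permute_list \<sigma> vs)) = of_nat (fact (length vs)) \<odot>\<^bsub>S\<^esub> pr (word vs)" .
  then have "pr (Sym (word vs)) = inverse (of_nat (fact (length vs))) \<odot>\<^bsub>S\<^esub> (of_nat (fact (length vs)) \<odot>\<^bsub>S\<^esub> pr (word vs))"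
    using c by (simp add: Sym_word[OF vs] symm_def alg_homD(5)[OF pr_hom])
  also have "\<dots> = (inverse (of_nat (fact (length vs))) * of_nat (fact (length vs))) \<odot>\<^bsub>S\<^esub> pr (word vs)"
    using S.smult_assoc1[of "inverse (of_nat (fact (length vs)))" "of_nat (fact (length vs))" "pr (word vs)"]
      vs alg_homD(1)[OF pr_hom] by simp
  also have "\<dots> = pr (word vs)"
    using char vs alg_homD(1)[OF pr_hom] S.smult_one[of "pr (word vs)"] by simp
  finally show "pr (Sym (word vs)) = pr (word vs)" .
qed

text \<open>Reindexing the product of values moves the permutation from the letters to the forms,
  where it appears inverted.\<close>

lemma wev_permute:
  assumes \<phi>s: "\<phi>s \<in> lists (lin_map V scalar_alg)" and vs: "vs \<in> lists (carrier V)"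
    and len: "length vs = length \<phi>s" and \<sigma>: "\<sigma> permutes {..<length vs}"
  shows "wev \<phi>s (word (permute_list \<sigma> vs)) = wev (permute_list (inv_into UNIV \<sigma>) \<phi>s) (word vs)"
proof -
  have \<sigma>': "inv_into UNIV \<sigma> permutes {..<length vs}" using \<sigma> by (rule permutes_inv)
  have p: "permute_list (inv_into UNIV \<sigma>) \<phi>s \<in> lists (lin_map V scalar_alg)"
    using \<phi>s \<sigma>' len by (auto simp: in_lists_conv_set)
  have prod_nth: "prod_list (map2 (\<lambda>v \<phi>. \<phi> v) xs ys) = (\<Prod>i<length xs. (ys ! i) (xs ! i))"
    if "length xs = length ys" for xs :: "'v list" and ys :: "('v \<Rightarrow> 'k) list"
  proof -
    have "map2 (\<lambda>v \<phi>. \<phi> v) xs ys = map (\<lambda>i. (ys ! i) (xs ! i)) [0..<length xs]"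
      by (rule nth_equalityI) (use that in auto)
    then show ?thesis by (simp add: prod.list_conv_set_nth atLeast0LessThan)
  qed
  have "prod_list (map2 (\<lambda>v \<phi>. \<phi> v) (permute_list \<sigma> vs) \<phi>s) = (\<Prod>i<length vs. (\<phi>s ! i) (vs ! \<sigma> i))"
    using len \<sigma> by (simp add: prod_nth permute_list_nth)
  also have "\<dots> = (\<Prod>i<length vs. (\<phi>s ! inv_into UNIV \<sigma> i) (vs ! i))"
    by (rule prod.reindex_bij_witness[of _ "inv_into UNIV \<sigma>" \<sigma>])
      (use \<sigma> \<sigma>' permutes_in_image[OF \<sigma>] permutes_in_image[OF \<sigma>'] permutes_inverses[OF \<sigma>] in auto)
  also have "\<dots> = prod_list (map2 (\<lambda>v \<phi>. \<phi> v) vs (permute_list (inv_into UNIV \<sigma>) \<phi>s))"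
    using len \<sigma>' by (simp add: prod_nth permute_list_nth)
  finally show ?thesis
    using len vs \<sigma> by (simp add: wev_word[OF \<phi>s permute_list_carrier] wev_word[OF p])
qed

text \<open>The transpose of \<open>Sym\<close> symmetrizes the forms: the inversion of
  \<open>wev_permute\<close> disappears in a sum over the whole group, and for words of the wrong
  length both sides are zero.\<close>

lemma wev_Sym:
  assumes \<phi>s: "\<phi>s \<in> lists (lin_map V scalar_alg)" and X: "X \<in> carrier T"
  shows "wev \<phi>s (Sym X) = inverse (of_nat (fact (length \<phi>s))) *
    (\<Sum>\<sigma>\<in>{\<sigma>. \<sigma> permutes {..<length \<phi>s}}. wev (permute_list \<sigma> \<phi>s) X)"
proof -
  let ?P = "\<lambda>n. {\<sigma>. \<sigma> permutes {..<n::nat}}"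
  have f: "finite (?P n)" for n by (simp add: finite_permutations)
  have p: "permute_list \<sigma> \<phi>s \<in> lists (lin_map V scalar_alg)" if "\<sigma> \<in> ?P (length \<phi>s)" for \<sigma>
    using \<phi>s that by (auto simp: in_lists_conv_set)
  have lin: "(\<lambda>X. inverse (of_nat (fact (length \<phi>s))) * (\<Sum>\<sigma>\<in>?P (length \<phi>s). wev (permute_list \<sigma> \<phi>s) X))
    \<in> lin_map T scalar_alg"
    using lin_map_smult[OF vsp_scalar lin_map_finsum_pointwise[OF vT vsp_scalar f[of "length \<phi>s"], where f="\<lambda>\<sigma>. wev (permute_list \<sigma> \<phi>s)"]]
      wev_lin[OF p] f by (simp add: finsum_scalar)
  show ?thesis
  proof (rule lin_map_T_eq[OF vsp_scalar lin_map_comp[OF Sym_lin wev_lin[OF \<phi>s]] lin _ X])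
    fix vs assume vs: "vs \<in> lists (carrier V)"
    let ?n = "length vs"
    have c: "(\<lambda>\<sigma>. word (permute_list \<sigma> vs)) \<in> ?P ?n \<rightarrow> carrier T"
      using permute_list_carrier vs by auto
    have "wev \<phi>s (Sym (word vs)) = inverse (of_nat (fact ?n)) * (\<Sum>\<sigma>\<in>?P ?n. wev \<phi>s (word (permute_list \<sigma> vs)))"
      using c lin_map_finsum[OF vT vsp_scalar wev_lin[OF \<phi>s] f c] f
      by (simp add: Sym_word[OF vs] symm_def lin_mapD(3)[OF wev_lin[OF \<phi>s]] finsum_scalar)
    also have "\<dots> = inverse (of_nat (fact (length \<phi>s))) * (\<Sum>\<sigma>\<in>?P (length \<phi>s). wev (permute_list \<sigma> \<phi>s) (word vs))"
    proof (cases "?n = length \<phi>s")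
      case True
      have "(\<Sum>\<sigma>\<in>?P ?n. wev \<phi>s (word (permute_list \<sigma> vs))) = (\<Sum>\<sigma>\<in>?P ?n. wev (permute_list (inv_into UNIV \<sigma>) \<phi>s) (word vs))"
        by (rule sum.cong) (use wev_permute[OF \<phi>s vs True] in auto)
      also have "\<dots> = (\<Sum>\<sigma>\<in>?P ?n. wev (permute_list \<sigma> \<phi>s) (word vs))"
        by (rule sum.reindex_bij_witness[of _ "inv_into UNIV" "inv_into UNIV"])
          (auto simp: permutes_inv permutes_inv_inv)
      finally show ?thesis using True by simp
    next
      case False
      have "wev \<phi>s (word (permute_list \<sigma> vs)) = 0" if "\<sigma> \<in> ?P ?n" for \<sigma>
        using that False vs by (simp add: wev_word[OF \<phi>s permute_list_carrier])
      moreover have "wev (permute_list \<sigma> \<phi>s) (word vs) = 0" if "\<sigma> \<in> ?P (length \<phi>s)" for \<sigma>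
        using wev_word[OF p[OF that] vs] False by simp
      ultimately show ?thesis by simp
    qed
    finally show "wev \<phi>s (Sym (word vs)) =
      inverse (of_nat (fact (length \<phi>s))) * (\<Sum>\<sigma>\<in>?P (length \<phi>s). wev (permute_list \<sigma> \<phi>s) (word vs))" .
  qed
qed

end


section \<open>The coproduct of the tensor algebra of the dual of an operad\<close>

definition ev :: "nat \<times> 'a \<Rightarrow> (nat \<Rightarrow> 'a \<Rightarrow> 'k::field) \<Rightarrow> 'k" where
  "ev w f = f (fst w) (snd w)"

lemma ev_Pair: "ev (n, q) f = f n q"
  by (simp add: ev_def)

lemma dual_operad_simps:
  "\<zero>\<^bsub>dual_operad scale P\<^esub> = (\<lambda>n p. 0)"
  "f \<oplus>\<^bsub>dual_operad scale P\<^esub> g = (\<lambda>n p. f n p + g n p)"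
  "c \<odot>\<^bsub>dual_operad scale P\<^esub> f = (\<lambda>n p. c * f n p)"
  by (simp_all add: dual_operad_def)

lemma dual_operad_carrier:
  "f \<in> carrier (dual_operad scale P) \<longleftrightarrow>
     (\<forall>n. f n \<in> dual_of scale (P n)) \<and> f 0 = (\<lambda>p. 0) \<and> finite {n. f n \<noteq> (\<lambda>p. 0)}"
  by (simp add: dual_operad_def)

lemma vsp_dual_operad: "vsp (dual_operad scale P)"
proof (rule vspI)
  fix f g assume fg: "f \<in> carrier (dual_operad scale P)" "g \<in> carrier (dual_operad scale P)"
  have "{n. (\<lambda>p. f n p + g n p) \<noteq> (\<lambda>p. 0)} \<subseteq> {n. f n \<noteq> (\<lambda>p. 0)} \<union> {n. g n \<noteq> (\<lambda>p. 0)}" by auto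
  then have "finite {n. (\<lambda>p. f n p + g n p) \<noteq> (\<lambda>p. 0)}"
    using fg by (auto simp: dual_operad_carrier intro: finite_subset)
  then show "f \<oplus>\<^bsub>dual_operad scale P\<^esub> g \<in> carrier (dual_operad scale P)"
    using fg by (auto simp: dual_operad_carrier dual_operad_simps dual_of_def algebra_simps)
next
  fix f c assume f: "f \<in> carrier (dual_operad scale P)"
  have "{n. (\<lambda>p. c * f n p) \<noteq> (\<lambda>p. 0)} \<subseteq> {n. f n \<noteq> (\<lambda>p. 0)}" by auto
  then have "finite {n. (\<lambda>p. c * f n p) \<noteq> (\<lambda>p. 0)}"
    using f by (auto simp: dual_operad_carrier intro: finite_subset)
  then show "c \<odot>\<^bsub>dual_operad scale P\<^esub> f \<in> carrier (dual_operad scale P)"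
    using f by (auto simp: dual_operad_carrier dual_operad_simps dual_of_def algebra_simps)
qed (auto simp: dual_operad_carrier dual_operad_simps dual_of_def algebra_simps)

locale operad_fd = operad scale P act \<gamma> e
  for scale :: "'k::field \<Rightarrow> 'a::ab_group_add \<Rightarrow> 'a" and P act \<gamma> e +
  assumes P0: "P 0 = {0}"
    and fin_dim: "\<And>n. \<exists>B. finite B \<and> P n = span B"
begin

abbreviation "DP \<equiv> dual_operad scale P"
abbreviation "L \<equiv> lists (Sigma UNIV P)"
abbreviation EV :: "nat \<times> 'a \<Rightarrow> (nat \<Rightarrow> 'a \<Rightarrow> 'k) \<Rightarrow> 'k" where "EV \<equiv> ev"
abbreviation WE :: "(nat \<times> 'a) list \<Rightarrow> ((nat \<Rightarrow> 'a \<Rightarrow> 'k) list \<Rightarrow>\<^sub>0 'k) set \<Rightarrow> 'k" where "WE \<equiv> word_eval"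
abbreviation "arity ws \<equiv> sum_list (map fst ws)"

sublocale V: tensalg DP
  by (rule tensalg.intro) (rule vsp_dual_operad)

sublocale VT: tens DP V.T
  by (intro tens.intro vsp_dual_operad V.vT)

sublocale TT: tens_alg V.T V.T
  by (intro tens_alg.intro V.kalg_T)

lemma ev_lin: "ev w \<in> lin_map DP scalar_alg"
  by (rule lin_mapI) (auto simp: ev_def dual_operad_simps)

lemma DP_dual: "f \<in> carrier DP \<Longrightarrow> f n \<in> dual_of scale (P n)"
  by (simp add: dual_operad_carrier)

lemma DP_add: "f \<in> carrier DP \<Longrightarrow> x \<in> P n \<Longrightarrow> y \<in> P n \<Longrightarrow> f n (x + y) = f n x + f n y"
  using DP_dual[of f n] by (simp add: dual_of_def)

lemma DP_scale: "f \<in> carrier DP \<Longrightarrow> x \<in> P n \<Longrightarrow> f n (scale c x) = c * f n x"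
  using DP_dual[of f n] by (simp add: dual_of_def)

lemma DP_outside: "f \<in> carrier DP \<Longrightarrow> x \<notin> P n \<Longrightarrow> f n x = 0"
  using DP_dual[of f n] by (simp add: dual_of_def)

lemma P_zero: "0 \<in> P n"
  by (rule subspace_0[OF subspace_P])

lemma DP_zero: "f \<in> carrier DP \<Longrightarrow> f n 0 = 0"
  using DP_scale[OF _ P_zero, of f n 0] by simp

text \<open>Forms in \<open>dual_of\<close> vanish outside the subspace, so their values on the
  \<open>P n\<close> determine them as functions.\<close>

lemma separates_ev: "separates DP (EV ` Sigma UNIV P)"
  unfolding separates_def
proof (intro conjI ballI impI)
  show "EV ` Sigma UNIV P \<subseteq> lin_map DP scalar_alg" using ev_lin by blast
  fix f assume f: "f \<in> carrier DP" and z: "\<forall>\<phi>\<in>EV ` Sigma UNIV P. \<phi> f = 0"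
  have "f n q = 0" for n q
    using z[rule_format, of "ev (n, q)"] DP_outside[OF f, of q n] by (cases "q \<in> P n") (auto simp: ev_Pair)
  then show "f = \<zero>\<^bsub>DP\<^esub>" by (auto simp: dual_operad_simps)
qed

text \<open>Brings evaluation on words of operations under the general theory of \<open>wev\<close>,
  with the forms \<open>ev w\<close>.\<close>

lemma word_eval_eq: "word_eval ws = V.wev (map ev ws)"
proof -
  have "map2 (\<lambda>f (k, q). f k q) fs ws = map2 (\<lambda>v \<phi>. \<phi> v) fs (map ev ws)" for fs :: "(nat \<Rightarrow> 'a \<Rightarrow> 'k) list"
    by (simp add: zip_map2 ev_def comp_def case_prod_unfold)
  then show ?thesis by (simp only: word_eval_def V.wev_def length_map)
qed

lemma map_ev: "map ev ws \<in> lists (lin_map DP scalar_alg)"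
  using ev_lin by auto

lemma word_eval_lin: "word_eval ws \<in> lin_map V.T scalar_alg"
  unfolding word_eval_eq by (rule V.wev_lin[OF map_ev])

lemma word_eval_inc_mult:
  assumes "v \<in> carrier DP" "t \<in> carrier V.T"
  shows "word_eval ws (tensor_alg_inc DP v \<otimes>\<^bsub>V.T\<^esub> t) =
    (case ws of [] \<Rightarrow> 0 | (k, q) # us \<Rightarrow> v k q * word_eval us t)"
  using V.wev_inc_mult[OF map_ev assms, of ws] by (auto simp: word_eval_eq ev_Pair split: list.splits)

lemma word_eval_one: "word_eval ws \<one>\<^bsub>V.T\<^esub> = (if ws = [] then 1 else 0)"
  using V.wev_one[OF map_ev, of ws] by (simp add: word_eval_eq)

lemma word_eval_mult:
  assumes "s \<in> carrier V.T" "t \<in> carrier V.T"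
  shows "word_eval ws (s \<otimes>\<^bsub>V.T\<^esub> t) = (\<Sum>i\<le>length ws. word_eval (take i ws) s * word_eval (drop i ws) t)"
  using V.wev_mult[OF map_ev assms, of ws] by (simp add: word_eval_eq take_map drop_map)

lemma separates_word_eval: "separates V.T (WE ` L)"
  using V.separates_wev[OF separates_ev] by (simp add: lists_image image_image word_eval_eq)

lemma pairing_eq: "pairing n q ws = ften (ev (n, q)) (word_eval ws)"
  by (simp add: pairing_def ften_def ev_Pair)

lemma pairing_lin: "pairing n q ws \<in> lin_map (tensor DP V.T) scalar_alg"
  unfolding pairing_eq by (rule VT.ften_lin(1)[OF ev_lin word_eval_lin])

lemma pairing_pure: "v \<in> carrier DP \<Longrightarrow> t \<in> carrier V.T \<Longrightarrow> pairing n q ws (pure DP V.T v t) = v n q * word_eval ws t"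
  unfolding pairing_eq by (simp add: VT.ften_lin(2)[OF ev_lin word_eval_lin] ev_Pair)

text \<open>Supplies the uniqueness behind \<open>delta\<close>, and reduces later identities in
  this tensor product to identities between operations.\<close>

lemma pairing_separates:
  assumes "X \<in> carrier (tensor DP V.T)" "Y \<in> carrier (tensor DP V.T)"
    and "\<And>n q ws. q \<in> P n \<Longrightarrow> ws \<in> L \<Longrightarrow> pairing n q ws X = pairing n q ws Y"
  shows "X = Y"
proof (rule separates_eq[OF VT.vsp_tensor VT.separates_tensor[OF separates_ev separates_word_eval] assms(1,2)])
  fix \<phi> assume "\<phi> \<in> {ften \<phi> \<psi> |\<phi> \<psi>. \<phi> \<in> EV ` Sigma UNIV P \<and> \<psi> \<in> WE ` L}"
  then obtain n q ws where "q \<in> P n" "ws \<in> L" "\<phi> = pairing n q ws" by (auto simp: pairing_eq)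
  then show "\<phi> X = \<phi> Y" using assms(3) by simp
qed

section \<open>Dual bases and representable multilinear forms\<close>

lemma dual_basis:
  obtains B \<beta> where "finite B" "B \<subseteq> P k" "\<And>b. b \<in> B \<Longrightarrow> \<beta> b \<in> dual_of scale (P k)"
    "\<And>q. q \<in> P k \<Longrightarrow> q = (\<Sum>b\<in>B. scale (\<beta> b q) b)"
proof -
  obtain B0 where B0: "finite B0" "P k = span B0" using fin_dim by blast
  obtain B where B: "B \<subseteq> P k" "independent B" "P k \<subseteq> span B"
    using maximal_independent_subset[of "P k"] by blast
  have fB: "finite B" using independent_span_bound[OF B0(1) B(2)] B(1) B0(2) by simp
  \<comment> \<open>The coordinate forms are cut off outside \<open>P k\<close>, as
    \<open>dual_of\<close> demands.\<close>
  define \<beta> where "\<beta> b q = (if q \<in> P k then representation B q b else 0)" for b q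
  have s: "x \<in> span B" if "x \<in> P k" for x using B(3) that by blast
  have "\<beta> b \<in> dual_of scale (P k)" for b
    unfolding dual_of_def \<beta>_def using subspace_add[OF subspace_P[of k]] subspace_scale[OF subspace_P[of k]]
    by (auto simp: representation_add[OF B(2) s s] representation_scale[OF B(2) s])
  moreover have "q = (\<Sum>b\<in>B. scale (\<beta> b q) b)" if "q \<in> P k" for q
    using sum_representation_eq[OF B(2) s[OF that] fB] that by (simp add: \<beta>_def)
  ultimately show ?thesis using that fB B(1) by blast
qed

definition homog :: "nat \<Rightarrow> ('a \<Rightarrow> 'k) \<Rightarrow> nat \<Rightarrow> 'a \<Rightarrow> 'k" where
  "homog k \<phi> n = (if n = k then \<phi> else (\<lambda>p. 0))"

lemma homog_closed: "k \<noteq> 0 \<Longrightarrow> \<phi> \<in> dual_of scale (P k) \<Longrightarrow> homog k \<phi> \<in> carrier DP"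
proof -
  assume "k \<noteq> 0" "\<phi> \<in> dual_of scale (P k)"
  moreover have "finite {n. homog k \<phi> n \<noteq> (\<lambda>p. 0)}"
    by (rule finite_subset[of _ "{k}"]) (auto simp: homog_def)
  ultimately show ?thesis by (auto simp: dual_operad_carrier homog_def dual_of_def)
qed

text \<open>\<open>h\<close> is linear only on the subspace \<open>P k\<close>, so membership in
  \<open>P k\<close> has to be carried along with the sum.\<close>

lemma linear_form_expand:
  assumes B: "finite B" "B \<subseteq> P k" and q: "q = (\<Sum>b\<in>B. scale (c b) b)"
    and add: "\<And>x y. x \<in> P k \<Longrightarrow> y \<in> P k \<Longrightarrow> h (x + y) = h x + h y"
    and sc: "\<And>c x. x \<in> P k \<Longrightarrow> h (scale c x) = c * (h x :: 'k)"
  shows "h q = (\<Sum>b\<in>B. c b * h b)"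
proof -
  have h0: "h 0 = 0" using sc[OF P_zero, of 0] by simp
  have "h (\<Sum>b\<in>B. scale (c b) b) = (\<Sum>b\<in>B. c b * h b) \<and> (\<Sum>b\<in>B. scale (c b) b) \<in> P k"
    using B
  proof (induction B)
    case (insert b B)
    then have "b \<in> P k" "scale (c b) b \<in> P k" using subspace_scale[OF subspace_P] by auto
    then show ?case using insert add sc subspace_add[OF subspace_P] by simp
  qed (use h0 P_zero in auto)
  then show ?thesis unfolding q by blast
qed

text \<open>A multilinear form on the product of the \<open>P k\<close> for \<open>k\<close> running
  through \<open>ks\<close>. Its arguments are words with explicit arities, and only words with
  arity list \<open>ks\<close> are constrained.\<close>

definition mlform :: "nat list \<Rightarrow> ((nat \<times> 'a) list \<Rightarrow> 'k) \<Rightarrow> bool" where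
  "mlform ks g \<longleftrightarrow> (\<forall>us\<in>L. \<forall>vs\<in>L. \<forall>k. map fst us @ k # map fst vs = ks \<longrightarrow>
     (\<forall>r\<in>P k. \<forall>r'\<in>P k. g (us @ (k, r + r') # vs) = g (us @ (k, r) # vs) + g (us @ (k, r') # vs)) \<and>
     (\<forall>c. \<forall>r\<in>P k. g (us @ (k, scale c r) # vs) = c * g (us @ (k, r) # vs)))"

lemma mlform_Cons: "mlform (k # ks) g \<Longrightarrow> b \<in> P k \<Longrightarrow> mlform ks (\<lambda>ws. g ((k, b) # ws))"
  unfolding mlform_def
proof (intro ballI allI impI)
  fix us vs l
  assume m: "\<forall>us\<in>L. \<forall>vs\<in>L. \<forall>l. map fst us @ l # map fst vs = k # ks \<longrightarrow>
     (\<forall>r\<in>P l. \<forall>r'\<in>P l. g (us @ (l, r + r') # vs) = g (us @ (l, r) # vs) + g (us @ (l, r') # vs)) \<and>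
     (\<forall>c. \<forall>r\<in>P l. g (us @ (l, scale c r) # vs) = c * g (us @ (l, r) # vs))"
    and b: "b \<in> P k" and uv: "us \<in> L" "vs \<in> L" "map fst us @ l # map fst vs = ks"
  have "(k, b) # us \<in> L" "map fst ((k, b) # us) @ l # map fst vs = k # ks" using b uv by auto
  from m[rule_format, OF this(1) uv(2) this(2)]
  show "(\<forall>r\<in>P l. \<forall>r'\<in>P l. g ((k, b) # us @ (l, r + r') # vs) = g ((k, b) # us @ (l, r) # vs) + g ((k, b) # us @ (l, r') # vs)) \<and>
     (\<forall>c. \<forall>r\<in>P l. g ((k, b) # us @ (l, scale c r) # vs) = c * g ((k, b) # us @ (l, r) # vs))"
    by simp
qed

lemma mlform_head:
  assumes "mlform (k # ks) g" "ws \<in> L" "map fst ws = ks"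
  shows "r \<in> P k \<Longrightarrow> r' \<in> P k \<Longrightarrow> g ((k, r + r') # ws) = g ((k, r) # ws) + g ((k, r') # ws)"
    and "r \<in> P k \<Longrightarrow> g ((k, scale c r) # ws) = c * g ((k, r) # ws)"
  using assms(1)[unfolded mlform_def, rule_format, of "[]" ws k] assms(2,3) by auto

text \<open>A dual basis peels off the first argument: \<open>g\<close> is the sum, over basis
  elements \<open>b\<close>, of the coordinate form of \<open>b\<close> times the form obtained by
  inserting \<open>b\<close>, which the induction represents. Arity 0 is excluded because
  \<open>DP\<close> vanishes there; \<open>homog\<close> produces the zero on words with another
  arity list.\<close>

lemma mlform_representable:
  assumes "mlform ks g" "0 \<notin> set ks"
  shows "\<exists>t\<in>carrier V.T. \<forall>ws\<in>L. word_eval ws t = (if map fst ws = ks then g ws else 0)"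
  using assms
proof (induction ks arbitrary: g)
  case Nil
  show ?case
  proof (intro bexI ballI)
    fix ws
    show "word_eval ws (g [] \<odot>\<^bsub>V.T\<^esub> \<one>\<^bsub>V.T\<^esub>) = (if map fst ws = [] then g ws else 0)"
      using lin_mapD(3)[OF word_eval_lin, of "\<one>\<^bsub>V.T\<^esub>"] by (auto simp: word_eval_one)
  qed auto
next
  case (Cons k ks)
  obtain B \<beta> where B: "finite B" "B \<subseteq> P k" "\<And>b. b \<in> B \<Longrightarrow> \<beta> b \<in> dual_of scale (P k)"
    "\<And>q. q \<in> P k \<Longrightarrow> q = (\<Sum>b\<in>B. scale (\<beta> b q) b)"
    using dual_basis[of k] by blast
  have "\<forall>b\<in>B. \<exists>t\<in>carrier V.T. \<forall>ws\<in>L. word_eval ws t = (if map fst ws = ks then g ((k, b) # ws) else 0)"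
    by (intro ballI Cons.IH mlform_Cons[OF Cons.prems(1)]) (use Cons.prems(2) B(2) in auto)
  then obtain t where t: "\<And>b. b \<in> B \<Longrightarrow> t b \<in> carrier V.T"
    "\<And>b ws. b \<in> B \<Longrightarrow> ws \<in> L \<Longrightarrow> word_eval ws (t b) = (if map fst ws = ks then g ((k, b) # ws) else 0)"
    by metis
  let ?v = "\<lambda>b. homog k (\<beta> b)"
  have v: "?v b \<in> carrier DP" if "b \<in> B" for b
    by (rule homog_closed) (use B that Cons.prems in auto)
  let ?x = "\<lambda>b. tensor_alg_inc DP (?v b) \<otimes>\<^bsub>V.T\<^esub> t b"
  have x: "?x \<in> B \<rightarrow> carrier V.T" using t(1) v lin_mapD(1)[OF V.inc_lin] by auto
  show ?case
  proof (intro bexI ballI)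
    show c: "(\<Oplus>\<^bsub>V.T\<^esub>b\<in>B. ?x b) \<in> carrier V.T" using x by (rule V.T.finsum_closed)
    fix ws assume ws: "ws \<in> L"
    have "word_eval ws (\<Oplus>\<^bsub>V.T\<^esub>b\<in>B. ?x b) = (\<Sum>b\<in>B. word_eval ws (?x b))"
      using lin_map_finsum[OF V.vT vsp_scalar word_eval_lin B(1) x] finsum_scalar[OF B(1)] by simp
    also have "\<dots> = (if map fst ws = k # ks then g ws else 0)"
    proof (cases ws)
      case Nil
      then show ?thesis using v t(1) by (simp add: word_eval_inc_mult)
    next
      case (Cons w us)
      obtain n q where w: "w = (n, q)" "q \<in> P n" "us \<in> L" using ws Cons by (cases w) auto
      have "(\<Sum>b\<in>B. word_eval ws (?x b)) = (\<Sum>b\<in>B. ?v b n q * word_eval us (t b))"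
        using v t(1) by (simp add: word_eval_inc_mult Cons w)
      also have "\<dots> = (if n = k \<and> map fst us = ks then \<Sum>b\<in>B. \<beta> b q * g ((k, b) # us) else 0)"
        using t(2)[OF _ w(3)] by (auto simp: homog_def)
      also have "\<dots> = (if map fst ws = k # ks then g ws else 0)"
        using linear_form_expand[OF B(1,2) B(4), of q "\<lambda>x. g ((k, x) # us)"] w(2,3)
          mlform_head[OF Cons.prems(1) w(3)] by (auto simp: Cons w(1))
      finally show ?thesis .
    qed
    finally show "word_eval ws (\<Oplus>\<^bsub>V.T\<^esub>b\<in>B. ?x b) = (if map fst ws = k # ks then g ws else 0)" .
  qed
qed

section \<open>The transpose of the operadic composition\<close>

lemma L_split: "us @ w # vs \<in> L \<longleftrightarrow> us \<in> L \<and> snd w \<in> P (fst w) \<and> vs \<in> L"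
  by (cases w) auto

lemma gamma_closed: "ws \<in> L \<Longrightarrow> q \<in> P (length ws) \<Longrightarrow> \<gamma> q ws \<in> P (arity ws)"
  by (rule comp_closed)

lemma gamma_add: "us \<in> L \<Longrightarrow> vs \<in> L \<Longrightarrow> r \<in> P k \<Longrightarrow> r' \<in> P k \<Longrightarrow> q \<in> P (length us + 1 + length vs) \<Longrightarrow>
  \<gamma> q (us @ (k, r + r') # vs) = \<gamma> q (us @ (k, r) # vs) + \<gamma> q (us @ (k, r') # vs)"
  using comp_add_right[of us vs r k r' q] by simp

lemma gamma_scale: "us \<in> L \<Longrightarrow> vs \<in> L \<Longrightarrow> r \<in> P k \<Longrightarrow> q \<in> P (length us + 1 + length vs) \<Longrightarrow>
  \<gamma> q (us @ (k, scale c r) # vs) = scale c (\<gamma> q (us @ (k, r) # vs))"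
  using comp_scale_right[of us vs r k q c] by simp

lemma mlform_gamma:
  assumes f: "f \<in> carrier DP" and q: "q \<in> P (length ks)"
  shows "mlform ks (\<lambda>ws. f (arity ws) (\<gamma> q ws))"
  unfolding mlform_def
proof (intro ballI allI impI conjI)
  fix us vs k
  assume uv: "us \<in> L" "vs \<in> L" "map fst us @ k # map fst vs = ks"
  have q': "q \<in> P (length us + 1 + length vs)" using q unfolding uv(3)[symmetric] by simp
  have c: "\<gamma> q (us @ (k, r) # vs) \<in> P (arity us + k + arity vs)" if "r \<in> P k" for r
    using gamma_closed[of "us @ (k, r) # vs" q] uv(1,2) that q' by (simp add: algebra_simps)
  show "f (arity (us @ (k, r + r') # vs)) (\<gamma> q (us @ (k, r + r') # vs)) =
      f (arity (us @ (k, r) # vs)) (\<gamma> q (us @ (k, r) # vs)) +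
      f (arity (us @ (k, r') # vs)) (\<gamma> q (us @ (k, r') # vs))" if "r \<in> P k" "r' \<in> P k" for r r'
    using DP_add[OF f c[OF that(1)] c[OF that(2)]] by (simp add: gamma_add[OF uv(1,2) that q'] add.assoc)
  show "f (arity (us @ (k, scale d r) # vs)) (\<gamma> q (us @ (k, scale d r) # vs)) =
      d * f (arity (us @ (k, r) # vs)) (\<gamma> q (us @ (k, r) # vs))" if "r \<in> P k" for r d
    using DP_scale[OF f c[OF that]] by (simp add: gamma_scale[OF uv(1,2) that q'] add.assoc)
qed

text \<open>A letter of arity 0 is zero, and composition is linear in each letter. Arity lists with
  a zero entry therefore contribute nothing to \<open>\<delta> f\<close>.\<close>

lemma gamma_zero_arity:
  assumes "ws \<in> L" "q \<in> P (length ws)" "0 \<in> set (map fst ws)"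
  shows "\<gamma> q ws = 0"
proof -
  obtain w where w: "w \<in> set ws" "fst w = 0" using assms(3) by auto
  obtain us vs where ws: "ws = us @ w # vs" using split_list[OF w(1)] by blast
  have s: "us \<in> L" "vs \<in> L" "snd w \<in> P 0" using assms(1) w(2) unfolding ws L_split by auto
  then have "w = (0, scale 0 0)" using w(2) P0 by (cases w) auto
  then show ?thesis using gamma_scale[OF s(1,2) P_zero, of q 0 0] assms(2) ws by simp
qed

text \<open>This is the summand of \<open>\<delta> f\<close> whose right factors have arities
  \<open>ks\<close>. A dual basis of \<open>P (length ks)\<close> yields the left factors, and the
  forms induced by composition with its elements are representable.\<close>

lemma delta_component:
  assumes f: "f \<in> carrier DP" and ks: "0 \<notin> set ks" "ks \<noteq> []"
  shows "\<exists>X\<in>carrier (tensor DP V.T). \<forall>n. \<forall>q\<in>P n. \<forall>ws\<in>L.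
    pairing n q ws X = (if n = length ks \<and> map fst ws = ks then f (arity ws) (\<gamma> q ws) else 0)"
proof -
  let ?n = "length ks"
  interpret VTm: Module.module scalar_alg "tensor DP V.T" by (rule VT.vsp_tensor)
  obtain B \<beta> where B: "finite B" "B \<subseteq> P ?n" "\<And>b. b \<in> B \<Longrightarrow> \<beta> b \<in> dual_of scale (P ?n)"
    "\<And>q. q \<in> P ?n \<Longrightarrow> q = (\<Sum>b\<in>B. scale (\<beta> b q) b)"
    using dual_basis[of ?n] by blast
  have "\<forall>b\<in>B. \<exists>t\<in>carrier V.T. \<forall>ws\<in>L. word_eval ws t = (if map fst ws = ks then f (arity ws) (\<gamma> b ws) else 0)"
    by (intro ballI mlform_representable[OF mlform_gamma[OF f] ks(1)]) (use B(2) in auto)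
  then obtain t where t: "\<And>b. b \<in> B \<Longrightarrow> t b \<in> carrier V.T"
    "\<And>b ws. b \<in> B \<Longrightarrow> ws \<in> L \<Longrightarrow> word_eval ws (t b) = (if map fst ws = ks then f (arity ws) (\<gamma> b ws) else 0)"
    by metis
  let ?v = "\<lambda>b. homog ?n (\<beta> b)"
  have v: "?v b \<in> carrier DP" if "b \<in> B" for b
    by (rule homog_closed) (use B that ks in auto)
  let ?x = "\<lambda>b. pure DP V.T (?v b) (t b)"
  have x: "?x \<in> B \<rightarrow> carrier (tensor DP V.T)" using t(1) v by auto
  show ?thesis
  proof (intro bexI ballI allI)
    show c: "(\<Oplus>\<^bsub>tensor DP V.T\<^esub>b\<in>B. ?x b) \<in> carrier (tensor DP V.T)" using x by (rule VTm.finsum_closed)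
    fix n q ws assume q: "q \<in> P n" and ws: "ws \<in> L"
    have "pairing n q ws (\<Oplus>\<^bsub>tensor DP V.T\<^esub>b\<in>B. ?x b) = (\<Sum>b\<in>B. pairing n q ws (?x b))"
      using lin_map_finsum[OF VT.vsp_tensor vsp_scalar pairing_lin B(1) x] finsum_scalar[OF B(1)] by simp
    also have "\<dots> = (\<Sum>b\<in>B. ?v b n q * word_eval ws (t b))"
      using v t(1) by (simp add: pairing_pure)
    also have "\<dots> = (if n = ?n \<and> map fst ws = ks then \<Sum>b\<in>B. \<beta> b q * f (arity ws) (\<gamma> b ws) else 0)"
      using t(2)[OF _ ws] by (auto simp: homog_def)
    also have "\<dots> = (if n = ?n \<and> map fst ws = ks then f (arity ws) (\<gamma> q ws) else 0)"
    proof (cases "n = ?n \<and> map fst ws = ks")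
      case True
      have l: "length ws = ?n" using True by (metis length_map)
      have c: "\<gamma> x ws \<in> P (arity ws)" if "x \<in> P ?n" for x using gamma_closed[OF ws] that l by simp
      show ?thesis
        using True q linear_form_expand[OF B(1,2) B(4), of q "\<lambda>x. f (arity ws) (\<gamma> x ws)"]
          comp_add_left[OF ws] comp_scale_left[OF ws] l DP_add[OF f c c] DP_scale[OF f c] by auto
    qed auto
    finally show "pairing n q ws (\<Oplus>\<^bsub>tensor DP V.T\<^esub>b\<in>B. ?x b) =
      (if n = ?n \<and> map fst ws = ks then f (arity ws) (\<gamma> q ws) else 0)" .
  qed
qed

lemma delta_exists:
  assumes f: "f \<in> carrier DP"
  shows "\<exists>X\<in>carrier (tensor DP V.T). \<forall>n. \<forall>q\<in>P n. \<forall>ws\<in>L.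
    pairing n q ws X = (if length ws = n then f (arity ws) (\<gamma> q ws) else 0)"
proof -
  interpret VTm: Module.module scalar_alg "tensor DP V.T" by (rule VT.vsp_tensor)
  \<comment> \<open>The arity lists that can contribute. Positive entries bound the length and each
    entry by the sum, which is at most \<open>N\<close>; the empty list drops out because
    \<open>f 0\<close> is zero.\<close>
  define D where "D = {ks. 0 \<notin> set ks \<and> f (sum_list ks) \<noteq> (\<lambda>p. 0)}"
  have f0: "f 0 = (\<lambda>p. 0)" and ff: "finite {n. f n \<noteq> (\<lambda>p. 0)}" using f by (auto simp: dual_operad_carrier)
  define N where "N = Max {n. f n \<noteq> (\<lambda>p. 0)}"
  have "D \<subseteq> {ks. set ks \<subseteq> {..N} \<and> length ks \<le> N}"
  proof
    fix ks assume ks: "ks \<in> D"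
    have N: "sum_list ks \<le> N" unfolding N_def using ks ff by (intro Max_ge) (auto simp: D_def)
    have "length ks \<le> sum_list ks" if "0 \<notin> set ks" for ks :: "nat list"
      using that by (induction ks) auto
    then have "length ks \<le> sum_list ks" using ks by (simp add: D_def)
    moreover have "\<forall>k\<in>set ks. k \<le> N" using member_le_sum_list N order_trans by blast
    ultimately show "ks \<in> {ks. set ks \<subseteq> {..N} \<and> length ks \<le> N}" using N by auto
  qed
  then have fD: "finite D" using finite_lists_length_le[of "{..N}" N] finite_subset by blast
  have "\<forall>ks\<in>D. \<exists>X\<in>carrier (tensor DP V.T). \<forall>n. \<forall>q\<in>P n. \<forall>ws\<in>L.
    pairing n q ws X = (if n = length ks \<and> map fst ws = ks then f (arity ws) (\<gamma> q ws) else 0)"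
  proof
    fix ks assume "ks \<in> D"
    then have "0 \<notin> set ks" "ks \<noteq> []" using f0 by (auto simp: D_def)
    then show "\<exists>X\<in>carrier (tensor DP V.T). \<forall>n. \<forall>q\<in>P n. \<forall>ws\<in>L.
      pairing n q ws X = (if n = length ks \<and> map fst ws = ks then f (arity ws) (\<gamma> q ws) else 0)"
      by (rule delta_component[OF f])
  qed
  then obtain X where X: "\<And>ks. ks \<in> D \<Longrightarrow> X ks \<in> carrier (tensor DP V.T)"
    "\<And>ks n q ws. ks \<in> D \<Longrightarrow> q \<in> P n \<Longrightarrow> ws \<in> L \<Longrightarrow>
       pairing n q ws (X ks) = (if n = length ks \<and> map fst ws = ks then f (arity ws) (\<gamma> q ws) else 0)"
    by metis
  have x: "X \<in> D \<rightarrow> carrier (tensor DP V.T)" using X(1) by auto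
  show ?thesis
  proof (intro bexI ballI allI)
    show c: "(\<Oplus>\<^bsub>tensor DP V.T\<^esub>ks\<in>D. X ks) \<in> carrier (tensor DP V.T)" using x by (rule VTm.finsum_closed)
    fix n q ws assume q: "q \<in> P n" and ws: "ws \<in> L"
    have "pairing n q ws (\<Oplus>\<^bsub>tensor DP V.T\<^esub>ks\<in>D. X ks) = (\<Sum>ks\<in>D. pairing n q ws (X ks))"
      using lin_map_finsum[OF VT.vsp_tensor vsp_scalar pairing_lin fD x] finsum_scalar[OF fD] by simp
    also have "\<dots> = (\<Sum>ks\<in>D. if ks = map fst ws then (if length ws = n then f (arity ws) (\<gamma> q ws) else 0) else 0)"
      using X(2)[OF _ q ws] by (intro sum.cong) auto
    also have "\<dots> = (if map fst ws \<in> D then (if length ws = n then f (arity ws) (\<gamma> q ws) else 0) else 0)"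
      using fD by simp
    \<comment> \<open>Outside \<open>D\<close> the right-hand side is zero too: either
      \<open>f\<close> vanishes in that arity, or a letter of arity 0 makes the composite
      zero.\<close>
    also have "\<dots> = (if length ws = n then f (arity ws) (\<gamma> q ws) else 0)"
      using gamma_zero_arity[OF ws, of q] q DP_zero[OF f] by (auto simp: D_def)
    finally show "pairing n q ws (\<Oplus>\<^bsub>tensor DP V.T\<^esub>ks\<in>D. X ks) =
      (if length ws = n then f (arity ws) (\<gamma> q ws) else 0)" .
  qed
qed

abbreviation "\<delta> \<equiv> delta scale P \<gamma>"

text \<open>Existence from \<open>delta_exists\<close> and uniqueness from
  \<open>pairing_separates\<close> discharge the definite description; later arguments rely on
  membership and pairing values instead.\<close>

lemma delta:
  assumes f: "f \<in> carrier DP"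
  shows delta_closed: "\<delta> f \<in> carrier (tensor DP V.T)"
    and delta_pairing: "q \<in> P n \<Longrightarrow> ws \<in> L \<Longrightarrow>
      pairing n q ws (\<delta> f) = (if length ws = n then f (arity ws) (\<gamma> q ws) else 0)"
proof -
  let ?Q = "\<lambda>X. X \<in> carrier (tensor DP V.T) \<and> (\<forall>n. \<forall>q\<in>P n. \<forall>ws\<in>L.
        pairing n q ws X = (if length ws = n then f (arity ws) (\<gamma> q ws) else 0))"
  obtain X where X: "?Q X" using delta_exists[OF f] by blast
  have "?Q (\<delta> f)" unfolding delta_def
  proof (rule theI[of ?Q, OF X])
    fix Y assume "?Q Y"
    then show "Y = X" using X by (intro pairing_separates) auto
  qed
  then show "\<delta> f \<in> carrier (tensor DP V.T)"
    and "q \<in> P n \<Longrightarrow> ws \<in> L \<Longrightarrow>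
      pairing n q ws (\<delta> f) = (if length ws = n then f (arity ws) (\<gamma> q ws) else 0)" by auto
qed

lemma delta_lin: "\<delta> \<in> lin_map DP (tensor DP V.T)"
proof -
  interpret VTm: Module.module scalar_alg "tensor DP V.T" by (rule VT.vsp_tensor)
  show ?thesis
  proof (rule lin_mapI[OF delta_closed])
    fix f g assume fg: "f \<in> carrier DP" "g \<in> carrier DP"
    have s: "f \<oplus>\<^bsub>DP\<^esub> g \<in> carrier DP" using fg by simp
    show "\<delta> (f \<oplus>\<^bsub>DP\<^esub> g) = \<delta> f \<oplus>\<^bsub>tensor DP V.T\<^esub> \<delta> g"
      by (rule pairing_separates)
        (use fg s in \<open>simp_all add: delta_closed delta_pairing lin_mapD(2)[OF pairing_lin] dual_operad_simps(2)\<close>)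
  next
    fix f c assume f: "f \<in> carrier DP"
    have s: "c \<odot>\<^bsub>DP\<^esub> f \<in> carrier DP" using f by simp
    show "\<delta> (c \<odot>\<^bsub>DP\<^esub> f) = c \<odot>\<^bsub>tensor DP V.T\<^esub> \<delta> f"
      by (rule pairing_separates)
        (use f s in \<open>simp_all add: delta_closed delta_pairing lin_mapD(3)[OF pairing_lin] dual_operad_simps(3)\<close>)
  qed
qed

end


text \<open>The composite of two words: a letter of arity \<open>k\<close> in the first word
  consumes the next \<open>k\<close> letters of the second. A second word that is too short is
  silently truncated by \<open>take\<close>, hence the length condition in the facts on arities and
  closure.\<close>

fun bcomp :: "('a \<Rightarrow> (nat \<times> 'a) list \<Rightarrow> 'a) \<Rightarrow> (nat \<times> 'a) list \<Rightarrow> (nat \<times> 'a) list \<Rightarrow> (nat \<times> 'a) list" where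
  "bcomp \<gamma> [] z = []"
| "bcomp \<gamma> (w # y) z =
     (sum_list (map fst (take (fst w) z)), \<gamma> (snd w) (take (fst w) z)) # bcomp \<gamma> y (drop (fst w) z)"

text \<open>The cutting performed by \<open>bcomp\<close>, isolated so that it can serve as
  \<open>uss\<close> in the associativity axiom.\<close>

fun blocks :: "(nat \<times> 'a) list \<Rightarrow> (nat \<times> 'a) list \<Rightarrow> (nat \<times> 'a) list list" where
  "blocks [] z = []"
| "blocks (w # y) z = take (fst w) z # blocks y (drop (fst w) z)"

lemma length_bcomp [simp]: "length (bcomp \<gamma> y z) = length y"
  by (induction y arbitrary: z) auto

lemma bcomp_blocks:
  "bcomp \<gamma> y z = map2 (\<lambda>(k, r) us. (sum_list (map fst us), \<gamma> r us)) y (blocks y z)"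
  by (induction y arbitrary: z) (auto simp: case_prod_unfold)

lemma concat_blocks: "length z = sum_list (map fst y) \<Longrightarrow> concat (blocks y z) = z"
  by (induction y arbitrary: z) auto

lemma length_blocks: "length z = sum_list (map fst y) \<Longrightarrow> map length (blocks y z) = map fst y"
  by (induction y arbitrary: z) auto

lemma set_blocks: "z \<in> lists X \<Longrightarrow> blocks y z \<in> lists (lists X)"
  by (induction y arbitrary: z) (auto dest: in_set_takeD in_set_dropD)

lemma arity_bcomp:
  "length z = sum_list (map fst y) \<Longrightarrow> sum_list (map fst (bcomp \<gamma> y z)) = sum_list (map fst z)"
proof (induction y arbitrary: z)
  case (Cons w y)
  have "sum_list (map fst z) = sum_list (map fst (take (fst w) z @ drop (fst w) z))" by simp
  then show ?case using Cons by (simp del: append_take_drop_id)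
qed simp

lemma bcomp_append:
  "length z1 = sum_list (map fst y1) \<Longrightarrow> bcomp \<gamma> (y1 @ y2) (z1 @ z2) = bcomp \<gamma> y1 z1 @ bcomp \<gamma> y2 z2"
  by (induction y1 arbitrary: z1) auto

section \<open>The coproduct as the dual of composition of words\<close>

context operad_fd
begin

abbreviation "TT \<equiv> tensor V.T V.T"
abbreviation "inc \<equiv> tensor_alg_inc DP"
abbreviation "\<Delta> \<equiv> Delta_star scale P \<gamma>"
abbreviation "\<iota> \<equiv> tensor_map V.T V.T inc (\<lambda>t. t)"
abbreviation "cmp \<equiv> bcomp \<gamma>"

lemma inc_closed [simp, intro]: "v \<in> carrier DP \<Longrightarrow> inc v \<in> carrier V.T"
  by (rule lin_mapD(1)[OF V.inc_lin])

lemmas \<iota>_lin = tensor_map_lin(1)[OF vsp_dual_operad V.vT V.vT V.vT V.inc_lin lin_map_id]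
lemmas \<iota>_pure = tensor_map_lin(2)[OF vsp_dual_operad V.vT V.vT V.vT V.inc_lin lin_map_id]

lemma Delta_hom: "\<Delta> \<in> alg_hom V.T TT"
  and Delta_inc: "f \<in> carrier DP \<Longrightarrow> \<Delta> (inc f) = \<iota> (\<delta> f)"
  unfolding Delta_star_def Let_def
  using V.tensor_alg_lift[OF TT.kalg_tensor lin_map_comp[OF delta_lin \<iota>_lin]] by auto

abbreviation "ev2 y z \<equiv> ften (word_eval y) (word_eval z)"

lemmas ev2_lin = TT.ften_lin(1)[OF word_eval_lin word_eval_lin]
lemmas ev2_pure = TT.ften_lin(2)[OF word_eval_lin word_eval_lin]

text \<open>The left factor of \<open>\<iota> X\<close> has degree one, so it meets exactly the
  first letter of \<open>y\<close>; the right factors are multiplied, so \<open>z\<close> is cut at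
  every place.\<close>

lemma ev2_iota_mult:
  assumes X: "X \<in> carrier (tensor DP V.T)" and Y: "Y \<in> carrier TT"
  shows "ev2 y z (\<iota> X \<otimes>\<^bsub>TT\<^esub> Y) = (case y of [] \<Rightarrow> 0 | (k, q) # y' \<Rightarrow>
    \<Sum>i\<le>length z. pairing k q (take i z) X * ev2 y' (drop i z) Y)"
proof -
  let ?r = "\<lambda>X Y. case y of [] \<Rightarrow> 0 | (k, q) # y' \<Rightarrow>
    \<Sum>i\<le>length z. pairing k q (take i z) X * ev2 y' (drop i z) Y"
  have r: "?r X \<in> lin_map TT scalar_alg" if "X \<in> carrier (tensor DP V.T)" for X
    by (cases y) (auto intro!: lin_mapI
        simp: lin_mapD(2,3)[OF ev2_lin] algebra_simps sum.distrib sum_distrib_left)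
  have r': "(\<lambda>X. ?r X Y) \<in> lin_map (tensor DP V.T) scalar_alg" if "Y \<in> carrier TT" for Y
    by (cases y) (auto intro!: lin_mapI
        simp: lin_mapD(2,3)[OF pairing_lin] algebra_simps sum.distrib sum_distrib_left)
  have b: "bilin (tensor DP V.T) TT scalar_alg (\<lambda>X Y. ev2 y z (\<iota> X \<otimes>\<^bsub>TT\<^esub> Y))"
    by (rule bilin_comp[OF bilin_mult[OF TT.kalg_tensor] \<iota>_lin lin_map_id ev2_lin])
  have pp: "ev2 y z (\<iota> (pure DP V.T v t) \<otimes>\<^bsub>TT\<^esub> pure V.T V.T s u) = ?r (pure DP V.T v t) (pure V.T V.T s u)"
    if c: "v \<in> carrier DP" "t \<in> carrier V.T" "s \<in> carrier V.T" "u \<in> carrier V.T" for v t s u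
  proof -
    have "ev2 y z (\<iota> (pure DP V.T v t) \<otimes>\<^bsub>TT\<^esub> pure V.T V.T s u) =
        word_eval y (inc v \<otimes>\<^bsub>V.T\<^esub> s) * word_eval z (t \<otimes>\<^bsub>V.T\<^esub> u)"
      using c by (simp add: \<iota>_pure TT.pure_mult ev2_pure)
    also have "\<dots> = ?r (pure DP V.T v t) (pure V.T V.T s u)"
      unfolding word_eval_inc_mult[OF c(1,3)] word_eval_mult[OF c(2,4)] using c
      by (cases y) (auto simp: pairing_pure ev2_pure sum_distrib_left algebra_simps)
    finally show ?thesis .
  qed
  have "ev2 y z (\<iota> (pure DP V.T v t) \<otimes>\<^bsub>TT\<^esub> Y) = ?r (pure DP V.T v t) Y"
    if c: "v \<in> carrier DP" "t \<in> carrier V.T" for v t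
    by (rule TT.lin_map_tensor_eq[OF vsp_scalar bilinD(1)[OF b] r pp Y]) (use c in auto)
  then show ?thesis
    using VT.lin_map_tensor_eq[OF vsp_scalar bilinD(2)[OF b Y] r'[OF Y] _ X] by blast
qed

lemma cmp_closed:
  assumes "y \<in> L" "z \<in> L" "length z = arity y"
  shows "cmp y z \<in> L"
  using assms
proof (induction y arbitrary: z rule: list.induct)
  case (Cons w y)
  have "take (fst w) z \<in> L" "drop (fst w) z \<in> L" using Cons.prems(2) by (auto dest: in_set_takeD in_set_dropD)
  then show ?case using Cons gamma_closed[of "take (fst w) z" "snd w"] by auto
qed simp

text \<open>\<open>\<delta> v\<close> pairs with an operation of arity \<open>k\<close> only on
  words of length \<open>k\<close>, so of all cuts of \<open>z\<close> only the one after
  \<open>k\<close> letters survives. This is the recursion defining \<open>cmp\<close>.\<close>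

lemma ev2_Delta:
  assumes t: "t \<in> carrier V.T" and y: "y \<in> L" and z: "z \<in> L"
  shows "ev2 y z (\<Delta> t) = (if length z = arity y then word_eval (cmp y z) t else 0)"
proof -
  let ?r = "\<lambda>y z t. if length z = arity y then word_eval (cmp y z) t else 0"
  have r: "?r y z \<in> lin_map V.T scalar_alg"
    using word_eval_lin by (cases "length z = arity y") (auto intro!: lin_mapI)
  show ?thesis
  proof (rule V.lin_map_T_eq[OF vsp_scalar lin_map_comp[OF alg_hom_lin[OF Delta_hom] ev2_lin] r _ t])
    fix vs assume "vs \<in> lists (carrier DP)"
    then show "ev2 y z (\<Delta> (V.word vs)) = ?r y z (V.word vs)"
      using y z
    proof (induction vs arbitrary: y z rule: list.induct)
      case Nil
      have "ev2 y z (\<Delta> (V.word [])) = word_eval y \<one>\<^bsub>V.T\<^esub> * word_eval z \<one>\<^bsub>V.T\<^esub>"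
        by (simp add: V.word_Nil alg_homD(4)[OF Delta_hom] TT.pure_one ev2_pure)
      also have "\<dots> = ?r y z \<one>\<^bsub>V.T\<^esub>" by (cases y) (auto simp: word_eval_one)
      finally show ?case by (simp add: V.word_Nil)
    next
      case (Cons v vs)
      have v: "v \<in> carrier DP" "vs \<in> lists (carrier DP)" using Cons.prems by auto
      let ?Y = "\<Delta> (V.word vs)"
      have Y: "?Y \<in> carrier TT" using v alg_homD(1)[OF Delta_hom] by auto
      have eq: "\<Delta> (V.word (v # vs)) = \<iota> (\<delta> v) \<otimes>\<^bsub>TT\<^esub> ?Y"
        using v by (simp add: V.word_Cons alg_homD(3)[OF Delta_hom] Delta_inc)
      show ?case
      proof (cases y)
        case Nil
        then show ?thesis
          unfolding eq ev2_iota_mult[OF delta_closed[OF v(1)] Y] using v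
          by (simp add: V.word_Cons word_eval_inc_mult)
      next
        case (Cons w y')
        obtain k q where w: "w = (k, q)" by (cases w)
        have q: "q \<in> P k" "y' \<in> L" using \<open>y \<in> L\<close> Cons w by auto
        have td: "take i z \<in> L" "drop i z \<in> L" for i using \<open>z \<in> L\<close> by (auto dest: in_set_takeD in_set_dropD)
        have "ev2 y z (\<Delta> (V.word (v # vs))) =
            (\<Sum>i\<le>length z. pairing k q (take i z) (\<delta> v) * ev2 y' (drop i z) ?Y)"
          unfolding eq by (simp add: ev2_iota_mult[OF delta_closed[OF v(1)] Y] Cons w)
        also have "\<dots> = (\<Sum>i\<le>length z. if i = k then v (arity (take k z)) (\<gamma> q (take k z)) * ev2 y' (drop k z) ?Y else 0)"
          by (rule sum.cong) (auto simp: delta_pairing[OF v(1) q(1) td(1)])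
        also have "\<dots> = (if k \<le> length z then v (arity (take k z)) (\<gamma> q (take k z)) * ev2 y' (drop k z) ?Y else 0)"
          by simp
        also have "\<dots> = ?r y z (V.word (v # vs))"
        proof (cases "k \<le> length z")
          case True
          have "ev2 y' (drop k z) ?Y = ?r y' (drop k z) (V.word vs)"
            using Cons.IH[OF v(2) q(2) td(2)] .
          then show ?thesis using True v by (auto simp: Cons w V.word_Cons word_eval_inc_mult)
        qed (auto simp: Cons w)
        finally show ?thesis .
      qed
    qed
  qed
qed

text \<open>For each letter of \<open>x\<close> this is the axiom \<open>comp_assoc\<close>. The
  point is that cutting \<open>y\<close> after \<open>k\<close> letters and \<open>z\<close> after
  the total arity of those letters matches the cut of \<open>cmp y z\<close> after \<open>k\<close>
  letters.\<close>

lemma cmp_assoc: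
  assumes "x \<in> L" "y \<in> L" "z \<in> L" "length y = arity x" "length z = arity y"
  shows "cmp (cmp x y) z = cmp x (cmp y z)"
  using assms
proof (induction x arbitrary: y z rule: list.induct)
  case (Cons w x)
  obtain k q where w: "w = (k, q)" "q \<in> P k" "x \<in> L" using Cons.prems(1) by (cases w) auto
  let ?k = "arity (take k y)"
  have ky: "k \<le> length y" using Cons.prems(4) w by simp
  have "arity y = arity (take k y @ drop k y)" by simp
  then have ay: "arity y = ?k + arity (drop k y)" by (simp del: append_take_drop_id)
  have lt: "length (take ?k z) = ?k" "length (drop ?k z) = arity (drop k y)"
    using ay Cons.prems(5) by auto
  have tdL: "take k y \<in> L" "drop k y \<in> L" "take ?k z \<in> L" "drop ?k z \<in> L"
    using Cons.prems by (auto dest: in_set_takeD in_set_dropD)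
  have app: "cmp y z = cmp (take k y) (take ?k z) @ cmp (drop k y) (drop ?k z)"
    using bcomp_append[of "take ?k z" "take k y" \<gamma> "drop k y" "drop ?k z"] lt by simp
  then have tk: "take k (cmp y z) = cmp (take k y) (take ?k z)" "drop k (cmp y z) = cmp (drop k y) (drop ?k z)"
    using ky by auto
  have "\<gamma> (\<gamma> q (take k y)) (take ?k z) = \<gamma> q (cmp (take k y) (take ?k z))"
    using comp_assoc[OF tdL(1), of q "blocks (take k y) (take ?k z)"] w(2) ky
      set_blocks[OF tdL(3)] length_blocks[OF lt(1)] concat_blocks[OF lt(1)]
    by (simp add: bcomp_blocks)
  moreover have "arity (cmp (take k y) (take ?k z)) = arity (take ?k z)"
    by (rule arity_bcomp[OF lt(1)])
  moreover have "cmp (cmp x (drop k y)) (drop ?k z) = cmp x (cmp (drop k y) (drop ?k z))"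
    using Cons.IH[OF w(3) tdL(2,4) _ lt(2)] Cons.prems(4) w(1) by simp
  ultimately show ?case by (simp add: w(1) tk)
qed simp

section \<open>Coassociativity\<close>

abbreviation "assocT \<equiv> tensor_assoc V.T V.T V.T"
abbreviation "TTT \<equiv> tensor V.T TT"

text \<open>On forms the associator merely rebrackets. \<open>W\<close> is arbitrary because it will
  be a value of \<open>\<Delta>\<close>, which is not a pure tensor in general.\<close>

lemma assoc_ften:
  assumes W: "W \<in> carrier TT" and t: "t \<in> carrier V.T"
    and lin: "\<phi> \<in> lin_map V.T scalar_alg" "\<psi> \<in> lin_map V.T scalar_alg" "\<chi> \<in> lin_map V.T scalar_alg"
  shows "ften \<phi> (ften \<psi> \<chi>) (assocT (pure TT V.T W t)) = ften \<phi> \<psi> W * \<chi> t"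
proof -
  interpret T_TT: tens V.T TT by (intro tens.intro V.vT TT.vsp_tensor)
  interpret TT_T: tens TT V.T by (intro tens.intro V.vT TT.vsp_tensor)
  note F = TT.ften_lin[OF lin(2,3)]
  note G = T_TT.ften_lin[OF lin(1) F(1)]
  note H = TT.ften_lin[OF lin(1,2)]
  note A = tensor_assoc_lin[OF V.vT V.vT V.vT]
  show ?thesis
  proof (rule TT.lin_map_tensor_eq[OF vsp_scalar _ _ _ W])
    show "(\<lambda>W. ften \<phi> (ften \<psi> \<chi>) (assocT (pure TT V.T W t))) \<in> lin_map TT scalar_alg"
      by (rule lin_map_comp[OF lin_map_comp[OF bilinD(2)[OF TT_T.bilin_pure t] A(1)] G(1)])
    show "(\<lambda>W. ften \<phi> \<psi> W * \<chi> t) \<in> lin_map TT scalar_alg"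
      using lin_map_smult[OF vsp_scalar H(1), of "\<chi> t"] by (simp add: mult.commute)
    show "ften \<phi> (ften \<psi> \<chi>) (assocT (pure TT V.T (pure V.T V.T a b) t)) = ften \<phi> \<psi> (pure V.T V.T a b) * \<chi> t"
      if "a \<in> carrier V.T" "b \<in> carrier V.T" for a b
      using that t by (simp add: A(2) G(2) F(2) H(2) TT.pure_closed)
  qed
qed

text \<open>The two sides come with different length conditions: one compares \<open>z\<close> with
  the arity of \<open>cmp x y\<close>, the other \<open>cmp y z\<close> with the arity of
  \<open>x\<close>. They amount to the same pair of equations, because a composite has the length of
  its outer word and the total arity of its inner word.\<close>

lemma Delta_coassoc:
  assumes t: "t \<in> carrier V.T"
  shows "assocT (tensor_map TT V.T \<Delta> (\<lambda>y. y) (\<Delta> t)) = tensor_map V.T TT (\<lambda>y. y) \<Delta> (\<Delta> t)"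
proof -
  interpret T_TT: tens V.T TT by (intro tens.intro V.vT TT.vsp_tensor)
  note D = alg_hom_lin[OF Delta_hom]
  note M1 = tensor_map_lin[OF V.vT V.vT TT.vsp_tensor V.vT D lin_map_id]
  note M2 = tensor_map_lin[OF V.vT V.vT V.vT TT.vsp_tensor lin_map_id D]
  note A = tensor_assoc_lin[OF V.vT V.vT V.vT]
  have Dt: "\<Delta> t \<in> carrier TT" using lin_mapD(1)[OF D t] .
  show ?thesis
  proof (rule separates_eq[OF T_TT.vsp_tensor T_TT.separates_tensor[OF separates_word_eval
          TT.separates_tensor[OF separates_word_eval separates_word_eval]]])
    show "assocT (tensor_map TT V.T \<Delta> (\<lambda>y. y) (\<Delta> t)) \<in> carrier TTT"
      using Dt lin_mapD(1)[OF A(1)] lin_mapD(1)[OF M1(1)] by blast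
    show "tensor_map V.T TT (\<lambda>y. y) \<Delta> (\<Delta> t) \<in> carrier TTT"
      using Dt lin_mapD(1)[OF M2(1)] by blast
    fix \<phi> assume "\<phi> \<in> {ften \<phi> \<psi> |\<phi> \<psi>. \<phi> \<in> WE ` L \<and>
        \<psi> \<in> {ften \<phi> \<psi> |\<phi> \<psi>. \<phi> \<in> WE ` L \<and> \<psi> \<in> WE ` L}}"
    then obtain x y z where xyz: "x \<in> L" "y \<in> L" "z \<in> L" and \<phi>: "\<phi> = ften (word_eval x) (ev2 y z)" by auto
    note F = TT.ften_lin[OF word_eval_lin[of y] word_eval_lin[of z]]
    note G = T_TT.ften_lin[OF word_eval_lin[of x] F(1), folded \<phi>]
    have 1: "\<phi> (assocT (tensor_map TT V.T \<Delta> (\<lambda>y. y) U)) = (if length y = arity x then ev2 (cmp x y) z U else 0)"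
      if U: "U \<in> carrier TT" for U
    proof (rule TT.lin_map_tensor_eq[OF vsp_scalar lin_map_comp[OF lin_map_comp[OF M1(1) A(1)] G(1)] _ _ U])
      show "(\<lambda>U. if length y = arity x then ev2 (cmp x y) z U else 0) \<in> lin_map TT scalar_alg"
        using ev2_lin lin_map_const_zero[OF vsp_scalar, of TT] by (cases "length y = arity x") auto
      fix a b assume "a \<in> carrier V.T" "b \<in> carrier V.T"
      then show "\<phi> (assocT (tensor_map TT V.T \<Delta> (\<lambda>y. y) (pure V.T V.T a b))) =
        (if length y = arity x then ev2 (cmp x y) z (pure V.T V.T a b) else 0)"
        using lin_mapD(1)[OF D] xyz
        by (simp add: M1(2) \<phi> assoc_ften[OF _ _ word_eval_lin word_eval_lin word_eval_lin] ev2_Delta ev2_pure)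
    qed
    have 2: "\<phi> (tensor_map V.T TT (\<lambda>y. y) \<Delta> U) = (if length z = arity y then ev2 x (cmp y z) U else 0)"
      if U: "U \<in> carrier TT" for U
    proof (rule TT.lin_map_tensor_eq[OF vsp_scalar lin_map_comp[OF M2(1) G(1)] _ _ U])
      show "(\<lambda>U. if length z = arity y then ev2 x (cmp y z) U else 0) \<in> lin_map TT scalar_alg"
        using ev2_lin lin_map_const_zero[OF vsp_scalar, of TT] by (cases "length z = arity y") auto
      fix a b assume "a \<in> carrier V.T" "b \<in> carrier V.T"
      then show "\<phi> (tensor_map V.T TT (\<lambda>y. y) \<Delta> (pure V.T V.T a b)) =
        (if length z = arity y then ev2 x (cmp y z) (pure V.T V.T a b) else 0)"
        using lin_mapD(1)[OF D] xyz by (simp add: M2(2) G(2) ev2_Delta ev2_pure)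
    qed
    have "\<phi> (assocT (tensor_map TT V.T \<Delta> (\<lambda>y. y) (\<Delta> t))) =
      (if length y = arity x \<and> length z = arity y then word_eval (cmp (cmp x y) z) t else 0)"
      using ev2_Delta[OF t cmp_closed xyz(3), of x y] xyz arity_bcomp[of y x \<gamma>] by (simp add: 1[OF Dt])
    also have "\<dots> = (if length y = arity x \<and> length z = arity y then word_eval (cmp x (cmp y z)) t else 0)"
      using cmp_assoc[OF xyz] by simp
    also have "\<dots> = \<phi> (tensor_map V.T TT (\<lambda>y. y) \<Delta> (\<Delta> t))"
      using ev2_Delta[OF t xyz(1) cmp_closed, of y z] xyz by (simp add: 2[OF Dt])
    finally show "\<phi> (assocT (tensor_map TT V.T \<Delta> (\<lambda>y. y) (\<Delta> t))) = \<phi> (tensor_map V.T TT (\<lambda>y. y) \<Delta> (\<Delta> t))" .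
  qed
qed

section \<open>The counit\<close>

definition eps :: "((nat \<Rightarrow> 'a \<Rightarrow> 'k) list \<Rightarrow>\<^sub>0 'k) set \<Rightarrow> 'k" where
  "eps = tensor_alg_lift scalar_alg (ev (1, e))"

lemma eps_hom: "eps \<in> alg_hom V.T scalar_alg"
  and eps_inc: "f \<in> carrier DP \<Longrightarrow> eps (inc f) = ev (1, e) f"
  unfolding eps_def using V.tensor_alg_lift[OF kalg_scalar ev_lin[of "(1, e)"]] by auto

text \<open>The counit is the sum of the evaluations on all words \<open>e...e\<close>. For a given
  \<open>t\<close> only finitely many of them are nonzero, so the infinite sum is expressed by
  partial sums that are eventually constant; thresholds of summands combine by
  \<open>max\<close>.\<close>

lemma eps_sum:
  assumes "t \<in> carrier V.T"
  shows "\<exists>M. \<forall>N\<ge>M. eps t = (\<Sum>m\<le>N. word_eval (replicate m (1, e)) t)"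
  using assms
proof (induction t rule: V.T_induct)
  case zero
  show ?case
    using lin_map_zero[OF V.vT vsp_scalar word_eval_lin] lin_map_zero[OF V.vT vsp_scalar alg_hom_lin[OF eps_hom]] by simp
next
  case (scaled vs c)
  have "eps (V.word vs) = word_eval (replicate (length vs) (1, e)) (V.word vs) \<and>
    (\<forall>m. m \<noteq> length vs \<longrightarrow> word_eval (replicate m (1, e)) (V.word vs) = 0)"
    using scaled
  proof (induction vs rule: list.induct)
    case Nil
    show ?case using alg_homD(4)[OF eps_hom] by (auto simp: V.word_Nil word_eval_one)
  next
    case (Cons v vs)
    have r: "word_eval (replicate m (1, e)) (inc v \<otimes>\<^bsub>V.T\<^esub> V.word vs) =
      (case m of 0 \<Rightarrow> 0 | Suc m \<Rightarrow> v 1 e * word_eval (replicate m (1, e)) (V.word vs))" for m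
    proof -
      have "v \<in> carrier DP" "V.word vs \<in> carrier V.T" using Cons.prems by auto
      from word_eval_inc_mult[OF this, of "replicate m (1, e)"] show ?thesis
        by (simp del: One_nat_def split: nat.splits)
    qed
    show ?case using Cons
      by (auto simp: V.word_Cons r alg_homD(3)[OF eps_hom] eps_inc ev_Pair simp del: One_nat_def replicate_Suc split: nat.splits)
  qed
  then have w: "eps (V.word vs) = word_eval (replicate (length vs) (1, e)) (V.word vs)"
    "\<And>m. m \<noteq> length vs \<Longrightarrow> word_eval (replicate m (1, e)) (V.word vs) = 0" by auto
  show ?case
  proof (intro exI allI impI)
    fix N assume N: "length vs \<le> N"
    have "(\<Sum>m\<le>N. word_eval (replicate m (1, e)) (V.word vs)) =
        (\<Sum>m\<in>{length vs}. word_eval (replicate m (1, e)) (V.word vs))"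
      by (rule sum.mono_neutral_right) (use N w(2) in auto)
    then show "eps (c \<odot>\<^bsub>V.T\<^esub> V.word vs) = (\<Sum>m\<le>N. word_eval (replicate m (1, e)) (c \<odot>\<^bsub>V.T\<^esub> V.word vs))"
      using scaled w(1) V.word_closed[OF scaled]
      by (simp add: alg_homD(5)[OF eps_hom] lin_mapD(3)[OF word_eval_lin] sum_distrib_left[symmetric])
  qed
next
  case (add s t)
  then obtain M M' where M: "\<And>N. N \<ge> M \<Longrightarrow> eps s = (\<Sum>m\<le>N. word_eval (replicate m (1, e)) s)"
    "\<And>N. N \<ge> M' \<Longrightarrow> eps t = (\<Sum>m\<le>N. word_eval (replicate m (1, e)) t)" by blast
  show ?case
  proof (intro exI allI impI)
    fix N assume "max M M' \<le> N"
    then show "eps (s \<oplus>\<^bsub>V.T\<^esub> t) = (\<Sum>m\<le>N. word_eval (replicate m (1, e)) (s \<oplus>\<^bsub>V.T\<^esub> t))"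
      using add(1,2) M(1)[of N] M(2)[of N]
      by (simp add: alg_homD(2)[OF eps_hom] lin_mapD(2)[OF word_eval_lin] sum.distrib)
  qed
qed

text \<open>Carries \<open>eps_sum\<close> to the right tensor factor, so that
  \<open>delta_pairing\<close> can be applied to words of units.\<close>

lemma pairing_eps_sum:
  assumes "X \<in> carrier (tensor DP V.T)"
  shows "\<exists>M. \<forall>N\<ge>M. ften (ev (n, q)) eps X = (\<Sum>m\<le>N. pairing n q (replicate m (1, e)) X)"
  using assms
proof (induction X rule: VT.tensor_induct)
  case zero
  show ?case
    using lin_map_zero[OF VT.vsp_tensor vsp_scalar pairing_lin]
      lin_map_zero[OF VT.vsp_tensor vsp_scalar VT.ften_lin(1)[OF ev_lin alg_hom_lin[OF eps_hom]]] by simp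
next
  case (pure v t)
  obtain M where "\<forall>N\<ge>M. eps t = (\<Sum>m\<le>N. word_eval (replicate m (1, e)) t)" using eps_sum[OF pure(2)] ..
  then have "\<forall>N\<ge>M. ften (ev (n, q)) eps (pure DP V.T v t) = (\<Sum>m\<le>N. pairing n q (replicate m (1, e)) (pure DP V.T v t))"
    using pure by (simp add: ev_Pair pairing_pure VT.ften_lin(2)[OF ev_lin alg_hom_lin[OF eps_hom]] sum_distrib_left)
  then show ?case ..
next
  case (add s t)
  then obtain M M' where M:
    "\<And>N. N \<ge> M \<Longrightarrow> ften (ev (n, q)) eps s = (\<Sum>m\<le>N. pairing n q (replicate m (1, e)) s)"
    "\<And>N. N \<ge> M' \<Longrightarrow> ften (ev (n, q)) eps t = (\<Sum>m\<le>N. pairing n q (replicate m (1, e)) t)" by blast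
  show ?case
  proof (intro exI allI impI)
    fix N assume "max M M' \<le> N"
    then show "ften (ev (n, q)) eps (s \<oplus>\<^bsub>tensor DP V.T\<^esub> t) =
        (\<Sum>m\<le>N. pairing n q (replicate m (1, e)) (s \<oplus>\<^bsub>tensor DP V.T\<^esub> t))"
      using add(1,2) M(1)[of N] M(2)[of N]
      by (simp add: lin_mapD(2)[OF pairing_lin]
        lin_mapD(2)[OF VT.ften_lin(1)[OF ev_lin alg_hom_lin[OF eps_hom]]] sum.distrib)
  qed
qed

lemma unit_word: "replicate m (1, e) \<in> L"
  using unit_closed by (auto simp: in_lists_conv_set)

lemmas counit_left_lift = VT.tensor_lift[OF V.vT bilin_smult[OF vsp_dual_operad V.vT ev_lin[of "(1, e)"]]]

text \<open>Evaluated on \<open>ws\<close>, the left side is the pairing of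
  \<open>\<delta> f\<close> with \<open>e\<close> and \<open>ws\<close>. It vanishes unless
  \<open>ws\<close> has a single letter, and then \<open>unit_left\<close> returns this
  letter.\<close>

lemma delta_counit_left:
  assumes f: "f \<in> carrier DP"
  shows "lin_lift V.T (\<lambda>(v, t). ev (1, e) v \<odot>\<^bsub>V.T\<^esub> t) (\<delta> f) = inc f"
proof (rule separates_eq[OF V.vT separates_word_eval])
  let ?l = "lin_lift V.T (\<lambda>(v, t). ev (1, e) v \<odot>\<^bsub>V.T\<^esub> t)"
  show "?l (\<delta> f) \<in> carrier V.T"
    using lin_mapD(1)[OF counit_left_lift(1)] delta_closed[OF f] by blast
  fix \<phi> assume "\<phi> \<in> WE ` L"
  then obtain ws where ws: "ws \<in> L" "\<phi> = word_eval ws" by blast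
  have "word_eval ws (?l X) = pairing 1 e ws X" if X: "X \<in> carrier (tensor DP V.T)" for X
    by (rule VT.lin_map_tensor_eq[OF vsp_scalar lin_map_comp[OF counit_left_lift(1) word_eval_lin] pairing_lin _ X])
      (simp add: counit_left_lift(2) pairing_pure lin_mapD(3)[OF word_eval_lin] ev_Pair[symmetric] del: One_nat_def)
  then have "word_eval ws (?l (\<delta> f)) = (if length ws = 1 then f (arity ws) (\<gamma> e ws) else 0)"
    using delta_pairing[OF f unit_closed ws(1)] delta_closed[OF f] by simp
  also have "\<dots> = word_eval ws (inc f)"
  proof (cases ws)
    case (Cons w us)
    then show ?thesis using ws(1) unit_left f V.wev_inc[OF map_ev f, of ws]
      by (cases w; cases us) (auto simp: word_eval_eq ev_Pair)
  qed (use V.wev_inc[OF map_ev f, of ws] in \<open>simp add: word_eval_eq\<close>)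
  finally show "\<phi> (?l (\<delta> f)) = \<phi> (inc f)" using ws(2) by simp
qed (use f in auto)

lemmas counit_right_lift = VT.tensor_lift[OF vsp_dual_operad
    bilin_swap[OF bilin_smult[OF V.vT vsp_dual_operad alg_hom_lin[OF eps_hom]]]]

text \<open>Applying \<open>eps\<close> to the right factor leaves an element of \<open>DP\<close>,
  which is tested on operations \<open>q\<close>. Among the words of units only the one of length
  \<open>n\<close> pairs with \<open>q\<close>, and \<open>unit_right\<close> returns
  \<open>q\<close>.\<close>

lemma delta_counit_right:
  assumes f: "f \<in> carrier DP"
  shows "lin_lift DP (\<lambda>(v, t). eps t \<odot>\<^bsub>DP\<^esub> v) (\<delta> f) = f"
proof (rule separates_eq[OF vsp_dual_operad separates_ev])
  let ?l = "lin_lift DP (\<lambda>(v, t). eps t \<odot>\<^bsub>DP\<^esub> v)"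
  show "?l (\<delta> f) \<in> carrier DP"
    using lin_mapD(1)[OF counit_right_lift(1)] delta_closed[OF f] by blast
  fix \<phi> assume "\<phi> \<in> EV ` Sigma UNIV P"
  then obtain n q where q: "q \<in> P n" "\<phi> = ev (n, q)" by blast
  note E = VT.ften_lin[OF ev_lin[of "(n, q)"] alg_hom_lin[OF eps_hom]]
  have 1: "ev (n, q) (?l X) = ften (ev (n, q)) eps X" if X: "X \<in> carrier (tensor DP V.T)" for X
    by (rule VT.lin_map_tensor_eq[OF vsp_scalar lin_map_comp[OF counit_right_lift(1) ev_lin] E(1) _ X])
      (simp add: counit_right_lift(2) E(2), simp add: ev_def dual_operad_simps(3))
  obtain M where M: "\<forall>N\<ge>M. ften (ev (n, q)) eps (\<delta> f) = (\<Sum>m\<le>N. pairing n q (replicate m (1, e)) (\<delta> f))"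
    using pairing_eps_sum[OF delta_closed[OF f]] by blast
  \<comment> \<open>The bound \<open>max M n\<close> is past the threshold and includes the only
    nonzero term, \<open>m = n\<close>.\<close>
  have "ev (n, q) (?l (\<delta> f)) = (\<Sum>m\<le>max M n. pairing n q (replicate m (1, e)) (\<delta> f))"
    using M 1[OF delta_closed[OF f]] by simp
  also have "\<dots> = (\<Sum>m\<le>max M n. if m = n then f n q else 0)"
    by (rule sum.cong)
      (auto simp: delta_pairing[OF f q(1) unit_word] unit_right[OF q(1)] sum_list_replicate simp del: One_nat_def)
  also have "\<dots> = ev (n, q) f" by (simp add: ev_Pair)
  finally show "\<phi> (?l (\<delta> f)) = \<phi> f" using q(2) by simp
qed (use f in auto)

section \<open>Descent to the symmetric algebra\<close>

abbreviation "SS \<equiv> tensor V.S V.S"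
abbreviation "pr2 \<equiv> tensor_map V.S V.S V.pr V.pr"

lemma pr2_hom: "pr2 \<in> alg_hom TT SS"
  by (rule tensor_map_alg_hom[OF V.kalg_T V.kalg_T V.kalg_S V.kalg_S V.pr_hom V.pr_hom])

lemmas pr_lin = alg_hom_lin[OF V.pr_hom]
lemmas pr2_lin = tensor_map_lin(1)[OF V.vT V.vT V.vS V.vS pr_lin pr_lin]
lemmas pr2_pure = tensor_map_lin(2)[OF V.vT V.vT V.vS V.vS pr_lin pr_lin]

lemma comm_alg_SS: "comm_alg SS"
  by (rule comm_alg_tensor[OF V.comm_alg_S V.comm_alg_S])

text \<open>The induced maps are described only by their compatibility with \<open>pr\<close>; the
  concluding lemma obtains such maps from \<open>sym_factor\<close>.\<close>

context
  fixes \<Delta>S \<epsilon>S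
  assumes DS: "\<Delta>S \<in> alg_hom V.S SS" "\<And>x. x \<in> carrier V.T \<Longrightarrow> \<Delta>S (V.pr x) = pr2 (\<Delta> x)"
    and ES: "\<epsilon>S \<in> alg_hom V.S scalar_alg" "\<And>x. x \<in> carrier V.T \<Longrightarrow> \<epsilon>S (V.pr x) = eps x"
begin

interpretation SSi: tens_alg V.S V.S by (intro tens_alg.intro V.kalg_S)

text \<open>Projections intertwine every map in the identity with its analogue on the tensor
  algebra, so the identity is the image of \<open>Delta_coassoc\<close> under
  \<open>?G\<close>.\<close>

lemma DS_coassoc:
  assumes x: "x \<in> carrier V.S"
  shows "tensor_assoc V.S V.S V.S (tensor_map SS V.S \<Delta>S (\<lambda>y. y) (\<Delta>S x)) = tensor_map V.S SS (\<lambda>y. y) \<Delta>S (\<Delta>S x)"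
proof -
  interpret T_TT: tens V.T TT by (intro tens.intro V.vT TT.vsp_tensor)
  interpret TT_T: tens TT V.T by (intro tens.intro V.vT TT.vsp_tensor)
  interpret S_SS: tens V.S SS by (intro tens.intro V.vS SSi.vsp_tensor)
  interpret SS_S: tens SS V.S by (intro tens.intro V.vS SSi.vsp_tensor)
  note D = alg_hom_lin[OF Delta_hom] and DSl = alg_hom_lin[OF DS(1)]
  note M1 = tensor_map_lin[OF V.vT V.vT TT.vsp_tensor V.vT D lin_map_id]
  note M2 = tensor_map_lin[OF V.vT V.vT V.vT TT.vsp_tensor lin_map_id D]
  note A = tensor_assoc_lin[OF V.vT V.vT V.vT]
  note N1 = tensor_map_lin[OF V.vS V.vS SSi.vsp_tensor V.vS DSl lin_map_id]
  note N2 = tensor_map_lin[OF V.vS V.vS V.vS SSi.vsp_tensor lin_map_id DSl]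
  note B = tensor_assoc_lin[OF V.vS V.vS V.vS]
  let ?G = "tensor_map V.S SS V.pr pr2"
  note G = tensor_map_lin[OF V.vT TT.vsp_tensor V.vS SSi.vsp_tensor pr_lin pr2_lin]
  have Dc: "\<Delta> t \<in> carrier TT" if "t \<in> carrier V.T" for t using lin_mapD(1)[OF D that] .
  have prc: "V.pr t \<in> carrier V.S" if "t \<in> carrier V.T" for t using lin_mapD(1)[OF pr_lin that] .
  \<comment> \<open>The associators are compared for arbitrary \<open>W\<close>, because
    \<open>W\<close> will be \<open>\<Delta>\<close> of an element.\<close>
  have a0: "tensor_assoc V.S V.S V.S (pure SS V.S (pr2 W) (V.pr t)) = ?G (assocT (pure TT V.T W t))"
    if W: "W \<in> carrier TT" and t: "t \<in> carrier V.T" for W t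
  proof (rule TT.lin_map_tensor_eq[OF S_SS.vsp_tensor _ _ _ W])
    show "(\<lambda>W. tensor_assoc V.S V.S V.S (pure SS V.S (pr2 W) (V.pr t))) \<in> lin_map TT (tensor V.S SS)"
      by (rule lin_map_comp[OF lin_map_comp[OF pr2_lin bilinD(2)[OF SS_S.bilin_pure prc[OF t]]] B(1)])
    show "(\<lambda>W. ?G (assocT (pure TT V.T W t))) \<in> lin_map TT (tensor V.S SS)"
      by (rule lin_map_comp[OF lin_map_comp[OF bilinD(2)[OF TT_T.bilin_pure t] A(1)] G(1)])
  qed (use t prc in \<open>simp add: pr2_pure A(2) B(2) G(2) TT.pure_closed\<close>)
  have a: "tensor_assoc V.S V.S V.S (tensor_map SS V.S \<Delta>S (\<lambda>y. y) (pr2 U)) =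
      ?G (assocT (tensor_map TT V.T \<Delta> (\<lambda>y. y) U))" if U: "U \<in> carrier TT" for U
    by (rule TT.lin_map_tensor_eq[OF S_SS.vsp_tensor lin_map_comp[OF lin_map_comp[OF pr2_lin N1(1)] B(1)]
          lin_map_comp[OF lin_map_comp[OF M1(1) A(1)] G(1)] _ U])
      (simp add: pr2_pure N1(2) M1(2) prc DS(2) a0 Dc)
  have b: "tensor_map V.S SS (\<lambda>y. y) \<Delta>S (pr2 U) = ?G (tensor_map V.T TT (\<lambda>y. y) \<Delta> U)"
    if U: "U \<in> carrier TT" for U
    by (rule TT.lin_map_tensor_eq[OF S_SS.vsp_tensor lin_map_comp[OF pr2_lin N2(1)]
          lin_map_comp[OF M2(1) G(1)] _ U])
      (simp add: pr2_pure N2(2) M2(2) G(2) prc DS(2) Dc)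
  obtain t where t: "t \<in> carrier V.T" "x = V.pr t" using V.pr_surj[OF x] by blast
  show ?thesis using t Delta_coassoc[OF t(1)] by (simp add: DS(2) a b Dc)
qed

lemma DS_inc:
  assumes f: "f \<in> carrier DP"
  shows "\<Delta>S (sym_alg_inc DP f) = pr2 (\<iota> (\<delta> f))"
  using DS(2)[of "inc f"] f by (simp add: sym_alg_inc_def Delta_inc)

text \<open>Both sides are algebra endomorphisms of the symmetric algebra, so generators suffice;
  there the claim is the projection of \<open>delta_counit_left\<close>.\<close>

lemma DS_counit_left:
  assumes x: "x \<in> carrier V.S"
  shows "lin_lift V.S (\<lambda>(a, b). \<epsilon>S a \<odot>\<^bsub>V.S\<^esub> b) (\<Delta>S x) = x"
proof -
  let ?l = "lin_lift V.S (\<lambda>(a, b). \<epsilon>S a \<odot>\<^bsub>V.S\<^esub> b)"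
  note E = alg_homD[OF ES(1)]
  note l = SSi.tensor_lift[OF V.vS bilin_smult[OF V.vS V.vS alg_hom_lin[OF ES(1)]]]
  have sm: "c \<odot>\<^bsub>V.S\<^esub> (d \<odot>\<^bsub>V.S\<^esub> y) = (c * d) \<odot>\<^bsub>V.S\<^esub> y" if "y \<in> carrier V.S" for c d y
    using SSi.A.smult_assoc1[of c d y] that by simp
  have one: "1 \<odot>\<^bsub>V.S\<^esub> y = y" if "y \<in> carrier V.S" for y
    using SSi.A.smult_one[of y] that by simp
  have h: "?l \<in> alg_hom SS V.S"
    by (rule SSi.tensor_alg_homI[OF V.kalg_S l(1)])
      (use E in \<open>auto simp: l(2) one SSi.A.smult_mult SSi.A.mult_smult sm mult.commute\<close>)
  have g: "?l (pr2 (\<iota> X)) = V.pr (lin_lift V.T (\<lambda>(v, t). ev (1, e) v \<odot>\<^bsub>V.T\<^esub> t) X)"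
    if X: "X \<in> carrier (tensor DP V.T)" for X
    by (rule VT.lin_map_tensor_eq[OF V.vS lin_map_comp[OF lin_map_comp[OF \<iota>_lin pr2_lin] l(1)]
          lin_map_comp[OF counit_left_lift(1) pr_lin] _ X])
      (simp add: \<iota>_pure pr2_pure l(2) counit_left_lift(2) lin_mapD(1)[OF pr_lin] ES(2) eps_inc lin_mapD(3)[OF pr_lin]
        del: One_nat_def)
  show ?thesis
    by (rule V.alg_hom_S_eq[OF V.kalg_S alg_hom_comp[OF DS(1) h] alg_hom_id _ x])
      (use delta_closed delta_counit_left in \<open>simp add: DS_inc g sym_alg_inc_def[symmetric]\<close>)
qed

lemma DS_counit_right:
  assumes x: "x \<in> carrier V.S"
  shows "lin_lift V.S (\<lambda>(a, b). \<epsilon>S b \<odot>\<^bsub>V.S\<^esub> a) (\<Delta>S x) = x"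
proof -
  let ?l = "lin_lift V.S (\<lambda>(a, b). \<epsilon>S b \<odot>\<^bsub>V.S\<^esub> a)"
  note E = alg_homD[OF ES(1)]
  note l = SSi.tensor_lift[OF V.vS bilin_swap[OF bilin_smult[OF V.vS V.vS alg_hom_lin[OF ES(1)]]]]
  have sm: "c \<odot>\<^bsub>V.S\<^esub> (d \<odot>\<^bsub>V.S\<^esub> y) = (c * d) \<odot>\<^bsub>V.S\<^esub> y" if "y \<in> carrier V.S" for c d y
    using SSi.A.smult_assoc1[of c d y] that by simp
  have one: "1 \<odot>\<^bsub>V.S\<^esub> y = y" if "y \<in> carrier V.S" for y
    using SSi.A.smult_one[of y] that by simp
  have h: "?l \<in> alg_hom SS V.S"
    by (rule SSi.tensor_alg_homI[OF V.kalg_S l(1)])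
      (use E in \<open>auto simp: l(2) one SSi.A.smult_mult SSi.A.mult_smult sm mult.commute\<close>)
  have g: "?l (pr2 (\<iota> X)) = V.pr (inc (lin_lift DP (\<lambda>(v, t). eps t \<odot>\<^bsub>DP\<^esub> v) X))"
    if X: "X \<in> carrier (tensor DP V.T)" for X
    by (rule VT.lin_map_tensor_eq[OF V.vS lin_map_comp[OF lin_map_comp[OF \<iota>_lin pr2_lin] l(1)]
          lin_map_comp[OF lin_map_comp[OF counit_right_lift(1) V.inc_lin] pr_lin] _ X])
      (simp add: \<iota>_pure pr2_pure l(2) counit_right_lift(2) lin_mapD(1)[OF pr_lin] ES(2)
        lin_mapD(3)[OF pr_lin] lin_mapD(3)[OF V.inc_lin])
  show ?thesis
    by (rule V.alg_hom_S_eq[OF V.kalg_S alg_hom_comp[OF DS(1) h] alg_hom_id _ x])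
      (use delta_closed delta_counit_right in \<open>simp add: DS_inc g sym_alg_inc_def[symmetric]\<close>)
qed

lemma bialgebra_S: "bialgebra V.S \<Delta>S \<epsilon>S"
  unfolding bialgebra_def k_algebra_iff
  using V.kalg_S DS(1) ES(1) DS_coassoc DS_counit_left DS_counit_right by blast

end

end


section \<open>Block permutations\<close>

lemma sum_list_take_mono: "m \<le> n \<Longrightarrow> sum_list (take m ks) \<le> sum_list (take n (ks :: nat list))"
proof -
  assume "m \<le> n"
  then have "take n ks = take m ks @ take (n - m) (drop m ks)"
    by (metis le_add_diff_inverse take_add)
  then show ?thesis by simp
qed

lemma sum_list_take_Suc: "i < length ks \<Longrightarrow> sum_list (take (Suc i) ks) = sum_list (take i ks) + (ks ! i :: nat)"
  by (simp add: take_Suc_conv_app_nth)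

text \<open>The \<open>LEAST\<close> in \<open>block_perm\<close> finds the block containing
  \<open>x\<close>: minimality bounds \<open>x\<close> from below, the defining inequality from
  above.\<close>

lemma block_index:
  fixes ks :: "nat list"
  assumes "x < sum_list ks"
  defines "i \<equiv> LEAST i. x < sum_list (take (Suc i) ks)"
  shows "i < length ks" "sum_list (take i ks) \<le> x" "x - sum_list (take i ks) < ks ! i"
proof -
  have ne: "ks \<noteq> []" using assms(1) by auto
  then have last: "x < sum_list (take (Suc (length ks - 1)) ks)" using assms(1) by simp
  have 1: "x < sum_list (take (Suc i) ks)" unfolding i_def by (rule LeastI[where P="\<lambda>i. x < sum_list (take (Suc i) ks)", OF last])
  have "i \<le> length ks - 1" unfolding i_def by (rule Least_le[where P="\<lambda>i. x < sum_list (take (Suc i) ks)", OF last])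
  then show i: "i < length ks" using ne by (cases ks) auto
  show 2: "sum_list (take i ks) \<le> x"
  proof (cases i)
    case (Suc m)
    then have "\<not> x < sum_list (take (Suc m) ks)" using not_less_Least[of m "\<lambda>i. x < sum_list (take (Suc i) ks)"]
      unfolding i_def by simp
    then show ?thesis using Suc by simp
  qed simp
  show "x - sum_list (take i ks) < ks ! i" using 1 2 sum_list_take_Suc[OF i] by simp
qed

text \<open>Blocks are disjoint intervals: an earlier block ends no later than a later one
  starts.\<close>

lemma block_unique:
  fixes ks :: "nat list"
  assumes "a < length ks" "b < length ks" "j < ks ! a" "j' < ks ! b"
    and "sum_list (take a ks) + j = sum_list (take b ks) + j'"
  shows "a = b \<and> j = j'"
proof -
  have *: "\<not> a < b" if "a < length ks" "j < ks ! a" "sum_list (take a ks) + j = sum_list (take b ks) + j'" for a b j j'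
  proof
    assume "a < b"
    then have "sum_list (take (Suc a) ks) \<le> sum_list (take b ks)" by (intro sum_list_take_mono) simp
    then show False using that sum_list_take_Suc[OF that(1)] by simp
  qed
  have "a = b" using *[OF assms(1,3,5)] *[OF assms(2,4) assms(5)[symmetric]] by simp
  then show ?thesis using assms(5) by simp
qed

text \<open>Invariance of a form concerns permutations, so the maps that the equivariance axioms
  hand to \<open>act\<close> must be shown to be such. A value determines its block and its offset,
  which gives injectivity; finiteness gives the rest.\<close>

lemma block_perm_permutes:
  assumes \<sigma>: "\<sigma> permutes {..<length ks}"
    and \<tau>: "\<And>i. i < length ks \<Longrightarrow> \<tau> i permutes {..<ks ! i}"
  shows "block_perm ks \<sigma> \<tau> permutes {..<sum_list ks}"
proof -
  let ?n = "length ks" and ?i = "\<lambda>x. LEAST i. x < sum_list (take (Suc i) ks)"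
  let ?j = "\<lambda>x. x - sum_list (take (?i x) ks)"
  \<comment> \<open>The block lengths after rearrangement: entry \<open>\<sigma> i\<close> of
    \<open>ks'\<close> is entry \<open>i\<close> of \<open>ks\<close>, and the offsets in
    \<open>block_perm\<close> are prefix sums of \<open>ks'\<close>.\<close>
  define ks' where "ks' = permute_list (inv_into UNIV \<sigma>) ks"
  have \<sigma>': "inv_into UNIV \<sigma> permutes {..<?n}" by (rule permutes_inv[OF \<sigma>])
  have len: "length ks' = ?n" by (simp add: ks'_def)
  have "mset ks' = mset ks" unfolding ks'_def by (rule mset_permute_list[OF \<sigma>'])
  then have sum: "sum_list ks' = sum_list ks" by (metis sum_mset_sum_list)
  have nth: "ks' ! \<sigma> i = ks ! i" "\<sigma> i < ?n" if "i < ?n" for i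
    using that permutes_in_image[OF \<sigma>, of i] permutes_inverses[OF \<sigma>]
    unfolding ks'_def by (auto simp: permute_list_nth[OF \<sigma>'])
  have off: "(\<Sum>l<a. ks ! inv_into UNIV \<sigma> l) = sum_list (take a ks')" if "a \<le> ?n" for a
    using that by (simp add: ks'_def permute_list_def take_map interv_sum_list_conv_sum_set_nat atLeast0LessThan)
  have val: "block_perm ks \<sigma> \<tau> x = sum_list (take (\<sigma> (?i x)) ks') + \<tau> (?i x) (?j x)"
    and \<tau>x: "\<tau> (?i x) (?j x) < ks' ! \<sigma> (?i x)" and i: "?i x < ?n" and \<sigma>i: "\<sigma> (?i x) < length ks'"
    and j: "?j x < ks ! ?i x" and x: "x = sum_list (take (?i x) ks) + ?j x"
    if "x < sum_list ks" for x
  proof -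
    note b = block_index[OF that]
    show "?i x < ?n" "?j x < ks ! ?i x" "x = sum_list (take (?i x) ks) + ?j x" using b by auto
    show "\<sigma> (?i x) < length ks'" using nth(2)[OF b(1)] len by simp
    show "block_perm ks \<sigma> \<tau> x = sum_list (take (\<sigma> (?i x)) ks') + \<tau> (?i x) (?j x)"
      using that off[of "\<sigma> (?i x)"] nth(2)[OF b(1)] by (simp add: block_perm_def Let_def)
    show "\<tau> (?i x) (?j x) < ks' ! \<sigma> (?i x)"
      using permutes_in_image[OF \<tau>[OF b(1)], of "?j x"] b(3) nth(1)[OF b(1)] by simp
  qed
  have inj: "inj_on (block_perm ks \<sigma> \<tau>) {..<sum_list ks}"
  proof (rule inj_onI)
    fix x y assume "x \<in> {..<sum_list ks}" "y \<in> {..<sum_list ks}"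
      and eq: "block_perm ks \<sigma> \<tau> x = block_perm ks \<sigma> \<tau> y"
    then have xy: "x < sum_list ks" "y < sum_list ks" by auto
    have "\<sigma> (?i x) = \<sigma> (?i y) \<and> \<tau> (?i x) (?j x) = \<tau> (?i y) (?j y)"
      by (rule block_unique[OF \<sigma>i \<sigma>i \<tau>x \<tau>x]) (use xy eq val in auto)
    then have "?i x = ?i y" "\<tau> (?i x) (?j x) = \<tau> (?i y) (?j y)"
      using permutes_inj[OF \<sigma>] by (auto dest: injD)
    then have "?i x = ?i y" "?j x = ?j y"
      using permutes_inj[OF \<tau>[OF i[OF xy(1)]]] by (auto dest: injD)
    then show "x = y" using x[OF xy(1)] x[OF xy(2)] by simp
  qed
  have "block_perm ks \<sigma> \<tau> ` {..<sum_list ks} \<subseteq> {..<sum_list ks}"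
  proof
    fix y assume "y \<in> block_perm ks \<sigma> \<tau> ` {..<sum_list ks}"
    then obtain z where z: "z < sum_list ks" "y = block_perm ks \<sigma> \<tau> z" by auto
    have "y < sum_list (take (Suc (\<sigma> (?i z))) ks')"
      using val[OF z(1)] \<tau>x[OF z(1)] sum_list_take_Suc[OF \<sigma>i[OF z(1)]] z(2) by simp
    also have "\<dots> \<le> sum_list (take (length ks') ks')"
      using \<sigma>i[OF z(1)] by (intro sum_list_take_mono) simp
    finally show "y \<in> {..<sum_list ks}" using sum by simp
  qed
  then have "bij_betw (block_perm ks \<sigma> \<tau>) {..<sum_list ks} {..<sum_list ks}"
    using inj endo_inj_surj[of "{..<sum_list ks}" "block_perm ks \<sigma> \<tau>"] by (simp add: bij_betw_def)
  then show ?thesis by (rule bij_imp_permutes) (simp add: block_perm_def)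
qed


section \<open>Invariants\<close>

text \<open>Used twice: for the copy of the symmetric algebra of invariants, and for the image of
  its tensor square.\<close>

lemma alg_hom_image:
  assumes A: "kalg A" and B: "kalg B" and h: "h \<in> alg_hom A B"
  shows "h ` carrier A \<subseteq> carrier B" "\<zero>\<^bsub>B\<^esub> \<in> h ` carrier A" "\<one>\<^bsub>B\<^esub> \<in> h ` carrier A"
    and "\<And>x y. x \<in> h ` carrier A \<Longrightarrow> y \<in> h ` carrier A \<Longrightarrow> x \<oplus>\<^bsub>B\<^esub> y \<in> h ` carrier A"
    and "\<And>x y. x \<in> h ` carrier A \<Longrightarrow> y \<in> h ` carrier A \<Longrightarrow> x \<otimes>\<^bsub>B\<^esub> y \<in> h ` carrier A"
    and "\<And>c x. x \<in> h ` carrier A \<Longrightarrow> c \<odot>\<^bsub>B\<^esub> x \<in> h ` carrier A"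
proof -
  interpret A: kalg A by fact
  note D = alg_homD[OF h]
  show "h ` carrier A \<subseteq> carrier B" using D(1) by auto
  show "\<zero>\<^bsub>B\<^esub> \<in> h ` carrier A"
    using lin_map_zero[OF kalg_vsp[OF A] kalg_vsp[OF B] alg_hom_lin[OF h]] by (intro image_eqI[of _ _ "\<zero>\<^bsub>A\<^esub>"]) auto
  show "\<one>\<^bsub>B\<^esub> \<in> h ` carrier A" using D(4) by (intro image_eqI[of _ _ "\<one>\<^bsub>A\<^esub>"]) auto
  fix x assume "x \<in> h ` carrier A"
  then obtain a where a: "a \<in> carrier A" "x = h a" by blast
  show "c \<odot>\<^bsub>B\<^esub> x \<in> h ` carrier A" for c
    using a D(5) by (intro image_eqI[of _ _ "c \<odot>\<^bsub>A\<^esub> a"]) auto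
  fix y assume "y \<in> h ` carrier A"
  then obtain b where b: "b \<in> carrier A" "y = h b" by blast
  show "x \<oplus>\<^bsub>B\<^esub> y \<in> h ` carrier A" using a b D(2) by (intro image_eqI[of _ _ "a \<oplus>\<^bsub>A\<^esub> b"]) auto
  show "x \<otimes>\<^bsub>B\<^esub> y \<in> h ` carrier A" using a b D(3) by (intro image_eqI[of _ _ "a \<otimes>\<^bsub>A\<^esub> b"]) auto
qed

locale operad_char0 = operad_fd scale P act \<gamma> e
  for scale :: "'k::field_char_0 \<Rightarrow> 'a::ab_group_add \<Rightarrow> 'a" and P act \<gamma> e
begin

abbreviation "W \<equiv> inv_dual scale P act"
abbreviation "perms n \<equiv> {\<sigma>. \<sigma> permutes {..<n::nat}}"

text \<open>The inverse in the dual action disappears because the condition ranges over the whole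
  group; outside \<open>P n\<close> both \<open>dual_act\<close> and the form vanish.\<close>

lemma inv_dual_iff:
  "f \<in> carrier W \<longleftrightarrow> f \<in> carrier DP \<and> (\<forall>n \<sigma> p. \<sigma> permutes {..<n} \<longrightarrow> p \<in> P n \<longrightarrow> f n (act n \<sigma> p) = f n p)"
proof
  assume f: "f \<in> carrier W"
  then have fD: "f \<in> carrier DP" by (simp add: inv_dual_def)
  have "f n (act n \<sigma> p) = f n p" if "\<sigma> permutes {..<n}" "p \<in> P n" for n \<sigma> p
  proof -
    have "dual_act P act n (inv_into UNIV \<sigma>) (f n) = f n"
      using f permutes_inv[OF that(1)] by (simp add: inv_dual_def)
    then have "dual_act P act n (inv_into UNIV \<sigma>) (f n) p = f n p" by simp
    then show ?thesis using that permutes_inv_inv[OF that(1)] by (simp add: dual_act_def)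
  qed
  then show "f \<in> carrier DP \<and> (\<forall>n \<sigma> p. \<sigma> permutes {..<n} \<longrightarrow> p \<in> P n \<longrightarrow> f n (act n \<sigma> p) = f n p)"
    using fD by blast
next
  assume f: "f \<in> carrier DP \<and> (\<forall>n \<sigma> p. \<sigma> permutes {..<n} \<longrightarrow> p \<in> P n \<longrightarrow> f n (act n \<sigma> p) = f n p)"
  have "dual_act P act n \<sigma> (f n) = f n" if "\<sigma> permutes {..<n}" for n \<sigma>
    using f permutes_inv[OF that] DP_outside[of f] by (auto simp: dual_act_def)
  then show "f \<in> carrier W" using f by (simp add: inv_dual_def)
qed

lemma W_simps:
  "\<zero>\<^bsub>W\<^esub> = \<zero>\<^bsub>DP\<^esub>" "f \<oplus>\<^bsub>W\<^esub> g = f \<oplus>\<^bsub>DP\<^esub> g" "c \<odot>\<^bsub>W\<^esub> f = c \<odot>\<^bsub>DP\<^esub> f"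
  by (simp_all add: inv_dual_def)

lemma W_DP: "f \<in> carrier W \<Longrightarrow> f \<in> carrier DP"
  by (simp add: inv_dual_iff)

lemma submodule_W: "submodule (carrier W) scalar_alg DP"
proof (rule submodule_scalarI[OF vsp_dual_operad])
  show "f \<oplus>\<^bsub>DP\<^esub> g \<in> carrier W" if "f \<in> carrier W" "g \<in> carrier W" for f g
    using that V.V.M.a_closed[of f g] by (simp add: inv_dual_iff dual_operad_simps(2))
  show "c \<odot>\<^bsub>DP\<^esub> f \<in> carrier W" if "f \<in> carrier W" for f c
    using that V.V.smult_closed[of c f] by (simp add: inv_dual_iff dual_operad_simps(3))
  show "\<zero>\<^bsub>DP\<^esub> \<in> carrier W"
    using V.V.M.zero_closed by (simp add: inv_dual_iff dual_operad_simps(1))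
qed (use W_DP in auto)

lemma vsp_W: "vsp W"
proof -
  have "W = DP\<lparr>carrier := carrier W\<rparr>" by (simp add: inv_dual_def)
  then show ?thesis using submodule.submodule_is_module[OF submodule_W vsp_dual_operad] by simp
qed

sublocale W: tensalg W
  by (rule tensalg.intro) (rule vsp_W)

lemma W_inclusion: "(\<lambda>f. f) \<in> lin_map W DP"
  using W_DP by (intro lin_mapI) (auto simp: W_simps)

lemma finite_perms: "finite (perms n)"
  by (simp add: finite_permutations)

section \<open>Averaging over the symmetric groups\<close>

definition avg :: "nat \<Rightarrow> 'a \<Rightarrow> 'a" where
  "avg n p = scale (inverse (of_nat (fact n))) (\<Sum>\<sigma>\<in>perms n. act n \<sigma> p)"

lemma avg_closed: "p \<in> P n \<Longrightarrow> avg n p \<in> P n"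
  unfolding avg_def by (intro subspace_scale[OF subspace_P] subspace_sum[OF subspace_P]) (auto intro: act_closed)

lemma avg_add: "p \<in> P n \<Longrightarrow> q \<in> P n \<Longrightarrow> avg n (p + q) = avg n p + avg n q"
  by (simp add: avg_def act_add sum.distrib scale_right_distrib)

lemma avg_scale: "p \<in> P n \<Longrightarrow> avg n (scale c p) = scale c (avg n p)"
  by (simp add: avg_def act_scale scale_sum_right[symmetric] mult.commute)

text \<open>Translation permutes the summands; for a right action \<open>act_comp\<close> makes it
  the translation of \<open>\<tau>\<close> to \<open>\<rho> \<circ> \<tau>\<close>.\<close>

lemma avg_act:
  assumes \<rho>: "\<rho> permutes {..<n}" and p: "p \<in> P n"
  shows "avg n (act n \<rho> p) = avg n p"
proof -
  have "(\<Sum>\<tau>\<in>perms n. act n \<tau> (act n \<rho> p)) = (\<Sum>\<tau>\<in>perms n. act n (\<rho> \<circ> \<tau>) p)"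
    by (rule sum.cong) (auto simp: act_comp[OF \<rho> _ p])
  also have "\<dots> = (\<Sum>\<tau>\<in>perms n. act n \<tau> p)"
    by (rule sum.reindex_bij_witness[of _ "\<lambda>\<tau>. inv_into UNIV \<rho> \<circ> \<tau>" "\<lambda>\<tau>. \<rho> \<circ> \<tau>"])
      (auto simp: o_assoc permutes_inv_o[OF \<rho>] intro: permutes_compose \<rho> permutes_inv[OF \<rho>])
  finally show ?thesis by (simp add: avg_def)
qed

lemma form_avg:
  assumes add: "\<And>x y. x \<in> P n \<Longrightarrow> y \<in> P n \<Longrightarrow> h (x + y) = h x + h y"
    and sc: "\<And>c x. x \<in> P n \<Longrightarrow> h (scale c x) = c * (h x :: 'k)" and p: "p \<in> P n"
  shows "h (avg n p) = inverse (of_nat (fact n)) * (\<Sum>\<sigma>\<in>perms n. h (act n \<sigma> p))"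
proof -
  have h0: "h 0 = 0" using sc[OF P_zero, of 0] by simp
  have "h (\<Sum>\<sigma>\<in>K. act n \<sigma> p) = (\<Sum>\<sigma>\<in>K. h (act n \<sigma> p)) \<and> (\<Sum>\<sigma>\<in>K. act n \<sigma> p) \<in> P n"
    if "finite K" "K \<subseteq> perms n" for K
    using that
  proof (induction K)
    case (insert \<sigma> K)
    then have "act n \<sigma> p \<in> P n" using act_closed p by auto
    then show ?case using insert add subspace_add[OF subspace_P] by simp
  qed (use h0 P_zero in auto)
  from this[OF finite_perms subset_refl] show ?thesis by (simp add: avg_def sc)
qed

text \<open>This is how averages are removed from arguments: a form that is constant along an orbit
  keeps its value at the average, since \<open>n!\<close> equal terms are divided by
  \<open>n!\<close>.\<close>

lemma form_avg_const:
  assumes "\<And>x y. x \<in> P n \<Longrightarrow> y \<in> P n \<Longrightarrow> h (x + y) = h x + h y"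
    and "\<And>c x. x \<in> P n \<Longrightarrow> h (scale c x) = c * (h x :: 'k)" and "p \<in> P n"
    and "\<And>\<sigma>. \<sigma> permutes {..<n} \<Longrightarrow> h (act n \<sigma> p) = d"
  shows "h (avg n p) = d"
  using form_avg[OF assms(1-3)] assms(4) by (simp add: card_permutations)

text \<open>The projection \<open>\<pi>\<close>, given as the transpose of \<open>avg\<close>, so
  that in every pairing it can be moved to the operations.\<close>

definition avg_dual :: "(nat \<Rightarrow> 'a \<Rightarrow> 'k) \<Rightarrow> nat \<Rightarrow> 'a \<Rightarrow> 'k" where
  "avg_dual f n = (\<lambda>p. if p \<in> P n then f n (avg n p) else 0)"

lemma avg_dual_closed:
  assumes f: "f \<in> carrier DP"
  shows "avg_dual f \<in> carrier W"
proof -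
  have "{n. avg_dual f n \<noteq> (\<lambda>p. 0)} \<subseteq> {n. f n \<noteq> (\<lambda>p. 0)}" by (auto simp: avg_dual_def)
  then have "finite {n. avg_dual f n \<noteq> (\<lambda>p. 0)}"
    using f by (auto simp: dual_operad_carrier intro: finite_subset)
  moreover have "avg_dual f n \<in> dual_of scale (P n)" for n
    using subspace_add[OF subspace_P[of n]] subspace_scale[OF subspace_P[of n]]
    by (auto simp: dual_of_def avg_dual_def avg_add avg_scale avg_closed DP_add[OF f] DP_scale[OF f])
  moreover have "avg_dual f 0 = (\<lambda>p. 0)" using f by (auto simp: avg_dual_def dual_operad_carrier)
  ultimately show ?thesis
    by (auto simp: inv_dual_iff dual_operad_carrier avg_dual_def act_closed avg_act)
qed

lemma avg_dual_lin: "avg_dual \<in> lin_map DP W"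
  by (rule lin_mapI[OF avg_dual_closed]) (auto simp: W_simps dual_operad_simps avg_dual_def fun_eq_iff)

lemma avg_dual_lin': "avg_dual \<in> lin_map DP DP"
  using lin_map_comp[OF avg_dual_lin W_inclusion] by simp

lemma avg_dual_inv: "f \<in> carrier W \<Longrightarrow> avg_dual f = f"
proof (intro ext)
  fix n p assume f: "f \<in> carrier W"
  show "avg_dual f n p = f n p"
  proof (cases "p \<in> P n")
    case True
    then show ?thesis unfolding avg_dual_def
      using form_avg_const[of n "f n" p "f n p"] f DP_add[OF W_DP[OF f]] DP_scale[OF W_DP[OF f]]
      by (auto simp: inv_dual_iff)
  qed (use DP_outside[OF W_DP[OF f]] in \<open>simp add: avg_dual_def\<close>)
qed

definition avgw :: "nat \<times> 'a \<Rightarrow> nat \<times> 'a" where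
  "avgw w = (fst w, avg (fst w) (snd w))"

lemma avgw_simps: "fst (avgw w) = fst w" "avgw (k, r) = (k, avg k r)"
  by (simp_all add: avgw_def)

lemma map_avgw: "ws \<in> L \<Longrightarrow> map avgw ws \<in> L" "arity (map avgw ws) = arity ws"
  by (induction ws) (auto simp: avgw_def avg_closed)

text \<open>The map \<open>T(\<pi>)\<close>, kept as an endomorphism of the tensor algebra of
  \<open>DP\<close> so that it can be compared with symmetrization in one space. That its values
  come from invariants is exploited after projection.\<close>

definition avgT :: "((nat \<Rightarrow> 'a \<Rightarrow> 'k) list \<Rightarrow>\<^sub>0 'k) set \<Rightarrow> ((nat \<Rightarrow> 'a \<Rightarrow> 'k) list \<Rightarrow>\<^sub>0 'k) set" where
  "avgT = tensor_alg_lift V.T (\<lambda>f. inc (avg_dual f))"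

lemma avgT_hom: "avgT \<in> alg_hom V.T V.T"
  and avgT_inc: "f \<in> carrier DP \<Longrightarrow> avgT (inc f) = inc (avg_dual f)"
  unfolding avgT_def using V.tensor_alg_lift[OF V.kalg_T lin_map_comp[OF avg_dual_lin' V.inc_lin]] by auto

lemma word_eval_avgT:
  assumes t: "t \<in> carrier V.T" and ws: "ws \<in> L"
  shows "word_eval ws (avgT t) = word_eval (map avgw ws) t"
proof (rule V.lin_map_T_eq[OF vsp_scalar lin_map_comp[OF alg_hom_lin[OF avgT_hom] word_eval_lin] word_eval_lin _ t])
  fix vs assume "vs \<in> lists (carrier DP)"
  then show "word_eval ws (avgT (V.word vs)) = word_eval (map avgw ws) (V.word vs)"
    using ws
  proof (induction vs arbitrary: ws rule: list.induct)
    case Nil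
    show ?case using alg_homD(4)[OF avgT_hom] by (simp add: V.word_Nil word_eval_one)
  next
    case (Cons v vs)
    have v: "v \<in> carrier DP" "vs \<in> lists (carrier DP)" "V.word vs \<in> carrier V.T" using Cons.prems by auto
    have T: "avgT (V.word (v # vs)) = inc (avg_dual v) \<otimes>\<^bsub>V.T\<^esub> avgT (V.word vs)"
      using v by (simp add: V.word_Cons alg_homD(3)[OF avgT_hom] avgT_inc)
    have c: "avg_dual v \<in> carrier DP" "avgT (V.word vs) \<in> carrier V.T"
      using v lin_mapD(1)[OF avg_dual_lin'] alg_homD(1)[OF avgT_hom] by auto
    have "(case ws of [] \<Rightarrow> 0 | (k, q) # us \<Rightarrow> avg_dual v k q * word_eval us (avgT (V.word vs))) =
        (case map avgw ws of [] \<Rightarrow> 0 | (k, q) # us \<Rightarrow> v k q * word_eval us (V.word vs))"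
    proof (cases ws)
      case (Cons w us)
      then show ?thesis
        using Cons.IH[OF v(2), of us] \<open>ws \<in> L\<close> by (cases w) (auto simp: avgw_simps avg_dual_def)
    qed simp
    then show ?case
      unfolding T unfolding V.word_Cons[OF v(1,2)] word_eval_inc_mult[OF c] word_eval_inc_mult[OF v(1,3)] .
  qed
qed

section \<open>Averaged and symmetrized coproducts of invariant forms\<close>

lemmas avg2_lin = tensor_map_lin(1)[OF vsp_dual_operad V.vT vsp_dual_operad V.vT avg_dual_lin' alg_hom_lin[OF avgT_hom]]
lemmas avg2_pure = tensor_map_lin(2)[OF vsp_dual_operad V.vT vsp_dual_operad V.vT avg_dual_lin' alg_hom_lin[OF avgT_hom]]
lemmas SymT_lin = tensor_map_lin(1)[OF vsp_dual_operad V.vT vsp_dual_operad V.vT lin_map_id V.Sym_lin]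
lemmas SymT_pure = tensor_map_lin(2)[OF vsp_dual_operad V.vT vsp_dual_operad V.vT lin_map_id V.Sym_lin]

abbreviation "avg2 \<equiv> tensor_map DP V.T avg_dual avgT"
abbreviation "SymT \<equiv> tensor_map DP V.T (\<lambda>v. v) V.Sym"

lemma pairing_avg2:
  assumes X: "X \<in> carrier (tensor DP V.T)" and q: "q \<in> P n" and ws: "ws \<in> L"
  shows "pairing n q ws (avg2 X) = pairing n (avg n q) (map avgw ws) X"
  by (rule VT.lin_map_tensor_eq[OF vsp_scalar lin_map_comp[OF avg2_lin pairing_lin] pairing_lin _ X])
    (use q ws lin_mapD(1)[OF avg_dual_lin'] alg_homD(1)[OF avgT_hom] in
      \<open>simp add: avg2_pure pairing_pure word_eval_avgT avg_dual_def del: in_lists_conv_set\<close>)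

lemma pairing_SymT:
  assumes X: "X \<in> carrier (tensor DP V.T)"
  shows "pairing n q ws (SymT X) =
    inverse (of_nat (fact (length ws))) * (\<Sum>\<sigma>\<in>perms (length ws). pairing n q (permute_list \<sigma> ws) X)"
proof (rule VT.lin_map_tensor_eq[OF vsp_scalar lin_map_comp[OF SymT_lin pairing_lin] _ _ X])
  show "(\<lambda>X. inverse (of_nat (fact (length ws))) * (\<Sum>\<sigma>\<in>perms (length ws). pairing n q (permute_list \<sigma> ws) X))
    \<in> lin_map (tensor DP V.T) scalar_alg"
    by (rule lin_mapI) (simp_all add: lin_mapD(2,3)[OF pairing_lin] sum.distrib sum_distrib_left algebra_simps)
  fix v t assume v: "v \<in> carrier DP" and t: "t \<in> carrier V.T"
  have "word_eval ws (V.Sym t) = inverse (of_nat (fact (length ws))) *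
      (\<Sum>\<sigma>\<in>perms (length ws). word_eval (permute_list \<sigma> ws) t)"
    using V.wev_Sym[OF map_ev t, of ws] by (simp add: word_eval_eq permute_list_map)
  then show "pairing n q ws (SymT (pure DP V.T v t)) = inverse (of_nat (fact (length ws))) *
      (\<Sum>\<sigma>\<in>perms (length ws). pairing n q (permute_list \<sigma> ws) (pure DP V.T v t))"
    using v t lin_mapD(1)[OF V.Sym_lin t] by (simp add: SymT_pure pairing_pure sum_distrib_left algebra_simps)
qed

text \<open>By \<open>equivariance_inner\<close>, acting on one letter is acting on the composite by
  a permutation inside one block. An invariant \<open>f\<close> does not see this, so the form in
  that slot is constant along the orbit of \<open>r\<close>.\<close>

lemma gamma_avg_slot:
  assumes f: "f \<in> carrier W" and ws: "us \<in> L" "vs \<in> L" "r \<in> P k" and q: "q \<in> P (length us + 1 + length vs)"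
  defines "N \<equiv> arity us + k + arity vs"
  shows "f N (\<gamma> q (us @ (k, avg k r) # vs)) = f N (\<gamma> q (us @ (k, r) # vs))"
proof (rule form_avg_const[where h="\<lambda>x. f N (\<gamma> q (us @ (k, x) # vs))"])
  have c: "\<gamma> q (us @ (k, x) # vs) \<in> P N" if "x \<in> P k" for x
    using gamma_closed[of "us @ (k, x) # vs" q] ws(1,2) that q by (simp add: N_def algebra_simps)
  note fD = W_DP[OF f]
  show "f N (\<gamma> q (us @ (k, x + y) # vs)) = f N (\<gamma> q (us @ (k, x) # vs)) + f N (\<gamma> q (us @ (k, y) # vs))"
    if "x \<in> P k" "y \<in> P k" for x y
    using DP_add[OF fD c[OF that(1)] c[OF that(2)]] by (simp add: gamma_add[OF ws(1,2) that q])
  show "f N (\<gamma> q (us @ (k, scale d x) # vs)) = d * f N (\<gamma> q (us @ (k, x) # vs))" if "x \<in> P k" for x d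
    using DP_scale[OF fD c[OF that]] by (simp add: gamma_scale[OF ws(1,2) that q])
  fix \<tau> assume \<tau>: "\<tau> permutes {..<k}"
  \<comment> \<open>The identity is used in all blocks but one; there \<open>act_id\<close> returns
    the original letters.\<close>
  let ?ws = "us @ (k, r) # vs" and ?\<tau> = "\<lambda>i. if i = length us then \<tau> else id"
  have L: "?ws \<in> L" using ws by auto
  have p: "?\<tau> i permutes {..<fst (?ws ! i)}" if "i < length ?ws" for i
    using \<tau> by (auto simp: permutes_id)
  have m: "snd (?ws ! i) \<in> P (fst (?ws ! i))" if "i < length ?ws" for i
    using L nth_mem[OF that] by (cases "?ws ! i") (auto simp: in_lists_conv_set)
  have "map (\<lambda>i. (fst (?ws ! i), act (fst (?ws ! i)) (?\<tau> i) (snd (?ws ! i)))) [0..<length ?ws] =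
      us @ (k, act k \<tau> r) # vs"
  proof (rule nth_equalityI)
    fix i assume "i < length (map (\<lambda>i. (fst (?ws ! i), act (fst (?ws ! i)) (?\<tau> i) (snd (?ws ! i)))) [0..<length ?ws])"
    then have i: "i < length ?ws" by simp
    show "map (\<lambda>i. (fst (?ws ! i), act (fst (?ws ! i)) (?\<tau> i) (snd (?ws ! i)))) [0..<length ?ws] ! i =
        (us @ (k, act k \<tau> r) # vs) ! i"
    proof (cases "i = length us")
      case False
      then have "?ws ! i = (us @ (k, act k \<tau> r) # vs) ! i" by (simp add: nth_append nth_Cons')
      then show ?thesis using False i m[OF i] act_id by (subst nth_map_upt) simp_all
    qed (use i in \<open>subst nth_map_upt; simp\<close>)
  qed simp
  then have "\<gamma> q (us @ (k, act k \<tau> r) # vs) =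
      act (arity ?ws) (block_perm (map fst ?ws) id ?\<tau>) (\<gamma> q ?ws)"
    using equivariance_inner[OF L _ p, of q] q by simp
  moreover have "block_perm (map fst ?ws) id ?\<tau> permutes {..<arity ?ws}"
  proof (rule block_perm_permutes)
    fix i assume i: "i < length (map fst ?ws)"
    have "map fst ?ws ! i = fst (?ws ! i)" by (rule nth_map) (use i in simp)
    then show "?\<tau> i permutes {..<map fst ?ws ! i}" using p[of i] i by (simp only: length_map)
  qed (rule permutes_id)
  moreover have "arity ?ws = N" by (simp add: N_def)
  ultimately show "f N (\<gamma> q (us @ (k, act k \<tau> r) # vs)) = f N (\<gamma> q ?ws)"
    using f c[OF ws(3)] by (simp add: inv_dual_iff)
qed (rule ws(3))

text \<open>The prefix \<open>us\<close> collects the letters already treated; each step averages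
  one more slot.\<close>

lemma gamma_avg_inner:
  assumes f: "f \<in> carrier W" and "us \<in> L" "vs \<in> L" "q \<in> P (length us + length vs)"
  shows "f (arity us + arity vs) (\<gamma> q (us @ map avgw vs)) = f (arity us + arity vs) (\<gamma> q (us @ vs))"
  using assms(2-)
proof (induction vs arbitrary: us rule: list.induct)
  case (Cons w vs)
  obtain k r where w: "w = (k, r)" "r \<in> P k" "vs \<in> L" using Cons.prems(2) by (cases w) auto
  have "f (arity (us @ [avgw w]) + arity vs) (\<gamma> q ((us @ [avgw w]) @ map avgw vs)) =
      f (arity (us @ [avgw w]) + arity vs) (\<gamma> q ((us @ [avgw w]) @ vs))"
    by (rule Cons.IH) (use Cons.prems w avg_closed in \<open>auto simp: avgw_simps\<close>)
  also have "\<dots> = f (arity us + k + arity vs) (\<gamma> q (us @ (k, r) # vs))"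
    using gamma_avg_slot[OF f Cons.prems(1) w(3,2), of q] Cons.prems(3) by (simp add: w avgw_simps add.assoc)
  finally show ?case by (simp add: w avgw_simps add.assoc)
qed simp

text \<open>By \<open>equivariance_outer\<close>, acting on the outer operation reorders the
  letters, up to a block permutation of the composite that \<open>f\<close> ignores. Averaging the
  operation thus becomes averaging over the orders of the letters, which is where symmetrization
  comes from.\<close>

lemma gamma_avg_outer:
  assumes f: "f \<in> carrier W" and ws: "ws \<in> L" and q: "q \<in> P (length ws)"
  shows "f (arity ws) (\<gamma> (avg (length ws) q) ws) = inverse (of_nat (fact (length ws))) *
    (\<Sum>\<sigma>\<in>perms (length ws). f (arity ws) (\<gamma> q (permute_list \<sigma> ws)))"
proof -
  let ?n = "length ws"
  have c: "\<gamma> x ws \<in> P (arity ws)" if "x \<in> P ?n" for x using gamma_closed[OF ws that] .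
  note fD = W_DP[OF f]
  have "f (arity ws) (\<gamma> (avg ?n q) ws) =
      inverse (of_nat (fact ?n)) * (\<Sum>\<sigma>\<in>perms ?n. f (arity ws) (\<gamma> (act ?n \<sigma> q) ws))"
    using comp_add_left[OF ws] comp_scale_left[OF ws] DP_add[OF fD c c] DP_scale[OF fD c]
    by (intro form_avg q) auto
  also have "(\<Sum>\<sigma>\<in>perms ?n. f (arity ws) (\<gamma> (act ?n \<sigma> q) ws)) =
      (\<Sum>\<sigma>\<in>perms ?n. f (arity ws) (\<gamma> q (permute_list (inv_into UNIV \<sigma>) ws)))"
  proof (rule sum.cong)
    fix \<sigma> assume "\<sigma> \<in> perms ?n"
    then have \<sigma>: "\<sigma> permutes {..<?n}" by simp
    let ?vs = "permute_list (inv_into UNIV \<sigma>) ws"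
    have \<sigma>': "inv_into UNIV \<sigma> permutes {..<?n}" by (rule permutes_inv[OF \<sigma>])
    have vs: "?vs \<in> L" using ws by (auto simp: in_lists_conv_set set_permute_list[OF \<sigma>'])
    have "mset (map fst ?vs) = mset (map fst ws)" using mset_permute_list[OF \<sigma>'] by simp
    then have ar: "arity ?vs = arity ws" by (metis sum_mset_sum_list)
    have "\<gamma> (act ?n \<sigma> q) ws = act (arity ws) (block_perm (map fst ws) \<sigma> (\<lambda>i. id)) (\<gamma> q ?vs)"
      using equivariance_outer[OF ws q \<sigma>] by (simp add: permute_list_def)
    moreover have "block_perm (map fst ws) \<sigma> (\<lambda>i. id) permutes {..<arity ws}"
      by (rule block_perm_permutes) (use \<sigma> permutes_id in auto)
    moreover have "\<gamma> q ?vs \<in> P (arity ws)" using gamma_closed[OF vs, of q] q ar by simp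
    ultimately show "f (arity ws) (\<gamma> (act ?n \<sigma> q) ws) = f (arity ws) (\<gamma> q ?vs)"
      using f by (simp add: inv_dual_iff)
  qed simp
  also have "\<dots> = (\<Sum>\<sigma>\<in>perms ?n. f (arity ws) (\<gamma> q (permute_list \<sigma> ws)))"
    by (rule sum.reindex_bij_witness[of _ "inv_into UNIV" "inv_into UNIV"])
      (auto simp: permutes_inv permutes_inv_inv)
  finally show ?thesis .
qed

text \<open>In pairings the left side averages the operation and every letter. The averages of the
  letters are discarded by \<open>gamma_avg_inner\<close>, and the average of the operation is
  traded for one over orders by \<open>gamma_avg_outer\<close>.\<close>

lemma avg2_delta:
  assumes f: "f \<in> carrier W"
  shows "avg2 (\<delta> f) = SymT (\<delta> f)"
proof (rule pairing_separates)
  note fD = W_DP[OF f]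
  note X = delta_closed[OF fD]
  show "avg2 (\<delta> f) \<in> carrier (tensor DP V.T)" "SymT (\<delta> f) \<in> carrier (tensor DP V.T)"
    using lin_mapD(1)[OF avg2_lin X] lin_mapD(1)[OF SymT_lin X] by auto
  fix n q ws assume q: "q \<in> P n" and ws: "ws \<in> L"
  have pl: "permute_list \<sigma> ws \<in> L" "arity (permute_list \<sigma> ws) = arity ws" if "\<sigma> \<in> perms (length ws)" for \<sigma>
  proof -
    have \<sigma>: "\<sigma> permutes {..<length ws}" using that by simp
    show "permute_list \<sigma> ws \<in> L" using ws by (auto simp: in_lists_conv_set set_permute_list[OF \<sigma>])
    have "mset (map fst (permute_list \<sigma> ws)) = mset (map fst ws)" using mset_permute_list[OF \<sigma>] by simp
    then show "arity (permute_list \<sigma> ws) = arity ws" by (metis sum_mset_sum_list)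
  qed
  have "pairing n q ws (avg2 (\<delta> f)) = (if length ws = n then f (arity ws) (\<gamma> (avg n q) (map avgw ws)) else 0)"
    using delta_pairing[OF fD avg_closed[OF q] map_avgw(1)[OF ws]]
    by (simp only: pairing_avg2[OF X q ws] length_map map_avgw(2))
  also have "\<dots> = (if length ws = n then f (arity ws) (\<gamma> (avg n q) ws) else 0)"
    using gamma_avg_inner[OF f _ ws, of "[]" "avg n q"] avg_closed[OF q] by auto
  also have "\<dots> = (if length ws = n then inverse (of_nat (fact (length ws))) *
      (\<Sum>\<sigma>\<in>perms (length ws). f (arity ws) (\<gamma> q (permute_list \<sigma> ws))) else 0)"
    using gamma_avg_outer[OF f ws] q by auto
  also have "\<dots> = inverse (of_nat (fact (length ws))) *
      (\<Sum>\<sigma>\<in>perms (length ws). if length ws = n then f (arity ws) (\<gamma> q (permute_list \<sigma> ws)) else 0)"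
    by simp
  also have "\<dots> = pairing n q ws (SymT (\<delta> f))"
    unfolding pairing_SymT[OF X]
  proof (intro arg_cong[where f="\<lambda>x. inverse (of_nat (fact (length ws))) * x"] sum.cong refl)
    fix \<sigma> assume "\<sigma> \<in> perms (length ws)"
    from delta_pairing[OF fD q pl(1)[OF this]] pl(2)[OF this]
    show "(if length ws = n then f (arity ws) (\<gamma> q (permute_list \<sigma> ws)) else 0) = pairing n q (permute_list \<sigma> ws) (\<delta> f)"
      by simp
  qed
  finally show "pairing n q ws (avg2 (\<delta> f)) = pairing n q ws (SymT (\<delta> f))" .
qed

lemma pr2_iota_Sym:
  assumes X: "X \<in> carrier (tensor DP V.T)"
  shows "pr2 (\<iota> (SymT X)) = pr2 (\<iota> X)"
proof -
  interpret SSi: tens_alg V.S V.S by (intro tens_alg.intro V.kalg_S)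
  show ?thesis
    by (rule VT.lin_map_tensor_eq[OF SSi.vsp_tensor lin_map_comp[OF SymT_lin lin_map_comp[OF \<iota>_lin pr2_lin]]
          lin_map_comp[OF \<iota>_lin pr2_lin] _ X])
      (simp add: SymT_pure \<iota>_pure pr2_pure lin_mapD(1)[OF V.Sym_lin] V.pr_Sym)
qed

lemma pr2_iota_delta:
  assumes f: "f \<in> carrier W"
  shows "pr2 (\<iota> (\<delta> f)) = pr2 (\<iota> (avg2 (\<delta> f)))"
  unfolding avg2_delta[OF f] by (rule pr2_iota_Sym[symmetric]) (rule delta_closed[OF W_DP[OF f]])

text \<open>\<open>K\<close>, the image of the tensor square of \<open>B\<close>, is a subalgebra of
  \<open>SS\<close>, so only the generators that come from invariants have to be tested. There
  \<open>pr2_iota_delta\<close> replaces \<open>\<delta> f\<close> by its average, both of whose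
  factors project into \<open>B\<close>.\<close>

lemma subbialgebra_image:
  assumes DS: "\<Delta>S \<in> alg_hom V.S SS" "\<And>x. x \<in> carrier V.T \<Longrightarrow> \<Delta>S (V.pr x) = pr2 (\<Delta> x)"
    and j: "j \<in> alg_hom W.S V.S" "\<And>f. f \<in> carrier W \<Longrightarrow> j (sym_alg_inc W f) = sym_alg_inc DP f"
  shows "subbialgebra V.S \<Delta>S (j ` carrier W.S)"
proof -
  interpret SSi: tens_alg V.S V.S by (intro tens_alg.intro V.kalg_S)
  define B where "B = j ` carrier W.S"
  let ?B = "V.S\<lparr>carrier := B\<rparr>"
  note img = alg_hom_image[OF W.kalg_S V.kalg_S j(1), folded B_def]
  note BS = img(1) and zero = img(2) and one = img(3) and add = img(4) and mult = img(5) and smult = img(6)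
  have sub: "submodule B scalar_alg V.S"
    by (rule submodule_scalarI[OF V.vS BS zero add smult])
  have vB: "vsp ?B" by (rule submodule.submodule_is_module[OF sub V.vS])
  \<comment> \<open>\<open>B\<close> becomes an algebra in its own right, so that its tensor square
    has a product and \<open>?\<kappa>\<close> is an algebra morphism.\<close>
  have kB: "kalg ?B"
    by (rule kalgI[OF vB]) (use BS one mult in \<open>auto simp: subset_iff SSi.A.m_assoc SSi.A.l_distr SSi.A.r_distr
        SSi.A.smult_mult SSi.A.mult_smult\<close>)
  interpret BB: tens_alg ?B ?B by (intro tens_alg.intro kB)
  have i: "(\<lambda>y. y) \<in> alg_hom ?B V.S"
    by (rule alg_homI[OF lin_mapI]) (use BS in auto)
  let ?\<kappa> = "tensor_map V.S V.S (\<lambda>y. y) (\<lambda>y. y)"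
  define K where "K = ?\<kappa> ` carrier (tensor ?B ?B)"
  have \<kappa>: "?\<kappa> \<in> alg_hom (tensor ?B ?B) SS"
    by (rule tensor_map_alg_hom[OF kB kB V.kalg_S V.kalg_S i i])
  note Kimg = alg_hom_image[OF BB.kalg_tensor SSi.kalg_tensor \<kappa>, folded K_def]
  note K0 = Kimg(2) and K1 = Kimg(3) and Kadd = Kimg(4) and Kmult = Kimg(5) and Ksmult = Kimg(6)
  have Kpure: "pure V.S V.S a b \<in> K" if "a \<in> B" "b \<in> B" for a b
  proof -
    have "?\<kappa> (pure ?B ?B a b) = pure V.S V.S a b"
      using that by (intro tensor_map_lin(2)[OF vB vB V.vS V.vS alg_hom_lin[OF i] alg_hom_lin[OF i]]) auto
    moreover have "pure ?B ?B a b \<in> carrier (tensor ?B ?B)" using that by (intro BB.pure_closed) auto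
    ultimately show ?thesis unfolding K_def by (intro image_eqI[of _ _ "pure ?B ?B a b"]) auto
  qed
  have inc_B: "sym_alg_inc DP (avg_dual v) \<in> B" if "v \<in> carrier DP" for v
    using j(2)[OF avg_dual_closed[OF that]] imageI[OF lin_mapD(1)[OF W.sym_inc_lin avg_dual_closed[OF that]], of j] by (simp add: B_def)
  have pr_B: "V.pr (avgT t) \<in> B" if "t \<in> carrier V.T" for t
    by (rule V.alg_hom_T_in[OF V.kalg_S alg_hom_comp[OF avgT_hom V.pr_hom] one add smult mult _ that])
      (use inc_B in \<open>auto simp: avgT_inc sym_alg_inc_def\<close>)
  \<comment> \<open>This holds for every \<open>X\<close>, so linear induction applies:
    \<open>avg2\<close> sends each pure tensor to one whose two factors project into
    \<open>B\<close>.\<close>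
  have avgK: "pr2 (\<iota> (avg2 X)) \<in> K" if "X \<in> carrier (tensor DP V.T)" for X
    using that
  proof (induction X rule: VT.tensor_induct)
    case zero
    show ?case
      using lin_map_zero[OF VT.vsp_tensor SSi.vsp_tensor lin_map_comp[OF avg2_lin lin_map_comp[OF \<iota>_lin pr2_lin]]] K0
      by simp
  next
    case (pure v t)
    have c: "avg_dual v \<in> carrier DP" "avgT t \<in> carrier V.T"
      using pure lin_mapD(1)[OF avg_dual_lin'] alg_homD(1)[OF avgT_hom] by auto
    show ?case using pure c Kpure[OF inc_B pr_B] by (simp add: avg2_pure \<iota>_pure pr2_pure sym_alg_inc_def)
  next
    case (add Y Z)
    then show ?case
      using Kadd lin_mapD(2)[OF lin_map_comp[OF avg2_lin lin_map_comp[OF \<iota>_lin pr2_lin]]] by simp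
  qed
  have "\<Delta>S (j (W.pr x)) \<in> K" if "x \<in> carrier W.T" for x
  proof (rule W.alg_hom_T_in[OF SSi.kalg_tensor alg_hom_comp[OF W.pr_hom alg_hom_comp[OF j(1) DS(1)]] K1 Kadd Ksmult Kmult _ that])
    fix f assume f: "f \<in> carrier W"
    have "\<Delta>S (j (W.pr (tensor_alg_inc W f))) = \<Delta>S (V.pr (inc f))"
      using j(2)[OF f] by (simp add: sym_alg_inc_def)
    also have "\<dots> = pr2 (\<iota> (avg2 (\<delta> f)))"
      using DS(2)[of "inc f"] W_DP[OF f] by (simp add: Delta_inc pr2_iota_delta[OF f])
    finally show "\<Delta>S (j (W.pr (tensor_alg_inc W f))) \<in> K"
      using avgK[OF delta_closed[OF W_DP[OF f]]] by simp
  qed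
  then have "\<Delta>S ` B \<subseteq> K" using W.pr_surj unfolding B_def by blast
  moreover have "subring B V.S"
  proof (rule SSi.A.subringI[OF BS one])
    show "\<ominus>\<^bsub>V.S\<^esub> h \<in> B" if "h \<in> B" for h
      using SSi.A.submoduleE(3)[OF sub that] .
  qed (use mult add in auto)
  ultimately show ?thesis using sub unfolding subbialgebra_def B_def K_def by simp
qed

lemma ex_bialgebra_subbialgebra:
  "\<exists>\<Delta>S \<epsilon>S.
    (\<forall>x\<in>carrier V.T. \<Delta>S (V.pr x) = pr2 (\<Delta> x)) \<and>
    bialgebra V.S \<Delta>S \<epsilon>S \<and>
    (\<exists>j \<in> alg_hom W.S V.S.
       (\<forall>f\<in>carrier W. j (sym_alg_inc W f) = sym_alg_inc DP f) \<and>
       inj_on j (carrier W.S) \<and>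
       subbialgebra V.S \<Delta>S (j ` carrier W.S))"
proof -
  obtain \<Delta>S where DS: "\<Delta>S \<in> alg_hom V.S SS" "\<And>x. x \<in> carrier V.T \<Longrightarrow> \<Delta>S (V.pr x) = pr2 (\<Delta> x)"
    using V.sym_factor[OF alg_hom_comp[OF Delta_hom pr2_hom] comm_alg_SS] by blast
  obtain \<epsilon>S where ES: "\<epsilon>S \<in> alg_hom V.S scalar_alg" "\<And>x. x \<in> carrier V.T \<Longrightarrow> \<epsilon>S (V.pr x) = eps x"
    using V.sym_factor[OF eps_hom comm_alg_scalar] by blast
  obtain j where j: "j \<in> alg_hom W.S V.S" "\<And>f. f \<in> carrier W \<Longrightarrow> j (sym_alg_inc W f) = sym_alg_inc DP f"
    using W.sym_lift[OF lin_map_comp[OF W_inclusion V.sym_inc_lin] V.comm_alg_S] by blast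
  obtain r where r: "r \<in> alg_hom V.S W.S" "\<And>f. f \<in> carrier DP \<Longrightarrow> r (sym_alg_inc DP f) = sym_alg_inc W (avg_dual f)"
    using V.sym_lift[OF lin_map_comp[OF avg_dual_lin W.sym_inc_lin] W.comm_alg_S] by blast
  have "r (j y) = y" if "y \<in> carrier W.S" for y
    by (rule W.alg_hom_S_eq[OF W.kalg_S alg_hom_comp[OF j(1) r(1)] alg_hom_id _ that])
      (simp add: j(2) r(2) W_DP avg_dual_inv)
  then have "inj_on j (carrier W.S)" by (rule inj_on_inverseI)
  then show ?thesis
    using DS(2) bialgebra_S[OF DS ES] subbialgebra_image[OF DS j] j by blast
qed

end

theorem corollary48:
  fixes scale :: "'k::field_char_0 \<Rightarrow> 'a::ab_group_add \<Rightarrow> 'a"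
    and P :: "nat \<Rightarrow> 'a set"
    and act :: "nat \<Rightarrow> (nat \<Rightarrow> nat) \<Rightarrow> 'a \<Rightarrow> 'a"
    and \<gamma> :: "'a \<Rightarrow> (nat \<times> 'a) list \<Rightarrow> 'a"
    and e :: 'a
  assumes "operad scale P act \<gamma> e"
    and "P 0 = {0}"
    and "\<And>n. \<exists>B. finite B \<and> P n = module.span scale B"
  shows "\<exists>\<Delta> \<epsilon>.
    (\<forall>x\<in>carrier (tensor_alg (dual_operad scale P)).
       \<Delta> (abel_proj (tensor_alg (dual_operad scale P)) x) =
       tensor_map (sym_alg (dual_operad scale P)) (sym_alg (dual_operad scale P))
         (abel_proj (tensor_alg (dual_operad scale P)))
         (abel_proj (tensor_alg (dual_operad scale P)))
         (Delta_star scale P \<gamma> x)) \<and>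
    bialgebra (sym_alg (dual_operad scale P)) \<Delta> \<epsilon> \<and>
    (\<exists>j \<in> alg_hom (sym_alg (inv_dual scale P act)) (sym_alg (dual_operad scale P)).
       (\<forall>f\<in>carrier (inv_dual scale P act).
          j (sym_alg_inc (inv_dual scale P act) f) = sym_alg_inc (dual_operad scale P) f) \<and>
       inj_on j (carrier (sym_alg (inv_dual scale P act))) \<and>
       subbialgebra (sym_alg (dual_operad scale P)) \<Delta> (j ` carrier (sym_alg (inv_dual scale P act))))"
proof -
  interpret operad scale P act \<gamma> e by fact
  interpret operad_char0 scale P act \<gamma> e
    by unfold_locales (use assms(2,3) in auto)
  show ?thesis by (rule ex_bialgebra_subbialgebra)
qed

end
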